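(* Let $T>0$. Let $\mathbf b\in L^\infty((0,T);L^\infty(\mathbb{R}^d;\mathbb{R}^d))$ and $\mathbf a\in L^\infty((0,T);W^{1,\infty}(\mathbb{R}^d;\mathbb{R}^{d\times d}))$ satisfy: for every $i$, $\sum_j\partial_j a_{ij}\in L^\infty([0,T]\times\mathbb{R}^d)$; $(\operatorname{div}\tilde{\mathbf b})^-=\big(\operatorname{div}\mathbf b-\frac12\sum_{i,j}\partial_{ij}a_{ij}\big)^-\in L^\infty([0,T]\times\mathbb{R}^d)$; and there is $\alpha>0$ with $\langle\xi,\mathbf a(t,x)\xi\rangle\ge\alpha|\xi|^2$ for all $\xi\in\mathbb{R}^d$ and a.e. $(t,x)$. Then, for a given initial datum $u_0$, there exists at most one distributional solution $u\in L^2((0,T)\times\mathbb{R}^d)$ of the Fokker–Planck equation with drift $\mathbf b$, diffusion $\mathbf a$ and initial datum $u_0$.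
   Context: The Fokker–Planck equation is $\partial_t u+\operatorname{div}(\mathbf b u)-\frac12\sum_{i,j}\partial_{ij}(a_{ij}u)=0$ in $(0,T)\times\mathbb{R}^d$, $u(0,\cdot)=u_0$, with $u_0\in L^1_{\mathrm{loc}}(\mathbb{R}^d)$. Here $\tilde b_i=b_i-\frac12\sum_j\partial_j a_{ij}$. A function $u\in L^2((0,T)\times\mathbb{R}^d)$ is a distributional solution if for every $\varphi\in C^\infty_c([0,T)\times\mathbb{R}^d)$: $\int_0^T\int_{\mathbb{R}^d}u\big(\partial_t\varphi+\mathbf b\cdot\nabla\varphi+\frac12\sum_{i,j}a_{ij}\partial_{ij}\varphi\big)\,dx\,dt+\int_{\mathbb{R}^d}u_0\varphi(0,\cdot)\,dx=0$. *)

theory Defs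
  imports "HOL-Analysis.Analysis"
begin

fun dpart :: "'a::real_normed_vector list \<Rightarrow> ('a \<Rightarrow> real) \<Rightarrow> 'a \<Rightarrow> real" where
  "dpart [] f = f"
| "dpart (e # es) f = (\<lambda>p. frechet_derivative (dpart es f) (at p) e)"

text \<open>C-infinity on the whole space: all iterated partial derivatives (along basis
  directions) exist everywhere (hence are continuous).\<close>
definition smooth_fun :: "('a::euclidean_space \<Rightarrow> real) \<Rightarrow> bool" where
  "smooth_fun f \<longleftrightarrow> (\<forall>es. set es \<subseteq> Basis \<longrightarrow> (\<forall>p. dpart es f differentiable (at p)))"

definition tsupp :: "('a::topological_space \<Rightarrow> real) \<Rightarrow> 'a set" where
  "tsupp f = closure {p. f p \<noteq> 0}"

definition dt :: "(real \<times> (real ^ 'd) \<Rightarrow> real) \<Rightarrow> real \<times> (real ^ 'd) \<Rightarrow> real" where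
  "dt f p = frechet_derivative f (at p) (1, 0)"

definition dx :: "'d::finite \<Rightarrow> (real \<times> (real ^ 'd) \<Rightarrow> real) \<Rightarrow> real \<times> (real ^ 'd) \<Rightarrow> real" where
  "dx i f p = frechet_derivative f (at p) (0, axis i 1)"

definition test_fun :: "('a::euclidean_space) set \<Rightarrow> ('a \<Rightarrow> real) \<Rightarrow> bool" where
  "test_fun U \<phi> \<longleftrightarrow> smooth_fun \<phi> \<and> compact (tsupp \<phi>) \<and> tsupp \<phi> \<subseteq> U"

text \<open>Test functions in C_c^infinity([0,T) x R^d): restrictions of smooth functions
  with compact support contained in [0,T) x R^d (equivalently, smooth functions on
  the whole space whose support is compact and lies in {t < T}).\<close>
definition test_fun_FP :: "real \<Rightarrow> (real \<times> (real ^ 'd) \<Rightarrow> real) \<Rightarrow> bool" where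
  "test_fun_FP T \<phi> \<longleftrightarrow> smooth_fun \<phi> \<and> compact (tsupp \<phi>) \<and> tsupp \<phi> \<subseteq> {t. t < T} \<times> UNIV"

definition cyl :: "real \<Rightarrow> (real \<times> (real ^ 'd)) set" where
  "cyl T = {0<..<T} \<times> UNIV"

definition ess_bounded_on :: "'a::euclidean_space set \<Rightarrow> ('a \<Rightarrow> real) \<Rightarrow> bool" where
  "ess_bounded_on S f \<longleftrightarrow> f \<in> borel_measurable (lebesgue_on S) \<and>
     (\<exists>C. AE p in lebesgue_on S. \<bar>f p\<bar> \<le> C)"

definition L2_on :: "'a::euclidean_space set \<Rightarrow> ('a \<Rightarrow> real) \<Rightarrow> bool" where
  "L2_on S f \<longleftrightarrow> f \<in> borel_measurable (lebesgue_on S) \<and>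
     integrable (lebesgue_on S) (\<lambda>p. (f p)\<^sup>2)"

definition loc_integrable_on :: "'a::euclidean_space set \<Rightarrow> ('a \<Rightarrow> real) \<Rightarrow> bool" where
  "loc_integrable_on S f \<longleftrightarrow> f \<in> borel_measurable (lebesgue_on S) \<and>
     (\<forall>K. compact K \<and> K \<subseteq> S \<longrightarrow> integrable (lebesgue_on K) f)"

definition weak_dx :: "(real \<times> (real ^ 'd)) set \<Rightarrow> 'd::finite \<Rightarrow> (real \<times> (real ^ 'd) \<Rightarrow> real)
     \<Rightarrow> (real \<times> (real ^ 'd) \<Rightarrow> real) \<Rightarrow> bool" where
  "weak_dx U k f g \<longleftrightarrow> loc_integrable_on U f \<and> loc_integrable_on U g \<and>
     (\<forall>\<phi>. test_fun U \<phi> \<longrightarrow>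
        integral\<^sup>L (lebesgue_on U) (\<lambda>p. f p * dx k \<phi> p) = - integral\<^sup>L (lebesgue_on U) (\<lambda>p. g p * \<phi> p))"

definition FP_solution :: "real \<Rightarrow> ('d::finite \<Rightarrow> real \<times> (real ^ 'd) \<Rightarrow> real)
     \<Rightarrow> ('d \<Rightarrow> 'd \<Rightarrow> real \<times> (real ^ 'd) \<Rightarrow> real) \<Rightarrow> (real ^ 'd \<Rightarrow> real)
     \<Rightarrow> (real \<times> (real ^ 'd) \<Rightarrow> real) \<Rightarrow> bool" where
  "FP_solution T b a u0 u \<longleftrightarrow> L2_on (cyl T) u \<and>
     (\<forall>\<phi>. test_fun_FP T \<phi> \<longrightarrow>
        integral\<^sup>L (lebesgue_on (cyl T))
          (\<lambda>p. u p * (dt \<phi> p + (\<Sum>i\<in>UNIV. b i p * dx i \<phi> p)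
                 + (1/2) * (\<Sum>i\<in>UNIV. \<Sum>j\<in>UNIV. a i j p * dx i (dx j \<phi>) p)))
        + integral\<^sup>L lebesgue (\<lambda>x. u0 x * \<phi> (0, x)) = 0)"

end

theory Submission
  imports Defs
begin

text \<open>
  Let \<open>w\<close> be the difference of two solutions and \<open>w\<^sub>n = \<rho>\<^sub>n * w\<close> its mollification in space. For fixed \<open>x\<close> the
  equation tested with \<open>\<theta>(t) \<rho>\<^sub>n(x - y)\<close> says that \<open>w\<^sub>n(\<cdot>, x)\<close> is absolutely continuous with \<open>w\<^sub>n(0, x) = 0\<close> and
  \<open>\<partial>\<^sub>t w\<^sub>n = - \<partial>\<^sub>i (\<rho>\<^sub>n * (b\<^sub>i w)) + \<partial>\<^sub>i\<^sub>j (\<rho>\<^sub>n * (a\<^sub>i\<^sub>j w)) / 2\<close>. Multiply by \<open>w\<^sub>n\<close> and integrate by parts. Since \<open>a\<close> is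
  Lipschitz in \<open>x\<close>, the commutator \<open>\<partial>\<^sub>j \<rho>\<^sub>n * (a\<^sub>i\<^sub>j w) - a\<^sub>i\<^sub>j (\<partial>\<^sub>j \<rho>\<^sub>n * w)\<close> is bounded in \<open>L\<^sup>2\<close> by a multiple of \<open>w\<close>,
  uniformly in \<open>n\<close>, and ellipticity absorbs \<open>\<nabla>w\<^sub>n\<close>; so the time derivative of \<open>\<parallel>w\<^sub>n(t)\<parallel>\<^sup>2\<close> is at most \<open>2 C \<parallel>w(t)\<parallel>\<^sup>2\<close>. With
  the weight \<open>exp (- \<mu> t)\<close> and \<open>n \<rightarrow> \<infinity>\<close> this gives \<open>E \<le> (2 C / \<mu>) E\<close> for the weighted energy \<open>E\<close> of \<open>w\<close>, hence
  \<open>E = 0\<close> once \<open>\<mu>\<close> is large.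
\<close>

section \<open>Smooth functions of one variable and their tensor products\<close>

text \<open>Mollifying in space only turns the equation, for each fixed \<open>x\<close>, into an
  ordinary differential equation in \<open>t\<close> with integrable right-hand side. The test
  functions need not vanish at \<open>t = 0\<close>, and this is how the zero initial value enters.
  The second-order term shapes the estimate: after one integration by parts it still contains a
  derivative of a mollified product in which \<open>w\<close> is merely square integrable. In the
  commutator the Lipschitz bound supplies a factor \<open>|x - y|\<close>, which compensates exactly
  for the growth of the differentiated mollifier; the error is therefore bounded, though not shown
  to be small. The price is that the energy inequality has \<open>w\<close> and not the mollified
  function on its right-hand side, so Gronwall's lemma cannot be applied directly at a fixed scale.
  The exponential weight takes its place: its integral from \<open>s\<close> to \<open>T\<close> is
  at most the weight at \<open>s\<close> divided by \<mu>, and mean-square convergence of the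
  mollifications then closes the estimate. The energy itself is never differentiated in time: the
  square of a primitive is rewritten by Fubini's theorem.\<close>

definition smooth1 :: "(real \<Rightarrow> real) \<Rightarrow> bool" where
  "smooth1 f \<longleftrightarrow> (\<forall>n x. ((deriv ^^ n) f has_field_derivative (deriv ^^ Suc n) f x) (at x))"

text \<open>Derivatives are unique, so the \<open>g'\<close> provided by \<open>step\<close> must be
  \<open>deriv g\<close>, and \<open>P\<close> passes to all iterated derivatives. Smoothness can
  thus be proved by naming a class closed under one differentiation, without a formula for the n-th
  derivative.\<close>

lemma smooth1_coinduct:
  assumes "P f" and step: "\<And>g. P g \<Longrightarrow> \<exists>g'. P g' \<and> (\<forall>x. (g has_field_derivative g' x) (at x))"
  shows "smooth1 f"
proof -
  have *: "P (deriv g) \<and> (\<forall>x. (g has_field_derivative deriv g x) (at x))" if g: "P g" for g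
  proof -
    obtain g' where g': "P g'" "\<And>x. (g has_field_derivative g' x) (at x)"
      using step[OF g] by blast
    then have "deriv g = g'"
      by (intro ext DERIV_imp_deriv)
    then show ?thesis using g' by simp
  qed
  have "P ((deriv ^^ n) f)" for n
    by (induction n) (use assms(1) * in auto)
  then show ?thesis
    unfolding smooth1_def using * by simp
qed

lemma smooth1_deriv: "smooth1 f \<Longrightarrow> smooth1 (deriv f)"
  unfolding smooth1_def
proof (intro allI)
  fix n x
  assume "\<forall>n x. ((deriv ^^ n) f has_field_derivative (deriv ^^ Suc n) f x) (at x)"
  then have "((deriv ^^ Suc n) f has_field_derivative (deriv ^^ Suc (Suc n)) f x) (at x)" by blast
  then show "((deriv ^^ n) (deriv f) has_field_derivative (deriv ^^ Suc n) (deriv f) x) (at x)"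
    by (simp add: funpow_swap1)
qed

lemma smooth1_funpow_deriv: "smooth1 f \<Longrightarrow> smooth1 ((deriv ^^ n) f)"
  by (induction n) (auto intro: smooth1_deriv)

lemma smooth1_DERIV: "smooth1 f \<Longrightarrow> (f has_field_derivative deriv f x) (at x)"
  unfolding smooth1_def by (drule spec[of _ 0]) simp

lemma smooth1_continuous: "smooth1 f \<Longrightarrow> continuous_on S f"
  by (meson DERIV_isCont continuous_at_imp_continuous_on smooth1_DERIV)

lemma smooth1_borel [measurable_dest]: "smooth1 f \<Longrightarrow> f \<in> borel_measurable borel"
  by (simp add: borel_measurable_continuous_onI smooth1_continuous)

text \<open>A class closed under differentiation by the sum, product and chain rules, made for
  \<open>smooth1_coinduct\<close>; it replaces the Leibniz formula for iterated derivatives of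
  products.\<close>

inductive smooth_alg :: "(real \<Rightarrow> real) \<Rightarrow> bool" where
  base: "smooth1 f \<Longrightarrow> smooth_alg (\<lambda>x. f (c * x + d))"
| const: "smooth_alg (\<lambda>_. c)"
| add: "smooth_alg f \<Longrightarrow> smooth_alg g \<Longrightarrow> smooth_alg (\<lambda>x. f x + g x)"
| mult: "smooth_alg f \<Longrightarrow> smooth_alg g \<Longrightarrow> smooth_alg (\<lambda>x. f x * g x)"

lemma smooth_alg_smooth1: "smooth_alg f \<Longrightarrow> smooth1 f"
proof (erule smooth1_coinduct[where P = smooth_alg])
  show "\<exists>g'. smooth_alg g' \<and> (\<forall>x. (g has_field_derivative g' x) (at x))" if "smooth_alg g" for g
    using that
  proof induction
    case (base f c d)
    have "smooth_alg (\<lambda>x. c * deriv f (c * x + d))"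
      by (intro smooth_alg.intros smooth1_deriv base)
    moreover have "((\<lambda>x. f (c * x + d)) has_field_derivative c * deriv f (c * x + d)) (at x)" for x
    proof -
      have "((\<lambda>x. c * x + d) has_field_derivative c) (at x)"
        by (auto intro!: derivative_eq_intros)
      from DERIV_chain2[OF smooth1_DERIV[OF base] this] show ?thesis
        by (simp add: mult.commute)
    qed
    ultimately show ?case by blast
  next
    case (const c)
    show ?case by (rule exI[of _ "\<lambda>_. 0"]) (auto intro: smooth_alg.const)
  next
    case (add f g)
    then obtain f' g' where "smooth_alg f'" "smooth_alg g'"
      "\<And>x. (f has_field_derivative f' x) (at x)" "\<And>x. (g has_field_derivative g' x) (at x)"
      by blast
    then show ?case
      by (intro exI[of _ "\<lambda>x. f' x + g' x"]) (auto intro: smooth_alg.intros DERIV_add)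
  next
    case (mult f g)
    then obtain f' g' where "smooth_alg f'" "smooth_alg g'"
      "\<And>x. (f has_field_derivative f' x) (at x)" "\<And>x. (g has_field_derivative g' x) (at x)"
      by blast
    then show ?case
      using mult by (intro exI[of _ "\<lambda>x. f' x * g x + g' x * f x"])
        (auto intro!: smooth_alg.intros DERIV_mult)
  qed
qed

lemma smooth1_imp_alg: "smooth1 f \<Longrightarrow> smooth_alg f"
  by (drule smooth_alg.base[where c = 1 and d = 0], simp)

lemma smooth1_affine: "smooth1 f \<Longrightarrow> smooth1 (\<lambda>x. f (c * x + d))"
  by (rule smooth_alg_smooth1, rule smooth_alg.base[of f])

lemma smooth1_const: "smooth1 (\<lambda>_. c)"
  by (rule smooth_alg_smooth1[OF smooth_alg.const])

lemma smooth1_add: "smooth1 f \<Longrightarrow> smooth1 g \<Longrightarrow> smooth1 (\<lambda>x. f x + g x)"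
  by (rule smooth_alg_smooth1[OF smooth_alg.add[OF smooth1_imp_alg smooth1_imp_alg]])

lemma smooth1_mult: "smooth1 f \<Longrightarrow> smooth1 g \<Longrightarrow> smooth1 (\<lambda>x. f x * g x)"
  by (rule smooth_alg_smooth1[OF smooth_alg.mult[OF smooth1_imp_alg smooth1_imp_alg]])

text \<open>The class consisting of \<open>F\<close> and all smooth functions is closed under
  differentiation.\<close>

lemma smooth1_antideriv:
  assumes "smooth1 f" "\<And>x. (F has_field_derivative f x) (at x)"
  shows "smooth1 F"
proof (rule smooth1_coinduct[where P = "\<lambda>h. h = F \<or> smooth1 h"])
  fix g assume "g = F \<or> smooth1 g"
  then show "\<exists>g'. (g' = F \<or> smooth1 g') \<and> (\<forall>x. (g has_field_derivative g' x) (at x))"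
  proof
    assume "g = F"
    then show ?thesis using assms by (intro exI[of _ f]) auto
  next
    assume "smooth1 g"
    then show ?thesis by (intro exI[of _ "deriv g"]) (auto intro: smooth1_deriv smooth1_DERIV)
  qed
qed simp

text \<open>Arbitrary polynomials \<open>p\<close> are allowed because this family is closed under differentiation.\<close>

definition flat :: "real poly \<Rightarrow> real \<Rightarrow> real" where
  "flat p x = (if x > 0 then poly p (1/x) * exp (- (1/x)) else 0)"

lemma poly_exp_tendsto_0: "((\<lambda>y::real. poly p y * exp (- y)) \<longlongrightarrow> 0) at_top"
proof -
  have "((\<lambda>y::real. \<Sum>i\<le>degree p. coeff p i * (y ^ i / exp y)) \<longlongrightarrow> (\<Sum>i\<le>degree p. coeff p i * 0)) at_top"
    by (intro tendsto_intros tendsto_power_div_exp_0)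
  then show ?thesis
    by (simp add: poly_altdef sum_distrib_right exp_minus divide_inverse mult.assoc)
qed

text \<open>The chain rule produces the factor \<open>1/x^2\<close>, which is the polynomial
  \<open>[:0,0,1:]\<close> evaluated at \<open>1/x\<close>. At the origin the difference quotient
  has to tend to 0.\<close>

lemma flat_DERIV: "(flat p has_field_derivative flat ([:0,0,1:] * (p - pderiv p)) x) (at x)"
proof -
  consider "x > 0" | "x < 0" | "x = 0" by linarith
  then show ?thesis
  proof cases
    case 1
    have "((\<lambda>x. poly p (1/x) * exp (- (1/x))) has_field_derivative flat ([:0,0,1:] * (p - pderiv p)) x) (at x)"
      using 1 by (auto intro!: derivative_eq_intros poly_DERIV[THEN DERIV_chain2]
          simp: flat_def field_simps power2_eq_square)
    then show ?thesis
      by (rule DERIV_cong_ev[THEN iffD1, rotated -1]) (use 1 in \<open>auto simp: flat_def eventually_nhds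
          intro!: exI[of _ "{0<..}"]\<close>)
  next
    case 2
    have "((\<lambda>x. 0) has_field_derivative flat ([:0,0,1:] * (p - pderiv p)) x) (at x)"
      using 2 by (auto simp: flat_def)
    then show ?thesis
      by (rule DERIV_cong_ev[THEN iffD1, rotated -1]) (use 2 in \<open>auto simp: flat_def eventually_nhds
          intro!: exI[of _ "{..<0}"]\<close>)
  next
    case 3
    \<comment> \<open>For \<open>h > 0\<close> the quotient is \<open>pCons 0 p\<close> at
      \<open>1/h\<close>, times \<open>exp (- 1/h)\<close>; exponential decay beats the
      polynomial.\<close>
    have "((\<lambda>h. flat p h / h) \<longlongrightarrow> 0) (at_right 0)"
    proof -
      have "((\<lambda>y::real. poly (pCons 0 p) y * exp (- y)) \<longlongrightarrow> 0) at_top"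
        by (rule poly_exp_tendsto_0)
      then have "((\<lambda>h::real. poly (pCons 0 p) (inverse h) * exp (- inverse h)) \<longlongrightarrow> 0) (at_right 0)"
        by (rule filterlim_compose) (rule filterlim_inverse_at_top_right)
      then show ?thesis
        by (rule Lim_transform_eventually)
           (auto simp: eventually_at flat_def field_simps intro!: exI[of _ 1])
    qed
    moreover have "((\<lambda>h. flat p h / h) \<longlongrightarrow> 0) (at_left 0)"
      by (rule Lim_transform_eventually[OF tendsto_const])
         (auto simp: eventually_at flat_def intro!: exI[of _ 1])
    ultimately have "((\<lambda>h. flat p h / h) \<longlongrightarrow> 0) (at 0)"
      by (simp add: filterlim_at_split)
    then show ?thesis
      using 3 by (simp add: DERIV_def flat_def)
  qed
qed

lemma smooth1_flat: "smooth1 (flat p)"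
  by (rule smooth1_coinduct[where P = "\<lambda>h. \<exists>p. h = flat p"]) (auto intro: flat_DERIV)

text \<open>For \<open>n > 0\<close> this is positive exactly on the open interval from
  \<open>l\<close> to \<open>u\<close>. The factor \<open>n\<close> sets the steepness of the edges,
  so letting it grow gives the indicator of the interval, with the constant 1 as a bound
  throughout.\<close>

definition bump :: "real \<Rightarrow> real \<Rightarrow> real \<Rightarrow> real \<Rightarrow> real" where
  "bump n l u t = flat 1 (n * (t - l)) * flat 1 (n * (u - t))"

lemma smooth1_bump: "smooth1 (bump n l u)"
proof -
  have "smooth1 (\<lambda>t. flat 1 (n * t + (- n * l)) * flat 1 ((- n) * t + n * u))"
    by (rule smooth1_mult; rule smooth1_affine[of "flat 1"]; rule smooth1_flat)
  moreover have "bump n l u = (\<lambda>t. flat 1 (n * t + (- n * l)) * flat 1 ((- n) * t + n * u))"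
    unfolding bump_def by (intro ext arg_cong2[where f = "(*)"] arg_cong[where f = "flat 1"])
      (simp_all add: right_diff_distrib)
  ultimately show ?thesis by simp
qed

lemma bump_nonneg: "0 \<le> bump n l u t"
  by (simp add: bump_def flat_def)

lemma bump_le_1: "bump n l u t \<le> 1"
  by (simp add: bump_def flat_def mult_le_one)

lemma bump_eq_0: "n > 0 \<Longrightarrow> t \<notin> {l<..<u} \<Longrightarrow> bump n l u t = 0"
  by (auto simp: bump_def flat_def zero_less_mult_iff)

lemma bump_pos: "n > 0 \<Longrightarrow> t \<in> {l<..<u} \<Longrightarrow> bump n l u t > 0"
  by (auto simp: bump_def flat_def)

lemma bump_tendsto: "(\<lambda>n. bump (real (Suc n)) l u t) \<longlonglongrightarrow> indicator {l<..<u} t"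
proof (cases "t \<in> {l<..<u}")
  case True
  have *: "(\<lambda>n. flat 1 (real (Suc n) * d)) \<longlonglongrightarrow> 1" if "d > 0" for d
  proof -
    have "(\<lambda>n. exp (- (1/d) * inverse (real (Suc n)))) \<longlonglongrightarrow> exp (- (1/d) * 0)"
      by (intro tendsto_intros LIMSEQ_inverse_real_of_nat)
    moreover have "flat 1 (real (Suc n) * d) = exp (- (1/d) * inverse (real (Suc n)))" for n
      using that by (simp add: flat_def add_pos_pos divide_inverse)
    ultimately show ?thesis by simp
  qed
  have "(\<lambda>n. flat 1 (real (Suc n) * (t - l)) * flat 1 (real (Suc n) * (u - t))) \<longlonglongrightarrow> 1 * 1"
    by (intro tendsto_mult *) (use True in auto)
  then show ?thesis using True by (simp add: bump_def)
next
  case False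
  then show ?thesis by (simp add: bump_eq_0 del: of_nat_Suc)
qed

text \<open>Test functions are built with one factor per basis vector: a partial derivative then
  only replaces one factor by its derivative, so all iterated partial derivatives keep the same form
  and smoothness reduces to one variable.\<close>

definition tens :: "('a::euclidean_space \<Rightarrow> real \<Rightarrow> real) \<Rightarrow> 'a \<Rightarrow> real" where
  "tens f p = (\<Prod>b\<in>Basis. f b (p \<bullet> b))"

lemma has_derivative_tens:
  assumes "\<And>b. b \<in> Basis \<Longrightarrow> smooth1 (f b)"
  shows "(tens f has_derivative (\<lambda>h. \<Sum>b\<in>Basis. (h \<bullet> b) * tens (f(b := deriv (f b))) p)) (at p)"
proof -
  have "((\<lambda>p. f b (p \<bullet> b)) has_derivative (\<lambda>h. deriv (f b) (p \<bullet> b) * (h \<bullet> b))) (at p)" if "b \<in> Basis" for b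
  proof -
    have "(f b has_derivative (*) (deriv (f b) (p \<bullet> b))) (at (p \<bullet> b))"
      using smooth1_DERIV[OF assms[OF that]] by (simp add: has_field_derivative_def)
    moreover have "((\<lambda>p. p \<bullet> b) has_derivative (\<lambda>h. h \<bullet> b)) (at p)"
      by (auto intro!: derivative_eq_intros)
    ultimately show ?thesis
      using has_derivative_compose[of "\<lambda>p. p \<bullet> b" _ p UNIV "f b"] by auto
  qed
  then have "(tens f has_derivative
      (\<lambda>h. \<Sum>b\<in>Basis. deriv (f b) (p \<bullet> b) * (h \<bullet> b) * (\<Prod>c\<in>Basis - {b}. f c (p \<bullet> c)))) (at p)"
    unfolding tens_def[abs_def] by (rule has_derivative_prod)
  moreover have "tens (f(b := deriv (f b))) p = deriv (f b) (p \<bullet> b) * (\<Prod>c\<in>Basis - {b}. f c (p \<bullet> c))"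
    if "b \<in> Basis" for b
    unfolding tens_def by (subst prod.remove[OF finite_Basis that]) auto
  ultimately show ?thesis
    by (simp add: mult_ac cong: sum.cong)
qed

lemma frechet_derivative_tens:
  assumes "\<And>b. b \<in> Basis \<Longrightarrow> smooth1 (f b)" "e \<in> Basis"
  shows "frechet_derivative (tens f) (at p) e = tens (f(e := deriv (f e))) p"
proof -
  have "frechet_derivative (tens f) (at p) = (\<lambda>h. \<Sum>b\<in>Basis. (h \<bullet> b) * tens (f(b := deriv (f b))) p)"
    by (rule frechet_derivative_at[symmetric], rule has_derivative_tens, rule assms)
  moreover have "(\<Sum>b\<in>Basis. (e \<bullet> b) * tens (f(b := deriv (f b))) p)
      = (\<Sum>b\<in>Basis. if e = b then tens (f(b := deriv (f b))) p else 0)"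
    using assms(2) by (intro sum.cong) (auto simp: inner_Basis)
  ultimately show ?thesis
    using assms(2) by (simp add: sum.delta')
qed

lemma smooth_fun_tens:
  assumes "\<And>b. b \<in> Basis \<Longrightarrow> smooth1 (f b)"
  shows "smooth_fun (tens f)"
proof -
  have "\<exists>g. (\<forall>b\<in>Basis. smooth1 (g b)) \<and> dpart es (tens f) = tens g" if "set es \<subseteq> Basis" for es
    using that
  proof (induction es)
    case Nil
    then show ?case using assms by auto
  next
    case (Cons e es)
    then obtain g where g: "\<forall>b\<in>Basis. smooth1 (g b)" "dpart es (tens f) = tens g" by auto
    have e: "e \<in> Basis" using Cons.prems by simp
    have "dpart (e # es) (tens f) = tens (g(e := deriv (g e)))"
      by (intro ext) (use g frechet_derivative_tens[of g e] e in simp)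
    moreover have "\<forall>b\<in>Basis. smooth1 ((g(e := deriv (g e))) b)"
      using g e by (simp add: smooth1_deriv)
    ultimately show ?case by blast
  qed
  moreover have "tens g differentiable (at p)" if "\<forall>b\<in>Basis. smooth1 (g b)" for g :: "'a \<Rightarrow> real \<Rightarrow> real" and p
    unfolding differentiable_def by (rule exI, rule has_derivative_tens) (use that in auto)
  ultimately show ?thesis
    unfolding smooth_fun_def by fastforce
qed

lemma tsupp_tens_subset:
  assumes "\<And>b t. b \<in> Basis \<Longrightarrow> t \<notin> {l \<bullet> b..u \<bullet> b} \<Longrightarrow> f b t = 0"
  shows "tsupp (tens f) \<subseteq> cbox l u"
  unfolding tsupp_def
proof (rule closure_minimal)
  show "{p. tens f p \<noteq> 0} \<subseteq> cbox l u"
  proof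
    fix p assume "p \<in> {p. tens f p \<noteq> 0}"
    then have "f b (p \<bullet> b) \<noteq> 0" if "b \<in> Basis" for b
      using that by (auto simp: tens_def)
    then show "p \<in> cbox l u"
      using assms by (force simp: mem_box)
  qed
qed (rule closed_cbox)

lemma test_fun_tens:
  assumes "\<And>b. b \<in> Basis \<Longrightarrow> smooth1 (f b)"
    and "\<And>b t. b \<in> Basis \<Longrightarrow> t \<notin> {l \<bullet> b..u \<bullet> b} \<Longrightarrow> f b t = 0" and "cbox l u \<subseteq> U"
  shows "test_fun U (tens f)"
proof -
  have "tsupp (tens f) \<subseteq> cbox l u" using assms(2) by (rule tsupp_tens_subset)
  moreover have "closed (tsupp (tens f))" by (simp add: tsupp_def)
  ultimately have "compact (tsupp (tens f))"
    by (metis bounded_cbox bounded_subset compact_eq_bounded_closed)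
  with \<open>tsupp (tens f) \<subseteq> cbox l u\<close> show ?thesis
    using assms by (auto simp: test_fun_def smooth_fun_tens)
qed

section \<open>The fundamental lemma of the calculus of variations\<close>

text \<open>\<open>ennreal\<close> truncates at 0, so \<open>ennreal (f x)\<close> and
  \<open>ennreal (- f x)\<close> are the positive and the negative part of \<open>f\<close>. The
  measures with these densities agree on open boxes, an intersection-stable generator of the Borel
  sets, and therefore coincide; equal positive and negative parts must both vanish.\<close>

lemma AE_eq_0_if_box_integrals_0:
  fixes f :: "'a::euclidean_space \<Rightarrow> real"
  assumes f: "integrable lborel f"
    and box: "\<And>l u. (LBINT x. f x * indicator (box l u) x) = 0"
  shows "AE x in lborel. f x = 0"
proof -
  have [measurable]: "f \<in> borel_measurable borel" using f by simp
  have fin: "(\<integral>\<^sup>+x. ennreal (f x * indicator (box l u) x) \<partial>lborel) < \<infinity> \<and>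
      (\<integral>\<^sup>+x. ennreal (- (f x * indicator (box l u) x)) \<partial>lborel) < \<infinity>" for l u :: 'a
    using integrable_mult_indicator[OF _ f, of "box l u"]
    by (auto simp: real_integrable_def mult.commute less_top)
  have eq: "(\<integral>\<^sup>+x. ennreal (f x * indicator (box l u) x) \<partial>lborel)
      = (\<integral>\<^sup>+x. ennreal (- (f x * indicator (box l u) x)) \<partial>lborel)" for l u :: 'a
  proof -
    have "integrable lborel (\<lambda>x. f x * indicator (box l u) x)"
      using integrable_mult_indicator[OF _ f, of "box l u"] by (simp add: mult.commute)
    from real_lebesgue_integral_def[OF this] box[of l u] fin[of l u] show ?thesis
      by (metis eq_iff_diff_eq_0 ennreal_enn2real infinity_ennreal_def)
  qed
  have ind: "ennreal (c x) * indicator S x = ennreal (c x * indicator S x)" for c S and x :: 'a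
    by (simp split: split_indicator)
  have "density lborel (\<lambda>x. ennreal (f x)) = density lborel (\<lambda>x. ennreal (- f x))" (is "?M = ?N")
  proof (rule measure_eqI_generator_eq)
    let ?E = "range (\<lambda>(a, b). box a b::'a set)"
    show "Int_stable ?E"
      by (auto simp: Int_stable_def box_Int_box)
    show "?E \<subseteq> Pow UNIV" "sets ?M = sigma_sets UNIV ?E" "sets ?N = sigma_sets UNIV ?E"
      by (simp_all add: borel_eq_box)
    let ?A = "\<lambda>n::nat. box (- (real n *\<^sub>R One)) (real n *\<^sub>R One) :: 'a set"
    show "range ?A \<subseteq> ?E" "(\<Union>i. ?A i) = UNIV"
      unfolding UN_box_eq_UNIV by auto
    show "emeasure ?M (?A i) \<noteq> \<infinity>" for i
      using fin by (simp add: emeasure_density ind less_top)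
    show "emeasure ?M X = emeasure ?N X" if "X \<in> ?E" for X
      using that eq by (auto simp: emeasure_density ind ind[of "\<lambda>x. - f x", simplified])
  qed
  then have "AE x in lborel. ennreal (f x) = ennreal (- f x)"
    by (intro sigma_finite_measure.density_unique[OF lborel.sigma_finite_measure_axioms]) auto
  then show ?thesis
    by eventually_elim (metis add_0 add_uminus_conv_diff diff_ge_0_iff_ge ennreal_eq_0_iff
        ennreal_inj linorder_linear neg_0_le_iff_le neg_equal_0_iff_equal order_antisym_conv)
qed

lemma box_subset_imp_cbox_subset:
  fixes l u c d :: "'a::euclidean_space"
  assumes "box l u \<subseteq> box c d" "box l u \<noteq> {}"
  shows "cbox l u \<subseteq> cbox c d"
  by (metis assms box_subset_cbox closed_cbox closure_box closure_minimal subset_trans)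

definition box_bump :: "nat \<Rightarrow> 'a::euclidean_space \<Rightarrow> 'a \<Rightarrow> 'a \<Rightarrow> real" where
  "box_bump n l u = tens (\<lambda>b. bump (real (Suc n)) (l \<bullet> b) (u \<bullet> b))"

lemma box_bump_nonneg: "0 \<le> box_bump n l u p"
  by (simp add: box_bump_def tens_def prod_nonneg bump_nonneg)

lemma box_bump_le_1: "box_bump n l u p \<le> 1"
  by (simp add: box_bump_def tens_def prod_le_1 bump_nonneg bump_le_1)

lemma box_bump_eq_0: "p \<notin> box l u \<Longrightarrow> box_bump n l u p = 0"
  by (auto simp: box_bump_def tens_def mem_box intro!: bump_eq_0)

lemma box_bump_le: "box_bump n l u p \<le> indicator (box l u) p"
  by (simp add: box_bump_eq_0 box_bump_le_1 indicator_def)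

lemma box_bump_tendsto: "(\<lambda>n. box_bump n l u p) \<longlonglongrightarrow> indicator (box l u) p"
proof -
  have "(\<lambda>n. box_bump n l u p) \<longlonglongrightarrow> (\<Prod>b\<in>Basis. indicator {l \<bullet> b<..<u \<bullet> b} (p \<bullet> b))"
    unfolding box_bump_def tens_def by (intro tendsto_prod bump_tendsto)
  also have "(\<Prod>b\<in>Basis. indicator {l \<bullet> b<..<u \<bullet> b} (p \<bullet> b)) = (indicator (box l u) p :: real)"
    by (auto simp: indicator_def mem_box)
  finally show ?thesis .
qed

lemma continuous_on_tens:
  "(\<And>b. b \<in> Basis \<Longrightarrow> smooth1 (f b)) \<Longrightarrow> continuous_on S (tens f)"
  by (meson continuous_at_imp_continuous_on has_derivative_continuous has_derivative_tens)

lemma box_bump_borel [measurable]: "box_bump n l u \<in> borel_measurable borel"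
  unfolding box_bump_def
  by (intro borel_measurable_continuous_onI continuous_on_tens smooth1_bump)

text \<open>Dominated convergence turns the bumps into indicators of open boxes, so the preceding
  criterion applies to \<open>f\<close> cut off to a box inside \<open>U\<close>. Countably many
  closed boxes exhaust \<open>U\<close>.\<close>

lemma AE_eq_0_if_bump_integrals_0:
  fixes f :: "'a::euclidean_space \<Rightarrow> real"
  assumes U: "open U" and [measurable]: "f \<in> borel_measurable borel"
    and int: "\<And>l u. cbox l u \<subseteq> U \<Longrightarrow> integrable lborel (\<lambda>x. f x * indicator (cbox l u) x)"
    and zero: "\<And>n l u. cbox l u \<subseteq> U \<Longrightarrow> (LBINT x. f x * box_bump n l u x) = 0"
  shows "AE x in lborel. x \<in> U \<longrightarrow> f x = 0"
proof -
  have box0: "(LBINT x. f x * indicator (box l u) x) = 0" if lu: "cbox l u \<subseteq> U" for l u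
  proof -
    have "(\<lambda>n. LBINT x. f x * box_bump n l u x) \<longlonglongrightarrow> (LBINT x. f x * indicator (box l u) x)"
    proof (rule integral_dominated_convergence[where w = "\<lambda>x. \<bar>f x * indicator (cbox l u) x\<bar>"])
      show "integrable lborel (\<lambda>x. \<bar>f x * indicator (cbox l u) x\<bar>)"
        using int[OF lu] by simp
      show "AE x in lborel. (\<lambda>n. f x * box_bump n l u x) \<longlonglongrightarrow> f x * indicator (box l u) x"
        by (intro AE_I2 tendsto_intros box_bump_tendsto)
      show "AE x in lborel. norm (f x * box_bump n l u x) \<le> \<bar>f x * indicator (cbox l u) x\<bar>" for n
      proof (intro AE_I2)
        fix x
        have "box_bump n l u x \<le> indicator (cbox l u) x"
          using box_bump_le[of n l u x] box_subset_cbox[of l u]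
          by (auto simp: indicator_def of_bool_def split: if_splits)
        then show "norm (f x * box_bump n l u x) \<le> \<bar>f x * indicator (cbox l u) x\<bar>"
          using box_bump_nonneg[of n l u x] by (auto simp: abs_mult intro!: mult_left_mono)
      qed
    qed auto
    then show ?thesis using zero[OF lu] by (simp add: LIMSEQ_const_iff)
  qed
  have AE_box: "AE x in lborel. x \<in> cbox c d \<longrightarrow> f x = 0" if cd: "cbox c d \<subseteq> U" for c d
  proof -
    have "AE x in lborel. f x * indicator (box c d) x = 0"
    proof (rule AE_eq_0_if_box_integrals_0)
      have "integrable lborel (\<lambda>x. indicator (box c d) x *\<^sub>R (f x * indicator (cbox c d) x))"
        by (rule integrable_mult_indicator) (use int[OF cd] in auto)
      then show "integrable lborel (\<lambda>x. f x * indicator (box c d) x)"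
        by (rule back_subst[where P = "integrable lborel"])
           (use box_subset_cbox[of c d] in \<open>auto simp: indicator_def fun_eq_iff\<close>)
      fix a b
      obtain l u where lu: "box a b \<inter> box c d = box l u"
        using box_Int_box by blast
      have eq: "f x * indicator (box c d) x * indicator (box a b) x = f x * indicator (box l u) x" for x
        unfolding lu[symmetric] by (simp add: indicator_inter_arith)
      show "(LBINT x. f x * indicator (box c d) x * indicator (box a b) x) = 0"
      \<comment> \<open>The corners of an empty intersection carry no information, so
        \<open>cbox l u\<close> need not lie in \<open>U\<close>; the integral is then trivially
        0.\<close>
      proof (cases "box l u = {}")
        case True
        then show ?thesis by (simp add: eq)
      next
        case False
        then have "cbox l u \<subseteq> U"
          using box_subset_imp_cbox_subset[of l u c d] lu cd by blast
        then show ?thesis by (simp add: eq box0)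
      qed
    qed
    moreover have "AE x in lborel. x \<notin> cbox c d - box c d"
      by (rule AE_not_in[OF null_sets_cbox_Diff_box])
    ultimately show ?thesis by eventually_elim (auto simp: indicator_def split: if_splits)
  qed
  obtain D where D: "countable D" "D \<subseteq> Pow U" "\<And>X. X \<in> D \<Longrightarrow> \<exists>a b. X = cbox a b" "\<Union>D = U"
    using open_countable_Union_open_cbox[OF U] by metis
  have "AE x in lborel. \<forall>X\<in>D. x \<in> X \<longrightarrow> f x = 0"
    unfolding AE_ball_countable[OF D(1)] using D(2,3) AE_box by fast
  then show ?thesis
    by eventually_elim (use D(4) in blast)
qed

section \<open>Integration of a weak ordinary differential equation\<close>

lemma smooth1_has_antideriv:
  assumes "smooth1 f"
  obtains F where "smooth1 F" "\<And>x. (F has_field_derivative f x) (at x)"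
proof -
  obtain F where F: "\<And>x. (F has_vector_derivative f x) (at x)"
    using einterval_antiderivative[of "-\<infinity>" "\<infinity>" f] assms smooth1_DERIV DERIV_isCont by force
  then have "(F has_field_derivative f x) (at x)" for x
    by (simp add: has_real_derivative_iff_has_vector_derivative)
  with assms show ?thesis using smooth1_antideriv that by blast
qed

lemma antideriv_const_right:
  fixes F :: "real \<Rightarrow> real"
  assumes "\<And>x. (F has_field_derivative f x) (at x)" "\<And>x. x \<ge> c \<Longrightarrow> f x = 0" "x \<ge> c"
  shows "F x = F c"
proof (cases "x = c")
  case False
  then show ?thesis
    using DERIV_isconst_end[of c x F] assms
    by (metis DERIV_continuous_on has_field_derivative_at_within less_eq_real_def)
qed simp

lemma antideriv_const_left:
  fixes F :: "real \<Rightarrow> real"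
  assumes "\<And>x. (F has_field_derivative f x) (at x)" "\<And>x. x \<le> c \<Longrightarrow> f x = 0" "x \<le> c"
  shows "F x = F c"
proof (cases "x = c")
  case False
  then show ?thesis
    using DERIV_isconst_end[of x c F] assms
    by (metis DERIV_continuous_on has_field_derivative_at_within less_eq_real_def)
qed simp

text \<open>A primitive of a bump, normalised by its total increase \<open>c\<close>.\<close>

lemma smooth_step:
  obtains \<eta> where "smooth1 \<eta>" "\<And>t. t \<le> -1 \<Longrightarrow> \<eta> t = 0" "\<And>t. t \<ge> 0 \<Longrightarrow> \<eta> t = (1::real)"
proof -
  obtain G where G: "smooth1 G" "\<And>x. (G has_field_derivative bump 1 (-1) 0 x) (at x)"
    using smooth1_has_antideriv[OF smooth1_bump] by metis
  define c where "c = G 0 - G (-1)"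
  have "G (-1) < G 0"
  proof (rule DERIV_pos_imp_increasing_open[of "-1" 0 G])
    show "continuous_on {-1..0} G" by (rule smooth1_continuous[OF G(1)])
    show "\<exists>y. (G has_field_derivative y) (at x) \<and> 0 < y" if "-1 < x" "x < 0" for x
      using G(2) that by (intro exI[of _ "bump 1 (-1) 0 x"]) (auto intro!: bump_pos)
  qed simp
  then have c: "c > 0" by (simp add: c_def)
  show ?thesis
  proof
    have "smooth1 (\<lambda>t. (1/c) * G t + (- G (-1) / c))"
      by (rule smooth1_add[OF smooth1_mult[OF smooth1_const G(1)] smooth1_const])
    then show "smooth1 (\<lambda>t. (G t - G (-1)) / c)"
      by (simp add: diff_divide_distrib)
    show "(G t - G (-1)) / c = 0" if "t \<le> -1" for t
      using antideriv_const_left[OF G(2) _ that] by (simp add: bump_eq_0)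
    show "(G t - G (-1)) / c = 1" if "t \<ge> 0" for t
      using antideriv_const_right[OF G(2) _ that] c by (simp add: bump_eq_0 c_def)
  qed
qed

lemma integrable_tensor:
  fixes g :: "'a::euclidean_space \<Rightarrow> real" and h :: "'b::euclidean_space \<Rightarrow> real"
  assumes "integrable lborel g" "integrable lborel h"
  shows "integrable (lborel \<Otimes>\<^sub>M lborel) (\<lambda>p. g (fst p) * h (snd p))"
proof (rule lborel_pair.Fubini_integrable)
  show "integrable lborel (\<lambda>x. LBINT y. norm (g (fst (x, y)) * h (snd (x, y))))"
    using assms by (simp add: abs_mult)
  show "AE x in lborel. integrable lborel (\<lambda>y. g (fst (x, y)) * h (snd (x, y)))"
    using assms by simp
qed (use assms in simp)

lemma primitive_borel [measurable]:
  fixes F :: "real \<Rightarrow> real"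
  assumes [measurable]: "F \<in> borel_measurable borel"
  shows "(\<lambda>t. LBINT s. indicator {..<t} s * F s) \<in> borel_measurable borel"
proof -
  have "(\<lambda>t. LBINT s. (if s < t then F s else 0)) \<in> borel_measurable borel"
    by measurable
  also have "(\<lambda>t. LBINT s. (if s < t then F s else 0)) = (\<lambda>t. LBINT s. indicator {..<t} s * F s)"
    by (auto simp: fun_eq_iff indicator_def intro!: Bochner_Integration.integral_cong)
  finally show ?thesis .
qed

lemma primitive_bound:
  fixes F :: "real \<Rightarrow> real"
  assumes F: "integrable lborel F"
  shows "\<bar>LBINT s. indicator {..<t} s * F s\<bar> \<le> (LBINT s. \<bar>F s\<bar>)"
proof -
  have "\<bar>LBINT s. indicator {..<t} s * F s\<bar> \<le> (LBINT s. \<bar>indicator {..<t} s * F s\<bar>)"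
    by (rule integral_abs_bound)
  also have "\<dots> \<le> (LBINT s. \<bar>F s\<bar>)"
  proof (rule integral_mono)
    show "integrable lborel (\<lambda>s. \<bar>indicator {..<t} s * F s\<bar>)"
      using integrable_mult_indicator[OF _ F, of "{..<t}"] by simp
  qed (use F in \<open>auto simp: indicator_def\<close>)
  finally show ?thesis .
qed

text \<open>The weak form of \<open>g' = F\<close> with \<open>g 0 = 0\<close>: since \<theta> may
  be nonzero at 0, the hypothesis contains the initial value as well as the equation. By the
  fundamental lemma it is enough to integrate against a bump \<psi>. The test function is the tail
  integral of \<psi>, whose derivative is \<open>- \<psi>\<close>, and Fubini's theorem moves the
  integration from \<psi> onto \<open>F\<close>.\<close>

theorem weak_ode_integral:
  fixes g F :: "real \<Rightarrow> real"
  assumes g: "integrable lborel g" and F: "integrable lborel F"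
    and g0: "\<And>t. t \<le> 0 \<Longrightarrow> g t = 0" and F0: "\<And>t. t \<le> 0 \<Longrightarrow> F t = 0"
    and weak: "\<And>\<theta> l u. smooth1 \<theta> \<Longrightarrow> (\<And>t. t \<notin> {l..u} \<Longrightarrow> \<theta> t = 0) \<Longrightarrow> u < T \<Longrightarrow>
        (LBINT t. deriv \<theta> t * g t + \<theta> t * F t) = 0"
  shows "AE t in lborel. t < T \<longrightarrow> g t = (LBINT s. indicator {..<t} s * F s)"
proof -
  define W where "W t = (LBINT s. indicator {..<t} s * F s)" for t
  have [measurable]: "g \<in> borel_measurable borel" "F \<in> borel_measurable borel"
    using g F by simp_all
  have [measurable]: "W \<in> borel_measurable borel"
    unfolding W_def by measurable
  have W_bound: "\<bar>W t\<bar> \<le> (LBINT s. \<bar>F s\<bar>)" for t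
    unfolding W_def by (rule primitive_bound[OF F])
  \<comment> \<open>A cut-off on the left is needed because the tail integral of a bump is constant,
    not zero, far to the left. The transition lies in \<open>[-1, 0]\<close>, where \<open>g\<close>
    and \<open>F\<close> vanish, so it does not influence the integrals.\<close>
  obtain \<eta> :: "real \<Rightarrow> real" where \<eta>: "smooth1 \<eta>" "\<And>t. t \<le> -1 \<Longrightarrow> \<eta> t = 0" "\<And>t. t \<ge> 0 \<Longrightarrow> \<eta> t = 1"
    using smooth_step by metis
  have "AE t in lborel. t \<in> {..<T} \<longrightarrow> g t - W t = 0"
  proof (rule AE_eq_0_if_bump_integrals_0)
    show "integrable lborel (\<lambda>t. (g t - W t) * indicator (cbox l u) t)" for l u :: real
    proof -
      have "integrable lborel (\<lambda>t. W t * indicator (cbox l u) t)"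
      proof (rule Bochner_Integration.integrable_bound)
        show "integrable lborel (\<lambda>t. (LBINT s. \<bar>F s\<bar>) * indicator (cbox l u) t)"
          by (intro integrable_mult_right integrable_real_indicator emeasure_lborel_cbox_finite) auto
        show "AE x in lborel. norm (W x * indicat_real (cbox l u) x)
            \<le> norm ((LBINT s. \<bar>F s\<bar>) * indicat_real (cbox l u) x)"
          using W_bound by (intro AE_I2) (auto simp: abs_mult intro!: mult_right_mono order_trans[OF W_bound])
      qed simp
      moreover have "integrable lborel (\<lambda>t. g t * indicator (cbox l u) t)"
        using integrable_mult_indicator[OF _ g, of "cbox l u"] by (simp add: mult.commute)
      ultimately show ?thesis
        by (simp add: left_diff_distrib)
    qed
    fix n and l u :: real assume lu: "cbox l u \<subseteq> {..<T}"
    define \<psi> where "\<psi> = box_bump n l u"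
    have \<psi>_eq: "\<psi> = bump (real (Suc n)) l u"
      by (simp add: \<psi>_def box_bump_def tens_def fun_eq_iff)
    show "(LBINT x. (g x - W x) * \<psi> x) = 0"
    proof (cases "l < u")
      case False
      then have "\<psi> = (\<lambda>_. 0)"
        by (auto simp: \<psi>_def fun_eq_iff intro!: box_bump_eq_0)
      then show ?thesis by simp
    next
      case True
      then have "u \<in> cbox l u" by simp
      then have "u < T" using lu by blast
      obtain G where G: "smooth1 G" "\<And>x. (G has_field_derivative \<psi> x) (at x)"
        using smooth1_has_antideriv[OF smooth1_bump] unfolding \<psi>_eq by metis
      \<comment> \<open>The integral of \<psi> over \<open>(t, \<infinity>)\<close>. It vanishes
        from \<open>u\<close> on, so the support of the test function ends before
        \<open>T\<close>.\<close>
      define \<Psi> where "\<Psi> t = G u - G t" for t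
      have \<Psi>: "smooth1 \<Psi>"
      proof -
        have "smooth1 (\<lambda>t. G u + (-1) * G t)"
          by (rule smooth1_add[OF smooth1_const smooth1_mult[OF smooth1_const G(1)]])
        then show ?thesis by (simp add: \<Psi>_def[abs_def])
      qed
      have \<psi>0: "\<psi> t = 0" if "t \<notin> {l<..<u}" for t
        using that by (simp add: \<psi>_def box_bump_eq_0)
      have \<Psi>0: "\<Psi> t = 0" if "t \<ge> u" for t
        using antideriv_const_right[OF G(2) _ that] \<psi>0 by (simp add: \<Psi>_def)
      have \<Psi>_int: "\<Psi> t = (LBINT s. indicator {t<..} s * \<psi> s)" for t
      proof (cases "t \<le> u")
        case True
        have "\<Psi> t = (LBINT s. \<psi> s * indicator {t..u} s)"
          unfolding \<Psi>_def
        proof (rule integral_FTC_Icc_real[symmetric])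
          show "isCont \<psi> x" for x
            unfolding \<psi>_eq using smooth1_DERIV[OF smooth1_bump] DERIV_isCont by blast
        qed (use True G in auto)
        also have "\<dots> = (LBINT s. indicator {t<..} s * \<psi> s)"
        proof (rule integral_cong_AE)
          show "AE s in lborel. \<psi> s * indicat_real {t..u} s = indicat_real {t<..} s * \<psi> s"
            using AE_lborel_singleton[of t] by eventually_elim (auto simp: indicator_def intro!: \<psi>0)
        qed (simp_all add: \<psi>_def)
        finally show ?thesis .
      next
        case False
        have "(LBINT s. indicator {t<..} s * \<psi> s) = (\<integral>s. 0 \<partial>(lborel::real measure))"
          using False by (intro Bochner_Integration.integral_cong) (auto simp: indicator_def intro!: \<psi>0)
        then show ?thesis using False \<Psi>0 by simp
      qed
      define \<theta> where "\<theta> = (\<lambda>t. \<eta> t * \<Psi> t)"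
      have \<theta>: "smooth1 \<theta>" unfolding \<theta>_def by (rule smooth1_mult[OF \<eta>(1) \<Psi>])
      have d\<theta>: "deriv \<theta> t = - \<psi> t" if "t > 0" for t
      proof -
        have "(\<Psi> has_field_derivative - \<psi> t) (at t)"
          unfolding \<Psi>_def[abs_def] by (auto intro!: derivative_eq_intros G(2))
        then have "(\<theta> has_field_derivative - \<psi> t) (at t)"
          by (rule DERIV_cong_ev[THEN iffD1, rotated -1])
             (use that \<eta>(3) in \<open>auto simp: \<theta>_def eventually_nhds intro!: exI[of _ "{0<..}"]\<close>)
        then show ?thesis by (rule DERIV_imp_deriv)
      qed
      have \<psi>_int: "integrable lborel \<psi>"
      proof (rule Bochner_Integration.integrable_bound)
        show "integrable lborel (indicator (cbox l u) :: real \<Rightarrow> real)"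
          by (intro integrable_real_indicator emeasure_lborel_cbox_finite) auto
        show "AE x in lborel. norm (\<psi> x) \<le> norm (indicator (cbox l u) x :: real)"
          using box_bump_le_1[of n l u] box_bump_nonneg[of n l u]
          by (intro AE_I2) (auto simp: indicator_def \<psi>_def box_bump_eq_0)
      qed (simp add: \<psi>_def)
      have [measurable]: "\<psi> \<in> borel_measurable borel" by (simp add: \<psi>_def)
      have pair: "integrable (lborel \<Otimes>\<^sub>M lborel) (case_prod (\<lambda>t s. indicator {t<..} s * \<psi> s * F t))"
      proof (rule Bochner_Integration.integrable_bound[OF integrable_tensor[OF F \<psi>_int]])
        have "(\<lambda>p. (if fst p < snd p then 1 else 0) * \<psi> (snd p) * F (fst p)) \<in> borel_measurable (lborel \<Otimes>\<^sub>M lborel)"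
          by measurable
        then show "case_prod (\<lambda>t s. indicat_real {t<..} s * \<psi> s * F t) \<in> borel_measurable (lborel \<Otimes>\<^sub>M lborel)"
          by (rule measurable_cong[THEN iffD1, rotated]) (auto simp: indicator_def)
      qed (auto intro!: AE_I2 simp: abs_mult indicator_def)
      have "(LBINT t. \<Psi> t * F t) = (LBINT t. (LBINT s. indicator {t<..} s * \<psi> s * F t))"
        by (simp add: \<Psi>_int)
      also have "\<dots> = (LBINT s. (LBINT t. indicator {t<..} s * \<psi> s * F t))"
        by (rule lborel_pair.Fubini_integral[OF pair, symmetric])
      also have "\<dots> = (LBINT s. (LBINT t. \<psi> s * (indicator {..<s} t * F t)))"
        by (intro Bochner_Integration.integral_cong) (auto simp: indicator_def)
      also have "\<dots> = (LBINT s. \<psi> s * W s)"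
        unfolding W_def by simp
      finally have \<Psi>F: "(LBINT t. \<Psi> t * F t) = (LBINT s. \<psi> s * W s)" .
      have \<psi>g: "integrable lborel (\<lambda>t. \<psi> t * g t)"
        by (rule Bochner_Integration.integrable_bound[OF g])
           (use box_bump_le_1[of n l u] box_bump_nonneg[of n l u] in
             \<open>auto simp: \<psi>_def abs_mult intro!: mult_left_le_one_le\<close>)
      have \<psi>W: "integrable lborel (\<lambda>t. \<psi> t * W t)"
      proof (rule Bochner_Integration.integrable_bound)
        show "integrable lborel (\<lambda>t. (LBINT s. \<bar>F s\<bar>) * \<psi> t)"
          using \<psi>_int by simp
        show "AE x in lborel. norm (\<psi> x * W x) \<le> norm ((LBINT s. \<bar>F s\<bar>) * \<psi> x)"
          using W_bound by (intro AE_I2) (simp add: abs_mult mult.commute[of "\<bar>\<psi> _\<bar>"] mult_right_mono)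
      qed simp
      have \<Psi>F_int: "integrable lborel (\<lambda>t. \<Psi> t * F t)"
        using lborel_pair.integrable_fst[OF pair] by (simp add: \<Psi>_int)
      have "0 = (LBINT t. deriv \<theta> t * g t + \<theta> t * F t)"
      proof (rule weak[symmetric, OF \<theta> _ \<open>u < T\<close>])
        show "\<theta> t = 0" if "t \<notin> {-1..u}" for t
          using that \<eta>(2)[of t] \<Psi>0[of t] by (auto simp: \<theta>_def)
      qed
      also have "\<dots> = (LBINT t. \<Psi> t * F t - \<psi> t * g t)"
      proof (intro Bochner_Integration.integral_cong refl)
        show "deriv \<theta> t * g t + \<theta> t * F t = \<Psi> t * F t - \<psi> t * g t" for t
          using g0[of t] F0[of t] d\<theta>[of t] \<eta>(3)[of t] by (cases "t > 0") (auto simp: \<theta>_def)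
      qed
      also have "\<dots> = (LBINT t. \<psi> t * W t) - (LBINT t. \<psi> t * g t)"
        using \<Psi>F_int \<psi>g by (simp add: \<Psi>F)
      also have "\<dots> = (LBINT t. \<psi> t * W t - \<psi> t * g t)"
        using \<psi>W \<psi>g by simp
      finally have "0 = (LBINT t. - ((g t - W t) * \<psi> t))"
        by (simp add: algebra_simps)
      then show ?thesis by simp
    qed
  qed auto
  then show ?thesis
    by eventually_elim (auto simp: W_def)
qed

section \<open>Square integrable functions and convolution with compactly supported kernels\<close>

definition L2 :: "('a::euclidean_space \<Rightarrow> real) \<Rightarrow> bool" where
  "L2 f \<longleftrightarrow> f \<in> borel_measurable borel \<and> integrable lborel (\<lambda>x. (f x)\<^sup>2)"

lemma L2_borel [measurable_dest]: "L2 f \<Longrightarrow> f \<in> borel_measurable borel"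
  by (simp add: L2_def)

lemma L2_nn: "L2 f \<longleftrightarrow> f \<in> borel_measurable borel \<and> (\<integral>\<^sup>+x. (ennreal \<bar>f x\<bar>)\<^sup>2 \<partial>lborel) < \<infinity>"
  by (auto simp: L2_def integrable_iff_bounded ennreal_power)

lemma L2_nn_eq: "L2 f \<Longrightarrow> (\<integral>\<^sup>+x. (ennreal \<bar>f x\<bar>)\<^sup>2 \<partial>lborel) = ennreal (LBINT x. (f x)\<^sup>2)"
  by (simp add: L2_def ennreal_power nn_integral_eq_integral)

lemma L2_bound:
  assumes "L2 g" "f \<in> borel_measurable borel" "AE x in lborel. \<bar>f x\<bar> \<le> \<bar>g x\<bar>"
  shows "L2 f"
  unfolding L2_def
proof
  show "integrable lborel (\<lambda>x. (f x)\<^sup>2)"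
    by (rule Bochner_Integration.integrable_bound[of _ "\<lambda>x. (g x)\<^sup>2"])
       (use assms in \<open>auto simp: L2_def abs_le_square_iff\<close>)
qed fact

lemma L2_integral_mono:
  assumes "L2 g" "L2 f" "AE x in lborel. \<bar>f x\<bar> \<le> \<bar>g x\<bar>"
  shows "(LBINT x. (f x)\<^sup>2) \<le> (LBINT x. (g x)\<^sup>2)"
  using assms by (intro integral_mono_AE) (auto simp: L2_def abs_le_square_iff)

lemma L2_mult_integrable:
  assumes "L2 f" "L2 g" shows "integrable lborel (\<lambda>x. f x * g x)"
proof (rule Bochner_Integration.integrable_bound)
  show "integrable lborel (\<lambda>x. (f x)\<^sup>2 + (g x)\<^sup>2)" using assms by (simp add: L2_def)
  show "AE x in lborel. norm (f x * g x) \<le> norm ((f x)\<^sup>2 + (g x)\<^sup>2)"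
  proof (intro AE_I2)
    fix x
    have "2 * (\<bar>f x\<bar> * \<bar>g x\<bar>) \<le> (f x)\<^sup>2 + (g x)\<^sup>2"
      using sum_squares_bound[of "\<bar>f x\<bar>" "\<bar>g x\<bar>"] by simp
    then show "norm (f x * g x) \<le> norm ((f x)\<^sup>2 + (g x)\<^sup>2)"
      by (simp add: abs_mult)
       (smt (verit) mult_nonneg_nonneg abs_ge_zero)
  qed
qed (use assms in \<open>auto simp: L2_def\<close>)

lemma L2_scale: "L2 f \<Longrightarrow> L2 (\<lambda>x. c * f x)"
  by (auto simp: L2_def power_mult_distrib)

lemma L2_add: "L2 f \<Longrightarrow> L2 g \<Longrightarrow> L2 (\<lambda>x. f x + g x)"
  using L2_mult_integrable[of f g]
  by (auto simp: L2_def power2_sum mult.assoc)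

lemma L2_diff: "L2 f \<Longrightarrow> L2 g \<Longrightarrow> L2 (\<lambda>x. f x - g x)"
  using L2_add[of f "\<lambda>x. -1 * g x"] L2_scale[of g "-1"] by simp

lemma L2_zero: "L2 (\<lambda>_. 0)"
  by (simp add: L2_def)

lemma L2_sum: "(\<And>i. i \<in> I \<Longrightarrow> L2 (f i)) \<Longrightarrow> L2 (\<lambda>x. \<Sum>i\<in>I. f i x)"
  by (induction I rule: infinite_finite_induct) (auto simp: L2_zero intro!: L2_add)

lemma L2_abs: "L2 f \<Longrightarrow> L2 (\<lambda>x. \<bar>f x\<bar>)"
  by (auto simp: L2_def)

lemma L2_bounded_mult:
  assumes "L2 f" "m \<in> borel_measurable borel" "\<And>x. \<bar>m x\<bar> \<le> C"
  shows "L2 (\<lambda>x. m x * f x)"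
proof (rule L2_bound[OF L2_scale[OF assms(1), of C]])
  show "AE x in lborel. \<bar>m x * f x\<bar> \<le> \<bar>C * f x\<bar>"
  proof (intro AE_I2)
    fix x show "\<bar>m x * f x\<bar> \<le> \<bar>C * f x\<bar>"
      using assms(3)[of x] by (auto simp: abs_mult intro!: mult_right_mono)
  qed
qed (use assms in \<open>auto simp: L2_def\<close>)

lemma L2_bounded_mult_le:
  assumes "L2 f" "m \<in> borel_measurable borel" "\<And>x. \<bar>m x\<bar> \<le> C"
  shows "(LBINT x. (m x * f x)\<^sup>2) \<le> C\<^sup>2 * (LBINT x. (f x)\<^sup>2)"
proof -
  have "(LBINT x. (m x * f x)\<^sup>2) \<le> (LBINT x. (C * f x)\<^sup>2)"
    by (rule L2_integral_mono[OF L2_scale[OF assms(1)] L2_bounded_mult[OF assms]])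
       (use assms(3) in \<open>auto simp: abs_mult intro!: mult_right_mono order_trans[OF assms(3)]\<close>)
  then show ?thesis by (simp add: power_mult_distrib)
qed

section \<open>Invariance of Lebesgue measure and Young's inequality\<close>

lemma nn_integral_reflect:
  fixes f :: "'a::euclidean_space \<Rightarrow> ennreal"
  assumes [measurable]: "f \<in> borel_measurable borel"
  shows "(\<integral>\<^sup>+y. f (x - y) \<partial>lborel) = (\<integral>\<^sup>+y. f y \<partial>lborel)"
proof -
  have "(lborel :: 'a measure) = density (distr lborel borel (\<lambda>y. x + (-1) *\<^sub>R y)) (\<lambda>_. ennreal (\<bar>-1\<bar> ^ DIM('a)))"
    by (rule lborel_affine[of "-1"]) simp
  then have eq: "(lborel :: 'a measure) = distr lborel borel (\<lambda>y. x - y)"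
    by (simp add: density_1)
  have "(\<integral>\<^sup>+y. f y \<partial>lborel) = (\<integral>\<^sup>+y. f y \<partial>(distr lborel borel (\<lambda>y. x - y)))"
    using eq by simp
  also have "\<dots> = (\<integral>\<^sup>+y. f (x - y) \<partial>lborel)" by (subst nn_integral_distr) auto
  finally show ?thesis by simp
qed

lemma nn_integral_shift:
  fixes f :: "'a::euclidean_space \<Rightarrow> ennreal"
  assumes [measurable]: "f \<in> borel_measurable borel"
  shows "(\<integral>\<^sup>+y. f (y + c) \<partial>lborel) = (\<integral>\<^sup>+y. f y \<partial>lborel)"
proof -
  have "(\<integral>\<^sup>+y. f y \<partial>lborel) = (\<integral>\<^sup>+y. f y \<partial>(distr lborel borel ((+) c)))"
    by (simp add: lborel_distr_plus)
  also have "\<dots> = (\<integral>\<^sup>+y. f (y + c) \<partial>lborel)"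
    by (subst nn_integral_distr) (auto simp: add.commute)
  finally show ?thesis by simp
qed

lemma integral_shift:
  fixes f :: "'a::euclidean_space \<Rightarrow> real"
  assumes [measurable]: "f \<in> borel_measurable borel"
  shows "(LBINT y. f (y + c)) = (LBINT y. f y)"
proof -
  have "(LBINT y. f y) = (\<integral>y. f y \<partial>(distr lborel borel ((+) c)))"
    by (simp add: lborel_distr_plus)
  also have "\<dots> = (LBINT y. f (y + c))"
    by (subst integral_distr) (auto simp: add.commute)
  finally show ?thesis by simp
qed

lemma integrable_shift:
  fixes f :: "'a::euclidean_space \<Rightarrow> real"
  assumes "integrable lborel f"
  shows "integrable lborel (\<lambda>y. f (y + c))"
  using assms nn_integral_shift[of "\<lambda>y. ennreal (norm (f y))" c]
  by (auto simp: integrable_iff_bounded)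

lemma L2_reflect: "L2 f \<Longrightarrow> L2 (\<lambda>y. f (x - y))"
  using nn_integral_reflect[of "\<lambda>y. (ennreal \<bar>f y\<bar>)\<^sup>2" x] by (auto simp: L2_nn)

text \<open>Young's inequality, from Cauchy--Schwarz with the splitting \<open>|k||f| = |k|\<^sup>1\<^sup>/\<^sup>2 (|k|\<^sup>1\<^sup>/\<^sup>2|f|)\<close>.\<close>

lemma Young_nn:
  fixes k f :: "'a::euclidean_space \<Rightarrow> real"
  assumes [measurable]: "k \<in> borel_measurable borel" "f \<in> borel_measurable borel"
  shows "(\<integral>\<^sup>+x. (\<integral>\<^sup>+y. ennreal \<bar>k (x - y)\<bar> * ennreal \<bar>f y\<bar> \<partial>lborel)\<^sup>2 \<partial>lborel)
    \<le> (\<integral>\<^sup>+z. ennreal \<bar>k z\<bar> \<partial>lborel)\<^sup>2 * (\<integral>\<^sup>+y. (ennreal \<bar>f y\<bar>)\<^sup>2 \<partial>lborel)"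
proof -
  define I where "I = (\<integral>\<^sup>+z. ennreal \<bar>k z\<bar> \<partial>lborel)"
  have sq: "(ennreal (sqrt \<bar>c\<bar>))\<^sup>2 = ennreal \<bar>c\<bar>" for c
    by (simp add: ennreal_power)
  have pt: "(\<integral>\<^sup>+y. ennreal \<bar>k (x - y)\<bar> * ennreal \<bar>f y\<bar> \<partial>lborel)\<^sup>2
      \<le> I * (\<integral>\<^sup>+y. ennreal \<bar>k (x - y)\<bar> * (ennreal \<bar>f y\<bar>)\<^sup>2 \<partial>lborel)" for x
  proof -
    have "(\<integral>\<^sup>+y. ennreal \<bar>k (x - y)\<bar> * ennreal \<bar>f y\<bar> \<partial>lborel)
       = (\<integral>\<^sup>+y. ennreal (sqrt \<bar>k (x - y)\<bar>) * (ennreal (sqrt \<bar>k (x - y)\<bar>) * ennreal \<bar>f y\<bar>) \<partial>lborel)"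
      by (subst sq[symmetric]) (simp add: power2_eq_square mult.assoc)
    also have "\<dots>\<^sup>2 \<le> (\<integral>\<^sup>+y. (ennreal (sqrt \<bar>k (x - y)\<bar>))\<^sup>2 \<partial>lborel)
        * (\<integral>\<^sup>+y. (ennreal (sqrt \<bar>k (x - y)\<bar>) * ennreal \<bar>f y\<bar>)\<^sup>2 \<partial>lborel)"
      by (rule Cauchy_Schwarz_nn_integral) auto
    also have "\<dots> = I * (\<integral>\<^sup>+y. ennreal \<bar>k (x - y)\<bar> * (ennreal \<bar>f y\<bar>)\<^sup>2 \<partial>lborel)"
      using nn_integral_reflect[of "\<lambda>z. ennreal \<bar>k z\<bar>" x]
      by (simp add: power_mult_distrib sq I_def)
    finally show ?thesis .
  qed
  have "(\<integral>\<^sup>+x. (\<integral>\<^sup>+y. ennreal \<bar>k (x - y)\<bar> * ennreal \<bar>f y\<bar> \<partial>lborel)\<^sup>2 \<partial>lborel)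
      \<le> (\<integral>\<^sup>+x. I * (\<integral>\<^sup>+y. ennreal \<bar>k (x - y)\<bar> * (ennreal \<bar>f y\<bar>)\<^sup>2 \<partial>lborel) \<partial>lborel)"
    by (intro nn_integral_mono pt)
  also have "\<dots> = I * (\<integral>\<^sup>+x. (\<integral>\<^sup>+y. ennreal \<bar>k (x - y)\<bar> * (ennreal \<bar>f y\<bar>)\<^sup>2 \<partial>lborel) \<partial>lborel)"
    by (rule nn_integral_cmult) measurable
  also have "(\<integral>\<^sup>+x. (\<integral>\<^sup>+y. ennreal \<bar>k (x - y)\<bar> * (ennreal \<bar>f y\<bar>)\<^sup>2 \<partial>lborel) \<partial>lborel)
      = (\<integral>\<^sup>+y. (\<integral>\<^sup>+x. ennreal \<bar>k (x - y)\<bar> * (ennreal \<bar>f y\<bar>)\<^sup>2 \<partial>lborel) \<partial>lborel)"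
    by (rule lborel_pair.Fubini') measurable
  also have "\<dots> = (\<integral>\<^sup>+y. I * (ennreal \<bar>f y\<bar>)\<^sup>2 \<partial>lborel)"
  proof (intro nn_integral_cong)
    fix y
    have "(\<integral>\<^sup>+x. ennreal \<bar>k (x - y)\<bar> * (ennreal \<bar>f y\<bar>)\<^sup>2 \<partial>lborel)
        = (\<integral>\<^sup>+x. ennreal \<bar>k (x - y)\<bar> \<partial>lborel) * (ennreal \<bar>f y\<bar>)\<^sup>2"
      by (rule nn_integral_multc) measurable
    also have "(\<integral>\<^sup>+x. ennreal \<bar>k (x - y)\<bar> \<partial>lborel) = I"
      using nn_integral_shift[of "\<lambda>z. ennreal \<bar>k z\<bar>" "- y"] by (simp add: I_def)
    finally show "(\<integral>\<^sup>+x. ennreal \<bar>k (x - y)\<bar> * (ennreal \<bar>f y\<bar>)\<^sup>2 \<partial>lborel) = I * (ennreal \<bar>f y\<bar>)\<^sup>2" .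
  qed
  also have "\<dots> = I * (\<integral>\<^sup>+y. (ennreal \<bar>f y\<bar>)\<^sup>2 \<partial>lborel)"
    by (rule nn_integral_cmult) measurable
  finally show ?thesis by (simp add: I_def power2_eq_square mult.assoc)
qed

text \<open>Such kernels lie in both \<open>L^1\<close> and \<open>L^2\<close>: the former is what
  Young's inequality asks for, the latter makes the convolution with an \<open>L^2\<close> function
  an absolutely convergent integral at every point, not only at almost every point.\<close>

definition kern :: "('a::euclidean_space \<Rightarrow> real) \<Rightarrow> bool" where
  "kern k \<longleftrightarrow> continuous_on UNIV k \<and> (\<exists>R. \<forall>z. norm z > R \<longrightarrow> k z = 0)"

lemma kern_borel [measurable_dest]: "kern k \<Longrightarrow> k \<in> borel_measurable borel"
  by (simp add: kern_def borel_measurable_continuous_onI)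

lemma kern_bound:
  assumes "kern k"
  obtains C R where "C \<ge> 0" "R \<ge> 0" "\<And>z. \<bar>k z\<bar> \<le> C * indicator (cball 0 R) z"
proof -
  obtain R where R: "\<And>z. norm z > R \<Longrightarrow> k z = 0" using assms by (auto simp: kern_def)
  have "compact (k ` cball 0 R)"
    using assms by (intro compact_continuous_image) (auto simp: kern_def intro: continuous_on_subset)
  then obtain C where C: "\<And>z. z \<in> cball 0 R \<Longrightarrow> \<bar>k z\<bar> \<le> C"
    by (fastforce dest!: compact_imp_bounded simp: bounded_iff)
  show ?thesis
  proof
    show "\<bar>k z\<bar> \<le> max 0 C * indicator (cball 0 (max 0 R)) z" for z
      using C[of z] R[of z] by (cases "norm z \<le> R") (auto simp: indicator_def)
  qed auto
qed

lemma integrable_cball_indicator: "integrable lborel (\<lambda>z::'a::euclidean_space. C * indicator (cball c R) z :: real)"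
  by (intro integrable_mult_right integrable_real_indicator emeasure_bounded_finite) auto

lemma kern_integrable:
  assumes "kern k" shows "integrable lborel k"
proof -
  obtain C R where b: "\<And>z. \<bar>k z\<bar> \<le> C * indicator (cball 0 R) z"
    using kern_bound[OF assms] by metis
  show ?thesis
    by (rule Bochner_Integration.integrable_bound[OF integrable_cball_indicator[of C 0 R]])
       (use assms b in \<open>auto intro!: order_trans[OF b] simp: kern_borel\<close>)
qed

lemma kern_mult: "kern k \<Longrightarrow> continuous_on UNIV l \<Longrightarrow> kern (\<lambda>z. k z * l z)"
  by (auto simp: kern_def intro!: continuous_intros)

lemma kern_abs: "kern k \<Longrightarrow> kern (\<lambda>z. \<bar>k z\<bar>)"
  by (auto simp: kern_def intro!: continuous_intros)

lemma kern_add: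
  assumes "kern k" "kern l" shows "kern (\<lambda>z. k z + l z)"
proof -
  obtain R S where "\<And>z. norm z > R \<Longrightarrow> k z = 0" "\<And>z. norm z > S \<Longrightarrow> l z = 0"
    using assms unfolding kern_def by blast
  then have "k z + l z = 0" if "norm z > max R S" for z
    using that by simp
  moreover have "continuous_on UNIV (\<lambda>z. k z + l z)"
    using assms by (intro continuous_intros) (auto simp: kern_def)
  ultimately show ?thesis unfolding kern_def by blast
qed

lemma kern_continuous: "kern k \<Longrightarrow> continuous_on S k"
  unfolding kern_def using continuous_on_subset by blast

lemma kern_L2: "kern k \<Longrightarrow> L2 k"
  using kern_integrable[OF kern_mult[OF _ kern_continuous], of k k]
  by (auto simp: L2_def power2_eq_square)

lemma kern_shift: assumes "kern k" shows "kern (\<lambda>z. k (z + c))"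
proof -
  obtain R where R: "\<And>z. norm z > R \<Longrightarrow> k z = 0" using assms by (auto simp: kern_def)
  have "k (z + c) = 0" if "norm z > R + norm c" for z
  proof (rule R)
    have "norm z \<le> norm (z + c) + norm c"
      using norm_triangle_ineq4[of "z + c" c] by simp
    then show "norm (z + c) > R" using that by simp
  qed
  moreover have "continuous_on UNIV (\<lambda>z. k (z + c))"
    by (rule continuous_on_compose2[OF kern_continuous[OF assms, of UNIV]]) (auto intro: continuous_intros)
  ultimately show ?thesis unfolding kern_def by blast
qed

definition conv :: "('a::euclidean_space \<Rightarrow> real) \<Rightarrow> ('a \<Rightarrow> real) \<Rightarrow> 'a \<Rightarrow> real" where
  "conv k f x = (LBINT y. k (x - y) * f y)"

lemma conv_integrable:
  assumes "kern k" "L2 f" shows "integrable lborel (\<lambda>y. k (x - y) * f y)"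
  by (rule L2_mult_integrable[OF L2_reflect[OF kern_L2[OF assms(1)]] assms(2)])

lemma conv_borel [measurable]:
  assumes [measurable]: "k \<in> borel_measurable borel" "f \<in> borel_measurable borel"
  shows "conv k f \<in> borel_measurable borel"
  unfolding conv_def by measurable

lemma conv_abs_nn:
  assumes "kern k" "L2 f"
  shows "ennreal \<bar>conv k f x\<bar> \<le> (\<integral>\<^sup>+y. ennreal \<bar>k (x - y)\<bar> * ennreal \<bar>f y\<bar> \<partial>lborel)"
  using integral_norm_bound_ennreal[OF conv_integrable[OF assms]]
  by (simp add: conv_def abs_mult ennreal_mult)

lemma kern_nn: "kern k \<Longrightarrow> (\<integral>\<^sup>+z. ennreal \<bar>k z\<bar> \<partial>lborel) = ennreal (LBINT z. \<bar>k z\<bar>)"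
  by (intro nn_integral_eq_integral integrable_abs kern_integrable) auto

lemma conv_L2_nn:
  assumes "kern k" "L2 f"
  shows "(\<integral>\<^sup>+x. (ennreal \<bar>conv k f x\<bar>)\<^sup>2 \<partial>lborel)
    \<le> ennreal ((LBINT z. \<bar>k z\<bar>)\<^sup>2 * (LBINT y. (f y)\<^sup>2))"
proof -
  have "(\<integral>\<^sup>+x. (ennreal \<bar>conv k f x\<bar>)\<^sup>2 \<partial>lborel)
    \<le> (\<integral>\<^sup>+x. (\<integral>\<^sup>+y. ennreal \<bar>k (x - y)\<bar> * ennreal \<bar>f y\<bar> \<partial>lborel)\<^sup>2 \<partial>lborel)"
    by (intro nn_integral_mono power_mono conv_abs_nn assms) auto
  also have "\<dots> \<le> (\<integral>\<^sup>+z. ennreal \<bar>k z\<bar> \<partial>lborel)\<^sup>2 * (\<integral>\<^sup>+y. (ennreal \<bar>f y\<bar>)\<^sup>2 \<partial>lborel)"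
    using assms by (intro Young_nn) (auto simp: kern_borel L2_borel)
  also have "\<dots> = ennreal ((LBINT z. \<bar>k z\<bar>)\<^sup>2 * (LBINT y. (f y)\<^sup>2))"
    unfolding kern_nn[OF assms(1)] L2_nn_eq[OF assms(2)] by (simp add: ennreal_mult ennreal_power)
  finally show ?thesis .
qed

lemma conv_L2:
  assumes "kern k" "L2 f" shows "L2 (conv k f)"
  unfolding L2_nn using le_less_trans[OF conv_L2_nn[OF assms]] assms
  by (auto intro!: conv_borel simp: kern_borel L2_borel)

lemma conv_L2_le:
  assumes "kern k" "L2 f"
  shows "(LBINT x. (conv k f x)\<^sup>2) \<le> (LBINT z. \<bar>k z\<bar>)\<^sup>2 * (LBINT y. (f y)\<^sup>2)"
  using conv_L2_nn[OF assms] unfolding L2_nn_eq[OF conv_L2[OF assms]]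
  by (subst (asm) ennreal_le_iff) (auto intro!: mult_nonneg_nonneg integral_nonneg)

lemma conv_pair_integrable:
  assumes k: "kern k" and f: "L2 f" and g: "L2 g"
  shows "integrable (lborel \<Otimes>\<^sub>M lborel) (\<lambda>(x, y). g x * (k (x - y) * f y))"
proof (rule lborel_pair.Fubini_integrable)
  note [measurable] = kern_borel[OF k] L2_borel[OF f] L2_borel[OF g]
  show "(\<lambda>(x, y). g x * (k (x - y) * f y)) \<in> borel_measurable (lborel \<Otimes>\<^sub>M lborel)"
    by measurable
  have "integrable lborel (\<lambda>x. \<bar>g x\<bar> * conv (\<lambda>z. \<bar>k z\<bar>) (\<lambda>y. \<bar>f y\<bar>) x)"
    by (intro L2_mult_integrable conv_L2 kern_abs L2_abs k f g)
  then show "integrable lborel (\<lambda>x. LBINT y. norm (case (x, y) of (x, y) \<Rightarrow> g x * (k (x - y) * f y)))"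
    by (simp add: conv_def abs_mult)
  show "AE x in lborel. integrable lborel (\<lambda>y. case (x, y) of (x, y) \<Rightarrow> g x * (k (x - y) * f y))"
    using conv_integrable[OF k f] by simp
qed

section \<open>Duality and integration by parts for convolutions\<close>

lemma conv_adjoint:
  assumes k: "kern k" and f: "L2 f" and g: "L2 g"
  shows "(LBINT x. g x * conv k f x) = (LBINT y. f y * conv (\<lambda>z. k (- z)) g y)"
proof -
  have "(LBINT x. g x * conv k f x) = (LBINT x. (LBINT y. g x * (k (x - y) * f y)))"
    by (simp add: conv_def)
  also have "\<dots> = (LBINT y. (LBINT x. g x * (k (x - y) * f y)))"
    by (rule lborel_pair.Fubini_integral[OF conv_pair_integrable[OF k f g], symmetric])
  also have "\<dots> = (LBINT y. f y * conv (\<lambda>z. k (- z)) g y)"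
    unfolding conv_def integral_mult_right_zero[symmetric] minus_diff_eq
    by (intro Bochner_Integration.integral_cong refl) (simp add: mult_ac)
  finally show ?thesis .
qed

text \<open>By translation invariance \<open>h (y + e) - h y\<close> has integral 0. Written as the
  integral of \<open>h'\<close> along the segment from \<open>y\<close> to \<open>y + e\<close> and
  integrated in \<open>y\<close> first, it has the same integral as \<open>h'\<close>.\<close>

lemma integral_directional_derivative_eq_0:
  fixes h h' :: "'a::euclidean_space \<Rightarrow> real"
  assumes h: "kern h" and h': "kern h'"
    and deriv: "\<And>y s. ((\<lambda>s. h (y + s *\<^sub>R e)) has_field_derivative h' (y + s *\<^sub>R e)) (at s)"
  shows "(LBINT y. h' y) = 0"
proof -
  note [measurable] = kern_borel[OF h] kern_borel[OF h']
  obtain C R where CR: "C \<ge> 0" "R \<ge> 0" "\<And>z. \<bar>h' z\<bar> \<le> C * indicator (cball 0 R) z"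
    using kern_bound[OF h'] by metis
  have pair: "integrable (lborel \<Otimes>\<^sub>M lborel) (case_prod (\<lambda>y s. h' (y + s *\<^sub>R e) * indicator {0..1} s))"
  proof (rule Bochner_Integration.integrable_bound)
    have "integrable lborel (indicator {0..1} :: real \<Rightarrow> real)"
      by (intro integrable_real_indicator) auto
    then show "integrable (lborel \<Otimes>\<^sub>M lborel)
        (\<lambda>p::'a \<times> real. (C * indicator (cball 0 (R + norm e)) (fst p)) * indicator {0..1} (snd p))"
      by (intro integrable_tensor integrable_cball_indicator)
    show "AE p in lborel \<Otimes>\<^sub>M lborel. norm (case_prod (\<lambda>y s. h' (y + s *\<^sub>R e) * indicator {0..1} s) p)
        \<le> norm ((C * indicator (cball 0 (R + norm e)) (fst p)) * indicator {0..1} (snd p))"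
    proof (rule AE_I2, safe)
      fix y :: 'a and s :: real
      \<comment> \<open>Moving along the segment changes the norm by at most \<open>norm e\<close>;
        the enlarged ball gives a majorant integrable in both variables.\<close>
      have "norm y \<le> R + norm e" if "norm (y + s *\<^sub>R e) \<le> R" "s \<in> {0..1}"
      proof -
        have "norm y \<le> norm (y + s *\<^sub>R e) + norm (s *\<^sub>R e)"
          using norm_triangle_ineq4[of "y + s *\<^sub>R e" "s *\<^sub>R e"] by simp
        also have "norm (s *\<^sub>R e) \<le> norm e"
          using that(2) by (simp add: mult_left_le_one_le)
        finally show ?thesis using that(1) by simp
      qed
      then show "norm (h' (y + s *\<^sub>R e) * indicator {0..1} s)
        \<le> norm ((C * indicator (cball 0 (R + norm e)) (fst (y, s))) * indicator {0..1} (snd (y, s)))"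
        using CR(3)[of "y + s *\<^sub>R e"] CR(1)
        by (cases "norm (y + s *\<^sub>R e) \<le> R") (auto simp: indicator_def abs_mult)
    qed
  qed measurable
  have ftc: "(LBINT s. h' (y + s *\<^sub>R e) * indicator {0..1} s) = h (y + e) - h y" for y
  proof -
    have "(LBINT s. h' (y + s *\<^sub>R e) * indicator {0..1} s) = h (y + 1 *\<^sub>R e) - h (y + 0 *\<^sub>R e)"
    proof (rule integral_FTC_Icc_real)
      show "isCont (\<lambda>s. h' (y + s *\<^sub>R e)) s" for s
      proof -
        have "continuous_on UNIV (\<lambda>s. h' (y + s *\<^sub>R e))"
          by (rule continuous_on_compose2[OF kern_continuous[OF h', of UNIV]]) (auto intro!: continuous_intros)
        then show ?thesis by (simp add: continuous_on_eq_continuous_at)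
      qed
    qed (use deriv in auto)
    then show ?thesis by simp
  qed
  have "0 = (LBINT y. h (y + e)) - (LBINT y. h y)"
    by (simp add: integral_shift)
  also have "\<dots> = (LBINT y. h (y + e) - h y)"
    by (rule Bochner_Integration.integral_diff[symmetric])
       (intro integrable_shift kern_integrable h)+
  also have "\<dots> = (LBINT y. (LBINT s. h' (y + s *\<^sub>R e) * indicator {0..1} s))"
    by (simp add: ftc)
  also have "\<dots> = (LBINT s. (LBINT y. h' (y + s *\<^sub>R e) * indicator {0..1} s))"
    by (rule lborel_pair.Fubini_integral[OF pair, symmetric])
  also have "\<dots> = (LBINT s. (LBINT y. h' y) * indicator {0..1::real} s)"
    by (simp add: integral_shift)
  also have "\<dots> = (LBINT y. h' y)"
    by (simp add: content_real)
  finally show ?thesis by simp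
qed

lemma conv_conv:
  assumes k: "kern k" and l: "kern l" and w: "L2 w"
  shows "(LBINT y. l (y - x) * conv k w y) = (LBINT z. w z * (LBINT y. l (y - x) * k (y - z)))"
proof -
  have l': "L2 (\<lambda>y. l (y - x))"
    using kern_L2[OF kern_shift[OF l, of "- x"]] by simp
  have "(LBINT y. l (y - x) * conv k w y) = (LBINT y. (LBINT z. l (y - x) * (k (y - z) * w z)))"
    by (simp add: conv_def)
  also have "\<dots> = (LBINT z. (LBINT y. l (y - x) * (k (y - z) * w z)))"
    by (rule lborel_pair.Fubini_integral[OF conv_pair_integrable[OF k w l'], symmetric])
  also have "\<dots> = (LBINT z. (LBINT y. w z * (l (y - x) * k (y - z))))"
    by (intro Bochner_Integration.integral_cong refl) (simp add: mult_ac)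
  finally show ?thesis by simp
qed

text \<open>Neither \<open>w\<close> nor \<open>g\<close> has derivatives. By Fubini's theorem both
  sides integrate \<open>w z * g x\<close> against an integral in \<open>y\<close> of a product of
  two translated kernels, and there the classical product rule moves the derivative from one kernel
  to the other.\<close>

lemma conv_integration_by_parts:
  fixes K K' L L' :: "'a::euclidean_space \<Rightarrow> real"
  assumes kern: "kern K" "kern K'" "kern L" "kern L'" and w: "L2 w" and g: "L2 g"
    and dK: "\<And>y s. ((\<lambda>s. K (y + s *\<^sub>R e)) has_field_derivative K' (y + s *\<^sub>R e)) (at s)"
    and dL: "\<And>y s. ((\<lambda>s. L (y + s *\<^sub>R e)) has_field_derivative L' (y + s *\<^sub>R e)) (at s)"
  shows "(LBINT x. conv K w x * conv L' g x) = - (LBINT x. conv K' w x * conv L g x)"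
proof -
  have inner: "(LBINT y. L' (y - x) * K (y - z)) = - (LBINT y. L (y - x) * K' (y - z))" for x z
  proof -
    have kLx: "kern (\<lambda>y. L (y - x))" "kern (\<lambda>y. L' (y - x))"
      using kern_shift[OF kern(3), of "- x"] kern_shift[OF kern(4), of "- x"] by simp_all
    have kKz: "kern (\<lambda>y. K (y - z))" "kern (\<lambda>y. K' (y - z))"
      using kern_shift[OF kern(1), of "- z"] kern_shift[OF kern(2), of "- z"] by simp_all
    have k1: "kern (\<lambda>y. L' (y - x) * K (y - z))" and k2: "kern (\<lambda>y. L (y - x) * K' (y - z))"
      and k0: "kern (\<lambda>y. L (y - x) * K (y - z))"
      by (intro kern_mult kLx kern_continuous[OF kKz(1)] kern_continuous[OF kKz(2)])+
    have "(LBINT y. L' (y - x) * K (y - z) + L (y - x) * K' (y - z)) = 0"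
    proof (rule integral_directional_derivative_eq_0[OF k0 kern_add[OF k1 k2]])
      fix y s
      have "((\<lambda>s. L (y - x + s *\<^sub>R e) * K (y - z + s *\<^sub>R e)) has_field_derivative
          L' (y - x + s *\<^sub>R e) * K (y - z + s *\<^sub>R e) + K' (y - z + s *\<^sub>R e) * L (y - x + s *\<^sub>R e)) (at s)"
        by (rule DERIV_mult[OF dL dK])
      then show "((\<lambda>s. L (y + s *\<^sub>R e - x) * K (y + s *\<^sub>R e - z)) has_field_derivative
          L' (y + s *\<^sub>R e - x) * K (y + s *\<^sub>R e - z) + L (y + s *\<^sub>R e - x) * K' (y + s *\<^sub>R e - z)) (at s)"
        by (simp add: add_diff_eq diff_add_eq mult.commute)
    qed
    then show ?thesis
      using kern_integrable[OF k1] kern_integrable[OF k2] by (simp add: add_eq_0_iff)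
  qed
  have adj: "(LBINT x. conv k w x * conv l g x)
      = (LBINT x. g x * (LBINT z. w z * (LBINT y. l (y - x) * k (y - z))))"
    if "kern k" "kern l" for k l
  proof -
    have "(LBINT x. conv k w x * conv l g x) = (LBINT x. g x * conv (\<lambda>z. l (- z)) (conv k w) x)"
      by (rule conv_adjoint[OF that(2) g conv_L2[OF that(1) w]])
    moreover have "conv (\<lambda>z. l (- z)) (conv k w) x = (LBINT z. w z * (LBINT y. l (y - x) * k (y - z)))" for x
      using conv_conv[OF that w, of x] by (simp add: conv_def[of "\<lambda>z. l (- z)"])
    ultimately show ?thesis by simp
  qed
  show ?thesis
    unfolding adj[OF kern(1,4)] adj[OF kern(2,3)] inner by simp
qed

section \<open>The energy inequality at a fixed time\<close>

lemma elliptic_young: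
  fixes D \<beta> :: "'d::finite \<Rightarrow> real" and A R :: "'d \<Rightarrow> 'd \<Rightarrow> real"
  assumes \<alpha>: "\<alpha> > 0" and ell: "(\<Sum>i\<in>UNIV. \<Sum>j\<in>UNIV. D i * A i j * D j) \<ge> \<alpha> * (\<Sum>i\<in>UNIV. (D i)\<^sup>2)"
  shows "(\<Sum>i\<in>UNIV. D i * \<beta> i) - (1/2) * (\<Sum>i\<in>UNIV. \<Sum>j\<in>UNIV. D i * (A i j * D j + R i j))
    \<le> 1 / (2 * \<alpha>) * (\<Sum>i\<in>UNIV. 2 * (\<beta> i)\<^sup>2 + (1/2) * real CARD('d) * (\<Sum>j\<in>UNIV. (R i j)\<^sup>2))"
proof -
  \<comment> \<open>Ellipticity disposes of the quadratic part; everything that remains linear in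
    \<open>D i\<close> is collected in \<open>c i\<close>.\<close>
  define c where "c i = \<beta> i - (1/2) * (\<Sum>j\<in>UNIV. R i j)" for i
  have "(\<Sum>i\<in>UNIV. \<Sum>j\<in>UNIV. D i * (A i j * D j + R i j))
      = (\<Sum>i\<in>UNIV. \<Sum>j\<in>UNIV. D i * A i j * D j) + (\<Sum>i\<in>UNIV. D i * (\<Sum>j\<in>UNIV. R i j))"
    by (simp add: algebra_simps sum.distrib sum_distrib_left)
  then have "(\<Sum>i\<in>UNIV. D i * \<beta> i) - (1/2) * (\<Sum>i\<in>UNIV. \<Sum>j\<in>UNIV. D i * (A i j * D j + R i j))
      \<le> (\<Sum>i\<in>UNIV. D i * \<beta> i) - (1/2) * (\<Sum>i\<in>UNIV. D i * (\<Sum>j\<in>UNIV. R i j)) - (1/2) * (\<alpha> * (\<Sum>i\<in>UNIV. (D i)\<^sup>2))"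
    using ell by argo
  also have "\<dots> = (\<Sum>i\<in>UNIV. D i * c i - \<alpha> / 2 * (D i)\<^sup>2)"
    by (simp add: c_def sum_subtractf sum_distrib_left sum_divide_distrib right_diff_distrib mult_ac)
  also have "\<dots> \<le> (\<Sum>i\<in>UNIV. 1 / (2 * \<alpha>) * (2 * (\<beta> i)\<^sup>2 + (1/2) * real CARD('d) * (\<Sum>j\<in>UNIV. (R i j)\<^sup>2)))"
  proof (intro sum_mono)
    fix i
    \<comment> \<open>Completing the square absorbs the gradient \<open>D i\<close> at the cost of
      \<open>c^2 / (2 \<alpha>)\<close>.\<close>
    have "0 \<le> (\<alpha> * D i - c i)\<^sup>2 / (2 * \<alpha>)" using \<alpha> by simp
    also have "\<dots> = (c i)\<^sup>2 / (2 * \<alpha>) - (D i * c i - \<alpha> / 2 * (D i)\<^sup>2)"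
      using \<alpha> by (simp add: power2_eq_square field_simps)
    finally have "D i * c i - \<alpha> / 2 * (D i)\<^sup>2 \<le> 1 / (2 * \<alpha>) * (c i)\<^sup>2" by simp
    also have "(c i)\<^sup>2 \<le> 2 * (\<beta> i)\<^sup>2 + 2 * ((1/2) * (\<Sum>j\<in>UNIV. R i j))\<^sup>2"
    proof -
      have "0 \<le> (\<beta> i + (1/2) * (\<Sum>j\<in>UNIV. R i j))\<^sup>2" by simp
      then show ?thesis by (simp add: c_def power2_eq_square algebra_simps)
    qed
    \<comment> \<open>Cauchy-Schwarz for the sum over \<open>j\<close> brings in the
      dimension.\<close>
    also have "\<dots> \<le> 2 * (\<beta> i)\<^sup>2 + (1/2) * real CARD('d) * (\<Sum>j\<in>UNIV. (R i j)\<^sup>2)"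
      using sum_squared_le_sum_of_squares[of "R i" UNIV] by (simp add: power_mult_distrib power2_eq_square mult_ac)
    finally show "D i * c i - \<alpha> / 2 * (D i)\<^sup>2 \<le> 1 / (2 * \<alpha>) *
        (2 * (\<beta> i)\<^sup>2 + (1/2) * real CARD('d) * (\<Sum>j\<in>UNIV. (R i j)\<^sup>2))"
      using \<alpha> by (simp add: divide_right_mono)
  qed
  finally show ?thesis by (simp add: sum_distrib_left)
qed

text \<open>The difference is the integral of \<open>K (x - y) * (a y - a x) * w y\<close>. The
  factor \<open>norm (x - y)\<close> from the Lipschitz bound is moved into the kernel: for a first
  derivative of a mollifier, \<open>\<bar>K z\<bar> * norm z\<close> has an \<open>L^1\<close> norm
  that does not depend on the scale.\<close>

lemma commutator_bound:
  fixes w a :: "'a::euclidean_space \<Rightarrow> real"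
  assumes K: "kern K" and w: "L2 w" and a: "a \<in> borel_measurable borel" "\<And>x. \<bar>a x\<bar> \<le> A"
    and lip: "AE y in lborel. \<bar>a y - a x\<bar> \<le> L * norm (x - y)"
  shows "\<bar>conv K (\<lambda>y. a y * w y) x - a x * conv K w x\<bar>
    \<le> L * conv (\<lambda>z. \<bar>K z\<bar> * norm z) (\<lambda>y. \<bar>w y\<bar>) x"
proof -
  have aw: "L2 (\<lambda>y. a y * w y)" by (rule L2_bounded_mult[OF w a])
  have kn: "kern (\<lambda>z. \<bar>K z\<bar> * norm z)"
    by (intro kern_mult kern_abs K continuous_intros)
  have i1: "integrable lborel (\<lambda>y. K (x - y) * (a y * w y))" "integrable lborel (\<lambda>y. K (x - y) * w y)"
    by (rule conv_integrable[OF K aw], rule conv_integrable[OF K w])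
  have i2: "integrable lborel (\<lambda>y. L * (\<bar>K (x - y)\<bar> * norm (x - y) * \<bar>w y\<bar>))"
    by (intro integrable_mult_right conv_integrable[OF kn L2_abs[OF w]])
  have "conv K (\<lambda>y. a y * w y) x - a x * conv K w x
      = (LBINT y. K (x - y) * (a y * w y) - a x * (K (x - y) * w y))"
    unfolding conv_def using i1 by simp
  also have "\<bar>\<dots>\<bar> \<le> (LBINT y. \<bar>K (x - y) * (a y * w y) - a x * (K (x - y) * w y)\<bar>)"
    by (rule integral_abs_bound)
  also have "\<dots> \<le> (LBINT y. L * (\<bar>K (x - y)\<bar> * norm (x - y) * \<bar>w y\<bar>))"
  proof (rule integral_mono_AE[OF _ i2])
    show "integrable lborel (\<lambda>y. \<bar>K (x - y) * (a y * w y) - a x * (K (x - y) * w y)\<bar>)"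
      using i1 by simp
    show "AE y in lborel. \<bar>K (x - y) * (a y * w y) - a x * (K (x - y) * w y)\<bar>
        \<le> L * (\<bar>K (x - y)\<bar> * norm (x - y) * \<bar>w y\<bar>)"
      using lip
    proof eventually_elim
      case (elim y)
      have "K (x - y) * (a y * w y) - a x * (K (x - y) * w y) = (a y - a x) * (K (x - y) * w y)"
        by (simp add: algebra_simps)
      then have "\<bar>K (x - y) * (a y * w y) - a x * (K (x - y) * w y)\<bar> = \<bar>a y - a x\<bar> * (\<bar>K (x - y)\<bar> * \<bar>w y\<bar>)"
        by (simp add: abs_mult)
      also have "\<dots> \<le> (L * norm (x - y)) * (\<bar>K (x - y)\<bar> * \<bar>w y\<bar>)"
        by (intro mult_right_mono elim) auto
      finally show ?case by (simp add: mult_ac)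
    qed
  qed
  finally show ?thesis by (simp add: conv_def)
qed

text \<open>Here \<open>K i\<close> and \<open>KK i j\<close> are the first and second derivatives
  of \<rho>. After integration by parts the mollified gradient \<open>D\<close> meets
  \<open>V i j = a i j * D j + R i j\<close> with commutator \<open>R\<close>; ellipticity controls
  \<open>D\<close>, and Young's inequality bounds what is left by the norm of \<open>w\<close>. In
  the constant, one factor \<open>CARD('d)\<close> comes from the sum over \<open>i\<close>, the two
  others from Cauchy-Schwarz and the sum over \<open>j\<close>.\<close>

theorem slice_energy:
  fixes w :: "real ^ 'd::finite \<Rightarrow> real" and b :: "'d \<Rightarrow> real ^ 'd \<Rightarrow> real"
    and a :: "'d \<Rightarrow> 'd \<Rightarrow> real ^ 'd \<Rightarrow> real"
  assumes w: "L2 w"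
    and \<rho>: "kern \<rho>" and K: "\<And>i. kern (K i)" and KK: "\<And>i j. kern (KK i j)"
    and d\<rho>: "\<And>i y s. ((\<lambda>s. \<rho> (y + s *\<^sub>R axis i 1)) has_field_derivative K i (y + s *\<^sub>R axis i 1)) (at s)"
    and dK: "\<And>i j y s. ((\<lambda>s. K j (y + s *\<^sub>R axis i 1)) has_field_derivative KK i j (y + s *\<^sub>R axis i 1)) (at s)"
    and b: "\<And>i. b i \<in> borel_measurable borel" "\<And>i x. \<bar>b i x\<bar> \<le> B"
    and a: "\<And>i j. a i j \<in> borel_measurable borel" "\<And>i j x. \<bar>a i j x\<bar> \<le> A"
    and lip: "AE x in lborel. AE y in lborel. \<forall>i j. \<bar>a i j y - a i j x\<bar> \<le> L * norm (x - y)"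
    and ell: "AE x in lborel. \<forall>\<xi>::real ^ 'd. (\<Sum>i\<in>UNIV. \<Sum>j\<in>UNIV. \<xi> $ i * a i j x * \<xi> $ j) \<ge> \<alpha> * (norm \<xi>)\<^sup>2"
    and \<alpha>: "\<alpha> > 0"
    and \<rho>1: "(LBINT z. \<bar>\<rho> z\<bar>) \<le> 1"
    and \<kappa>: "\<And>j. (LBINT z. \<bar>K j z\<bar> * norm z) \<le> \<kappa>"
  shows "(LBINT x. conv \<rho> w x * ((1/2) * (\<Sum>i\<in>UNIV. \<Sum>j\<in>UNIV. conv (KK i j) (\<lambda>y. a i j y * w y) x)
        - (\<Sum>i\<in>UNIV. conv (K i) (\<lambda>y. b i y * w y) x)))
    \<le> 1 / (2 * \<alpha>) * real CARD('d) * (2 * B\<^sup>2 + (1/2) * (real CARD('d))\<^sup>2 * (L * \<kappa>)\<^sup>2) * (LBINT x. (w x)\<^sup>2)"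
proof -
  define W2 where "W2 = (LBINT x. (w x)\<^sup>2)"
  have W2: "W2 \<ge> 0" by (simp add: W2_def)
  define D where "D i = conv (K i) w" for i
  define \<beta> where "\<beta> i = conv \<rho> (\<lambda>y. b i y * w y)" for i
  define V where "V i j = conv (K j) (\<lambda>y. a i j y * w y)" for i j
  define R where "R i j x = V i j x - a i j x * D j x" for i j x
  have bw: "L2 (\<lambda>y. b i y * w y)" for i by (rule L2_bounded_mult[OF w b])
  have aw: "L2 (\<lambda>y. a i j y * w y)" for i j by (rule L2_bounded_mult[OF w a])
  have DL: "L2 (D i)" and \<beta>L: "L2 (\<beta> i)" and VL: "L2 (V i j)" for i j
    unfolding D_def \<beta>_def V_def by (intro conv_L2 K w \<rho> bw aw)+
  have RL: "L2 (R i j)" for i j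
    unfolding R_def[abs_def] by (intro L2_diff VL L2_bounded_mult[OF DL a])
  have kn: "kern (\<lambda>z. \<bar>K j z\<bar> * norm z)" for j
    by (intro kern_mult kern_abs K continuous_intros)
  have \<beta>2: "(LBINT x. (\<beta> i x)\<^sup>2) \<le> B\<^sup>2 * W2" for i
  proof -
    have "(LBINT x. (\<beta> i x)\<^sup>2) \<le> (LBINT z. \<bar>\<rho> z\<bar>)\<^sup>2 * (LBINT x. (b i x * w x)\<^sup>2)"
      unfolding \<beta>_def by (rule conv_L2_le[OF \<rho> bw])
    also have "\<dots> \<le> 1 * (B\<^sup>2 * W2)"
      unfolding W2_def using \<rho>1
      by (intro mult_mono L2_bounded_mult_le[OF w b]) (auto simp: power_le_one)
    finally show ?thesis by simp
  qed
  \<comment> \<open>Young's inequality with the kernel of \<open>commutator_bound\<close>, whose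
    \<open>L^1\<close> norm is at most \<kappa>.\<close>
  have R2: "(LBINT x. (R i j x)\<^sup>2) \<le> (L * \<kappa>)\<^sup>2 * W2" for i j
  proof -
    let ?c = "conv (\<lambda>z. \<bar>K j z\<bar> * norm z) (\<lambda>y. \<bar>w y\<bar>)"
    have cL: "L2 ?c" by (intro conv_L2 kn L2_abs w)
    have "AE x in lborel. \<bar>R i j x\<bar> \<le> \<bar>L * ?c x\<bar>"
      using lip
    proof eventually_elim
      case (elim x)
      have "AE y in lborel. \<bar>a i j y - a i j x\<bar> \<le> L * norm (x - y)"
        using elim by eventually_elim simp
      from commutator_bound[OF K[of j] w a this] show ?case
        by (auto simp: R_def V_def D_def)
    qed
    then have "(LBINT x. (R i j x)\<^sup>2) \<le> (LBINT x. (L * ?c x)\<^sup>2)"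
      by (rule L2_integral_mono[OF L2_scale[OF cL] RL])
    also have "\<dots> = L\<^sup>2 * (LBINT x. (?c x)\<^sup>2)" by (simp add: power_mult_distrib)
    also have "\<dots> \<le> L\<^sup>2 * (\<kappa>\<^sup>2 * W2)"
    proof (intro mult_left_mono)
      have "(LBINT x. (?c x)\<^sup>2) \<le> (LBINT z. \<bar>\<bar>K j z\<bar> * norm z\<bar>)\<^sup>2 * (LBINT y. \<bar>w y\<bar>\<^sup>2)"
        by (rule conv_L2_le[OF kn L2_abs[OF w]])
      also have "\<dots> \<le> \<kappa>\<^sup>2 * W2"
        unfolding W2_def using \<kappa>[of j] by (intro mult_mono power_mono) (auto simp: abs_mult)
      finally show "(LBINT x. (?c x)\<^sup>2) \<le> \<kappa>\<^sup>2 * W2" .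
    qed simp
    finally show ?thesis by (simp add: power_mult_distrib mult.assoc)
  qed
  have ibp_b: "(LBINT x. conv \<rho> w x * conv (K i) (\<lambda>y. b i y * w y) x) = - (LBINT x. D i x * \<beta> i x)" for i
    unfolding D_def \<beta>_def by (rule conv_integration_by_parts[OF \<rho> K \<rho> K w bw d\<rho> d\<rho>])
  \<comment> \<open>Only the derivative in direction \<open>i\<close> is moved to the other factor;
    the one in direction \<open>j\<close> stays on the product \<open>a i j * w\<close> and becomes
    the commutator later.\<close>
  have ibp_a: "(LBINT x. conv \<rho> w x * conv (KK i j) (\<lambda>y. a i j y * w y) x) = - (LBINT x. D i x * V i j x)" for i j
    unfolding D_def V_def by (rule conv_integration_by_parts[OF \<rho> K K KK w aw d\<rho> dK])
  have \<rho>w: "L2 (conv \<rho> w)" by (rule conv_L2[OF \<rho> w])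
  have ii: "integrable lborel (\<lambda>x. conv \<rho> w x * conv (K i) (\<lambda>y. b i y * w y) x)"
    "integrable lborel (\<lambda>x. conv \<rho> w x * conv (KK i j) (\<lambda>y. a i j y * w y) x)"
    "integrable lborel (\<lambda>x. D i x * \<beta> i x)" "integrable lborel (\<lambda>x. D i x * V i j x)" for i j
    by (intro L2_mult_integrable \<rho>w DL \<beta>L VL conv_L2 K KK bw aw)+
  have "(LBINT x. conv \<rho> w x * ((1/2) * (\<Sum>i\<in>UNIV. \<Sum>j\<in>UNIV. conv (KK i j) (\<lambda>y. a i j y * w y) x)
        - (\<Sum>i\<in>UNIV. conv (K i) (\<lambda>y. b i y * w y) x)))
    = (LBINT x. (1/2) * (\<Sum>i\<in>UNIV. \<Sum>j\<in>UNIV. conv \<rho> w x * conv (KK i j) (\<lambda>y. a i j y * w y) x)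
        - (\<Sum>i\<in>UNIV. conv \<rho> w x * conv (K i) (\<lambda>y. b i y * w y) x))"
    by (intro Bochner_Integration.integral_cong refl) (simp add: right_diff_distrib sum_distrib_left mult.left_commute)
  also have "\<dots> = (1/2) * (\<Sum>i\<in>UNIV. \<Sum>j\<in>UNIV. - (LBINT x. D i x * V i j x))
      - (\<Sum>i\<in>UNIV. - (LBINT x. D i x * \<beta> i x))"
    using ii by (simp add: ibp_a ibp_b)
  also have "\<dots> = (LBINT x. (\<Sum>i\<in>UNIV. D i x * \<beta> i x) - (1/2) * (\<Sum>i\<in>UNIV. \<Sum>j\<in>UNIV. D i x * V i j x))"
    using ii by (simp add: sum_negf)
  also have "\<dots> \<le> (LBINT x. 1 / (2 * \<alpha>) * (\<Sum>i\<in>UNIV. 2 * (\<beta> i x)\<^sup>2 + (1/2) * real CARD('d) * (\<Sum>j\<in>UNIV. (R i j x)\<^sup>2)))"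
  proof (rule integral_mono_AE)
    show "integrable lborel (\<lambda>x. (\<Sum>i\<in>UNIV. D i x * \<beta> i x) - (1/2) * (\<Sum>i\<in>UNIV. \<Sum>j\<in>UNIV. D i x * V i j x))"
      using ii by (intro Bochner_Integration.integrable_diff integrable_mult_right Bochner_Integration.integrable_sum) auto
    show "integrable lborel (\<lambda>x. 1 / (2 * \<alpha>) * (\<Sum>i\<in>UNIV. 2 * (\<beta> i x)\<^sup>2 + (1/2) * real CARD('d) * (\<Sum>j\<in>UNIV. (R i j x)\<^sup>2)))"
      using \<beta>L RL by (intro Bochner_Integration.integrable_add integrable_mult_right Bochner_Integration.integrable_sum)
        (auto simp: L2_def)
    show "AE x in lborel. (\<Sum>i\<in>UNIV. D i x * \<beta> i x) - (1/2) * (\<Sum>i\<in>UNIV. \<Sum>j\<in>UNIV. D i x * V i j x)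
      \<le> 1 / (2 * \<alpha>) * (\<Sum>i\<in>UNIV. 2 * (\<beta> i x)\<^sup>2 + (1/2) * real CARD('d) * (\<Sum>j\<in>UNIV. (R i j x)\<^sup>2))"
      using ell
    proof eventually_elim
      case (elim x)
      have "\<alpha> * (norm (vec_lambda (\<lambda>i. D i x)))\<^sup>2 \<le> (\<Sum>i\<in>UNIV. \<Sum>j\<in>UNIV. D i x * a i j x * D j x)"
        using elim[rule_format, of "vec_lambda (\<lambda>i. D i x)"] by simp
      then have "\<alpha> * (\<Sum>i\<in>UNIV. (D i x)\<^sup>2) \<le> (\<Sum>i\<in>UNIV. \<Sum>j\<in>UNIV. D i x * a i j x * D j x)"
        by (simp add: norm_vec_def L2_set_def sum_nonneg)
      from elliptic_young[OF \<alpha> this, of "\<lambda>i. \<beta> i x" "\<lambda>i j. R i j x"]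
      show ?case by (simp add: R_def)
    qed
  qed
  also have "\<dots> = 1 / (2 * \<alpha>) * (\<Sum>i\<in>UNIV. 2 * (LBINT x. (\<beta> i x)\<^sup>2)
      + (1/2) * real CARD('d) * (\<Sum>j\<in>UNIV. (LBINT x. (R i j x)\<^sup>2)))"
    using \<beta>L RL by (simp add: L2_def)
  also have "\<dots> \<le> 1 / (2 * \<alpha>) * (\<Sum>i\<in>(UNIV::'d set). 2 * (B\<^sup>2 * W2)
      + (1/2) * real CARD('d) * (\<Sum>j\<in>(UNIV::'d set). (L * \<kappa>)\<^sup>2 * W2))"
    using \<alpha> by (intro mult_left_mono sum_mono add_mono \<beta>2 R2) auto
  also have "\<dots> = 1 / (2 * \<alpha>) * real CARD('d) * (2 * B\<^sup>2 + (1/2) * (real CARD('d))\<^sup>2 * (L * \<kappa>)\<^sup>2) * W2"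
    by (simp add: algebra_simps power2_eq_square)
  finally show ?thesis by (simp add: W2_def)
qed

section \<open>Mollifiers\<close>

text \<open>The partial derivative with multi-index \<open>m\<close> of the tensor product of
  \<open>d\<close> copies of \<open>g\<close>. Differentiating in direction \<open>i\<close> is then
  \<open>inc i\<close> on the multi-index (\<open>kfun_DERIV\<close>).\<close>

definition kfun :: "(real \<Rightarrow> real) \<Rightarrow> ('d::finite \<Rightarrow> nat) \<Rightarrow> real ^ 'd \<Rightarrow> real" where
  "kfun g m z = (\<Prod>i\<in>UNIV. (deriv ^^ m i) g (z $ i))"

abbreviation inc :: "'d \<Rightarrow> ('d \<Rightarrow> nat) \<Rightarrow> 'd \<Rightarrow> nat" where
  "inc i m \<equiv> m(i := Suc (m i))"

lemma deriv_eq_0_outside: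
  assumes "smooth1 g" "\<And>s. \<bar>s\<bar> > R \<Longrightarrow> g s = 0" "\<bar>s\<bar> > R"
  shows "(deriv ^^ k) g s = 0"
  using assms(3)
proof (induction k arbitrary: s)
  case (Suc k)
  have "((\<lambda>_. 0) has_field_derivative 0) (at s)" by simp
  then have "((deriv ^^ k) g has_field_derivative 0) (at s)"
  proof (rule DERIV_cong_ev[THEN iffD1, rotated -1])
    have "open {s. \<bar>s\<bar> > R}" by (intro open_Collect_less continuous_intros)
    then show "\<forall>\<^sub>F x in nhds s. 0 = (deriv ^^ k) g x"
      unfolding eventually_nhds using Suc by (intro exI[of _ "{s. \<bar>s\<bar> > R}"]) auto
  qed auto
  then show ?case by (simp add: DERIV_imp_deriv)
qed (use assms in auto)

text \<open>The norm is at most the sum of the absolute coordinates, so beyond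
  \<open>CARD('d) * R\<close> some coordinate exceeds \<open>R\<close> and its factor
  vanishes.\<close>

lemma kfun_support:
  fixes z :: "real ^ 'd::finite"
  assumes "smooth1 g" "\<And>s. \<bar>s\<bar> > R \<Longrightarrow> g s = 0" "norm z > real CARD('d) * R"
  shows "kfun g m z = 0"
proof -
  have "\<exists>i. \<bar>z $ i\<bar> > R"
  proof (rule ccontr)
    assume "\<nexists>i. \<bar>z $ i\<bar> > R"
    then have "(\<Sum>i\<in>UNIV. \<bar>z $ i\<bar>) \<le> (\<Sum>i\<in>(UNIV::'d set). R)"
      by (intro sum_mono) (simp add: not_less)
    then show False using assms(3) norm_le_l1_cart[of z] by simp
  qed
  then show ?thesis using deriv_eq_0_outside[OF assms(1,2)] by (auto simp: kfun_def)
qed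

lemma kfun_kern:
  assumes g: "smooth1 g" "\<And>s. \<bar>s\<bar> > R \<Longrightarrow> g s = 0"
  shows "kern (kfun g m :: real ^ 'd::finite \<Rightarrow> real)"
  unfolding kern_def
proof
  have "continuous_on UNIV (\<lambda>z::real ^ 'd. (deriv ^^ m i) g (z $ i))" for i
    by (rule continuous_on_compose2[OF smooth1_continuous[OF smooth1_funpow_deriv[OF g(1)], of UNIV]])
       (auto intro!: continuous_intros)
  then show "continuous_on UNIV (kfun g m :: real ^ 'd \<Rightarrow> real)"
    unfolding kfun_def[abs_def] by (intro continuous_intros)
  have "kfun g m z = 0" if "norm z > real CARD('d) * R" for z :: "real ^ 'd"
    by (rule kfun_support[OF g that])
  then show "\<exists>R. \<forall>z. norm z > R \<longrightarrow> kfun g m (z :: real ^ 'd) = 0" by blast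
qed

lemma kfun_DERIV:
  fixes y :: "real ^ 'd::finite"
  assumes g: "smooth1 g"
  shows "((\<lambda>s. kfun g m (y + s *\<^sub>R axis i 1)) has_field_derivative kfun g (inc i m) (y + s *\<^sub>R axis i 1)) (at s)"
proof -
  define c where "c = (\<Prod>j\<in>UNIV - {i}. (deriv ^^ m j) g (y $ j))"
  have split: "kfun g m' (y + s *\<^sub>R axis i 1) = (deriv ^^ m' i) g (y $ i + s) * c"
    if "\<And>j. j \<noteq> i \<Longrightarrow> m' j = m j" for m' s
    unfolding kfun_def c_def
    by (subst prod.remove[of UNIV i]) (auto simp: axis_def that intro!: prod.cong)
  have 1: "((deriv ^^ m i) g has_field_derivative (deriv ^^ Suc (m i)) g (y $ i + s)) (at (y $ i + s))"
    using g unfolding smooth1_def by blast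
  have 2: "((\<lambda>s. y $ i + s) has_field_derivative 1) (at s)"
    by (auto intro!: derivative_eq_intros)
  have "((\<lambda>s. (deriv ^^ m i) g (y $ i + s) * c) has_field_derivative (deriv ^^ Suc (m i)) g (y $ i + s) * c) (at s)"
    using DERIV_cmult_right[OF DERIV_chain2[OF 1 2]] by simp
  then show ?thesis
    by (simp add: split)
qed

lemma kfun_scale_0:
  "kfun (\<lambda>s. N * g (N * s)) (\<lambda>_. 0) z = N ^ CARD('d) * kfun g (\<lambda>_. 0) (N *\<^sub>R z)" for z :: "real ^ 'd::finite"
  by (simp add: kfun_def prod.distrib)

lemma kfun_scale_1:
  fixes z :: "real ^ 'd::finite"
  assumes "smooth1 g"
  shows "kfun (\<lambda>s. N * g (N * s)) (inc i (\<lambda>_. 0)) z = N * N ^ CARD('d) * kfun g (inc i (\<lambda>_. 0)) (N *\<^sub>R z)"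
proof -
  have "deriv (\<lambda>s. N * g (N * s)) s = N * (N * deriv g (N * s))" for s
  proof (rule DERIV_imp_deriv)
    have "((\<lambda>s. N * s) has_field_derivative N) (at s)" by (auto intro!: derivative_eq_intros)
    from DERIV_cmult[OF DERIV_chain2[OF smooth1_DERIV[OF assms] this], of N]
    show "((\<lambda>s. N * g (N * s)) has_field_derivative N * (N * deriv g (N * s))) (at s)"
      by (simp add: mult_ac)
  qed
  then show ?thesis
    unfolding kfun_def
    by (subst (1 2) prod.remove[of UNIV i])
       (auto simp: prod.distrib mult_ac power_Suc[symmetric] simp del: power_Suc intro!: prod.cong)
qed

lemma integral_scale:
  fixes f :: "'a::euclidean_space \<Rightarrow> real"
  assumes [measurable]: "f \<in> borel_measurable borel" and "c > 0"
  shows "(LBINT x. c ^ DIM('a) * f (c *\<^sub>R x)) = (LBINT x. f x)"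
proof -
  have eq: "(lborel :: 'a measure) = density (distr lborel borel (\<lambda>x. 0 + c *\<^sub>R x)) (\<lambda>_. ennreal (\<bar>c\<bar> ^ DIM('a)))"
    by (rule lborel_affine) (use assms in simp)
  have "(LBINT x. f x) = (\<integral>x. f x \<partial>(density (distr lborel borel (\<lambda>x. 0 + c *\<^sub>R x)) (\<lambda>_. ennreal (\<bar>c\<bar> ^ DIM('a)))))"
    using eq by simp
  also have "\<dots> = (\<integral>x. c ^ DIM('a) * f x \<partial>(distr lborel borel (\<lambda>x. 0 + c *\<^sub>R x)))"
    using assms by (subst integral_real_density) auto
  also have "\<dots> = (LBINT x. c ^ DIM('a) * f (c *\<^sub>R x))"
    by (subst integral_distr) auto
  finally show ?thesis by simp
qed

text \<open>The essential point is that \<kappa> does not depend on \<open>n\<close>. A derivative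
  of the profile rescaled by \<open>N\<close> carries an additional factor \<open>N\<close>, which
  turns \<open>norm z\<close> into \<open>norm (N *\<^sub>R z)\<close>; the change of variables then
  removes \<open>N\<close> altogether.\<close>

theorem mollifiers_exist:
  obtains g :: "nat \<Rightarrow> real \<Rightarrow> real" and \<kappa> :: real where
    "\<And>n. smooth1 (g n)" "\<And>n s. g n s \<ge> 0" "\<And>n s. \<bar>s\<bar> > 1 / real (Suc n) \<Longrightarrow> g n s = 0"
    "\<And>n. (LBINT z. kfun (g n) (\<lambda>_. 0) (z :: real ^ 'd::finite)) = 1"
    "\<And>n j. (LBINT z. \<bar>kfun (g n) (inc j (\<lambda>_. 0)) (z :: real ^ 'd)\<bar> * norm z) \<le> \<kappa>"
proof -
  define \<beta> where "\<beta> = bump 1 (-1) 1"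
  have \<beta>: "smooth1 \<beta>" "\<And>s. \<bar>s\<bar> > 1 \<Longrightarrow> \<beta> s = 0" "\<And>s. \<beta> s \<ge> 0"
    by (auto simp: \<beta>_def smooth1_bump bump_nonneg intro!: bump_eq_0)
  define P where "P = (kfun \<beta> (\<lambda>_. 0) :: real ^ 'd \<Rightarrow> real)"
  have P: "kern P" unfolding P_def by (rule kfun_kern[OF \<beta>(1,2)])
  have P0: "P z \<ge> 0" for z by (auto simp: P_def kfun_def intro!: prod_nonneg \<beta>)
  define c where "c = (LBINT z. P z)"
  have "c \<noteq> 0"
  proof
    assume "c = 0"
    then have AE0: "AE z in lborel. P z = 0"
      unfolding c_def using integral_nonneg_eq_0_iff_AE[OF kern_integrable[OF P]] P0 by auto
    \<comment> \<open>The product is positive on an open cube of volume \<open>2 ^ d\<close>, so it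
      cannot vanish almost everywhere.\<close>
    have pos: "P z \<noteq> 0" if "z \<in> box (-One) One" for z
    proof -
      have "-1 < z $ i \<and> z $ i < 1" for i
      proof -
        have ax: "axis i 1 \<in> (Basis :: (real ^ 'd) set)" by (simp add: axis_in_Basis_iff)
        have "One \<bullet> axis i (1::real) = 1"
          using ax by (simp add: inner_sum_left inner_Basis)
        then show ?thesis
          using that ax unfolding mem_box by (metis cart_eq_inner_axis inner_minus_left)
      qed
      then show ?thesis by (simp add: P_def kfun_def \<beta>_def less_imp_neq[OF bump_pos, symmetric])
    qed
    have "AE z in lborel. z \<notin> box (-One) (One :: real ^ 'd)"
      using AE0 by eventually_elim (use pos in blast)
    then have "emeasure lborel (box (-One) (One :: real ^ 'd)) = 0"
      by (subst (asm) AE_iff_measurable[OF _ refl]) auto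
    moreover have "emeasure lborel (box (-One) (One :: real ^ 'd)) = ennreal (\<Prod>b\<in>(Basis :: (real ^ 'd) set). 2)"
    proof (subst emeasure_lborel_box)
      show "ennreal (\<Prod>b\<in>Basis. (One - - One :: real ^ 'd) \<bullet> b) = ennreal (\<Prod>b\<in>(Basis :: (real ^ 'd) set). 2)"
        by (intro arg_cong[where f = ennreal] prod.cong refl)
           (simp only: inner_diff_left inner_minus_left inner_sum_left_Basis, simp)
    qed (simp add: inner_sum_left_Basis)
    ultimately show False by simp
  qed
  moreover have "c \<ge> 0" unfolding c_def by (rule integral_nonneg_AE) (simp add: P0)
  ultimately have c: "c > 0" by simp
  \<comment> \<open>The normalisation is distributed evenly over the \<open>d\<close> factors,
    whence the root of order \<open>d\<close>.\<close>
  define \<gamma> where "\<gamma> = root CARD('d) (1 / c)"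
  have \<gamma>: "\<gamma> \<ge> 0" "\<gamma> ^ CARD('d) = 1 / c"
    using c by (auto simp: \<gamma>_def)
  define h where "h s = \<gamma> * \<beta> s" for s
  have h: "smooth1 h" "\<And>s. \<bar>s\<bar> > 1 \<Longrightarrow> h s = 0" "\<And>s. h s \<ge> 0"
    using \<beta> \<gamma> smooth1_mult[OF smooth1_const \<beta>(1), of \<gamma>] by (auto simp: h_def[abs_def])
  have hP: "kfun h (\<lambda>_. 0) z = P z / c" for z :: "real ^ 'd"
    using \<gamma> by (simp add: kfun_def h_def P_def prod.distrib)
  define g where "g n s = real (Suc n) * h (real (Suc n) * s)" for n s
  \<comment> \<open>Summing over \<open>j\<close> gives one constant for all directions.\<close>
  define \<kappa> where "\<kappa> = (\<Sum>j\<in>UNIV. LBINT z. \<bar>kfun h (inc j (\<lambda>_. 0)) (z :: real ^ 'd)\<bar> * norm z)"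
  have kh: "kern (kfun h m :: real ^ 'd \<Rightarrow> real)" for m by (rule kfun_kern[OF h(1,2)])
  show ?thesis
  proof (rule that[of g \<kappa>])
    fix n
    define N where "N = real (Suc n)"
    have N: "N > 0" by (simp add: N_def)
    have gN: "g n = (\<lambda>s. N * h (N * s))" by (simp add: g_def[abs_def] N_def)
    show "smooth1 (g n)"
      unfolding gN using smooth1_mult[OF smooth1_const smooth1_affine[OF h(1), of N 0]] by simp
    show "g n s \<ge> 0" for s unfolding gN using N h(3) by simp
    show "g n s = 0" if "\<bar>s\<bar> > 1 / real (Suc n)" for s
    proof -
      have "\<bar>N * s\<bar> > 1" using that N unfolding N_def[symmetric] by (simp add: abs_mult field_simps)
      then show ?thesis by (simp add: gN h(2))
    qed
    have "(LBINT z. kfun (g n) (\<lambda>_. 0) (z :: real ^ 'd)) = (LBINT z. N ^ DIM(real ^ 'd) * kfun h (\<lambda>_. 0) (N *\<^sub>R z :: real ^ 'd))"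
      unfolding gN kfun_scale_0 by simp
    also have "\<dots> = (LBINT z. kfun h (\<lambda>_. 0) (z :: real ^ 'd))"
      by (rule integral_scale[OF kern_borel[OF kh] N])
    also have "\<dots> = 1" using c by (simp add: hP c_def[symmetric])
    finally show "(LBINT z. kfun (g n) (\<lambda>_. 0) (z :: real ^ 'd)) = 1" .
    fix j :: 'd
    have "(LBINT z. \<bar>kfun (g n) (inc j (\<lambda>_. 0)) (z :: real ^ 'd)\<bar> * norm z)
      = (LBINT z. N ^ DIM(real ^ 'd) * (\<bar>kfun h (inc j (\<lambda>_. 0)) (N *\<^sub>R z :: real ^ 'd)\<bar> * norm (N *\<^sub>R z)))"
      unfolding gN kfun_scale_1[OF h(1)] using N by (simp add: abs_mult mult_ac)
    also have "\<dots> = (LBINT z. \<bar>kfun h (inc j (\<lambda>_. 0)) (z :: real ^ 'd)\<bar> * norm z)"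
      by (rule integral_scale[OF _ N, where f = "\<lambda>z. \<bar>kfun h (inc j (\<lambda>_. 0)) z\<bar> * norm z"])
         (use kern_borel[OF kh] in measurable)
    also have "\<dots> \<le> \<kappa>"
      unfolding \<kappa>_def by (rule member_le_sum) (auto intro!: integral_nonneg)
    finally show "(LBINT z. \<bar>kfun (g n) (inc j (\<lambda>_. 0)) (z :: real ^ 'd)\<bar> * norm z) \<le> \<kappa>" .
  qed
qed

section \<open>Separated test functions\<close>

lemma prod_Basis_pair:
  fixes h :: "real \<times> (real ^ 'd::finite) \<Rightarrow> 'c::comm_monoid_mult"
  shows "prod h Basis = h (1, 0) * (\<Prod>i\<in>UNIV. h (0, axis i 1))"
proof -
  have B: "(Basis :: (real ^ 'd) set) = range (\<lambda>i. axis i 1)"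
    by (auto simp: Basis_vec_def)
  have eq: "Basis = insert (1, 0 :: real ^ 'd) ((\<lambda>i. (0 :: real, axis i 1 :: real ^ 'd)) ` UNIV)"
    unfolding Basis_prod_def B by auto
  have inj: "inj (\<lambda>i. (0 :: real, axis i 1 :: real ^ 'd))"
    by (auto simp: inj_on_def axis_eq_axis)
  show ?thesis
    unfolding eq by (subst prod.insert) (auto simp: prod.reindex[OF inj])
qed

lemma DERIV_along_line:
  fixes f :: "'a::real_normed_vector \<Rightarrow> real"
  assumes "f differentiable (at (p + s *\<^sub>R v))"
  shows "((\<lambda>s. f (p + s *\<^sub>R v)) has_field_derivative frechet_derivative f (at (p + s *\<^sub>R v)) v) (at s)"
proof -
  have lin: "linear (frechet_derivative f (at (p + s *\<^sub>R v)))"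
    using assms by (rule linear_frechet_derivative)
  have "((\<lambda>s. p + s *\<^sub>R v) has_derivative (\<lambda>s. s *\<^sub>R v)) (at s)"
    by (auto intro!: derivative_eq_intros)
  moreover have "(f has_derivative frechet_derivative f (at (p + s *\<^sub>R v))) (at (p + s *\<^sub>R v))"
    using assms by (simp add: frechet_derivative_works)
  ultimately have "((\<lambda>s. f (p + s *\<^sub>R v)) has_derivative (\<lambda>r. frechet_derivative f (at (p + s *\<^sub>R v)) (r *\<^sub>R v))) (at s)"
    by (rule has_derivative_compose)
  then show ?thesis
    unfolding has_field_derivative_def
    by (rule has_derivative_eq_rhs) (simp add: fun_eq_iff linear_scale[OF lin] mult.commute)
qed

text \<open>Once differentiability is known, partial derivatives can be computed along a line with
  the one-variable rules.\<close>

lemma directional_derivative: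
  fixes f :: "'a::real_normed_vector \<Rightarrow> real"
  assumes "f differentiable (at p)"
    and "((\<lambda>s. f (p + s *\<^sub>R v)) has_field_derivative D) (at 0)"
  shows "frechet_derivative f (at p) v = D"
  using DERIV_along_line[of f p 0 v] assms DERIV_unique by fastforce

lemma smooth_fun_differentiable: "smooth_fun f \<Longrightarrow> f differentiable (at p)"
  unfolding smooth_fun_def by (drule spec[of _ "[]"]) simp

lemma smooth_fun_dx_differentiable: "smooth_fun f \<Longrightarrow> dx i f differentiable (at p)"
  unfolding smooth_fun_def by (drule spec[of _ "[(0, axis i 1)]"]) (simp add: dx_def[abs_def] Basis_prod_def del: split_paired_All)

text \<open>The point \<open>x\<close> is a parameter: integrating against this test function
  produces the convolution at \<open>x\<close>, tested in time with \<theta>. In coordinates it is a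
  tensor product, which yields smoothness and support.\<close>

definition sep_test :: "(real \<Rightarrow> real) \<Rightarrow> (real \<Rightarrow> real) \<Rightarrow> real ^ 'd::finite \<Rightarrow> real \<times> (real ^ 'd) \<Rightarrow> real" where
  "sep_test \<theta> g x p = \<theta> (fst p) * kfun g (\<lambda>_. 0) (x - snd p)"

lemma sep_test_tens:
  "sep_test \<theta> g x = tens (\<lambda>e. if e = (1, 0) then \<theta> else (\<lambda>s. g (x \<bullet> snd e - s)))"
  by (auto simp: fun_eq_iff sep_test_def tens_def prod_Basis_pair kfun_def cart_eq_inner_axis[symmetric] axis_eq_0_iff
      inner_diff_left)

context
  fixes \<theta> g :: "real \<Rightarrow> real" and R :: real and x :: "real ^ 'd::finite"
  assumes \<theta>: "smooth1 \<theta>" and g: "smooth1 g"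
begin

lemma smooth_sep_test: "smooth_fun (sep_test \<theta> g x)"
  unfolding sep_test_tens
proof (rule smooth_fun_tens)
  fix e :: "real \<times> (real ^ 'd)"
  have "smooth1 (\<lambda>s. g ((-1) * s + x \<bullet> snd e))"
    by (rule smooth1_affine[OF g])
  then show "smooth1 (if e = (1, 0) then \<theta> else (\<lambda>s. g (x \<bullet> snd e - s)))"
    using \<theta> by (simp add: algebra_simps)
qed

text \<open>The kernel is evaluated at \<open>x - snd p\<close>, so each space derivative
  contributes a sign. The factor \<open>c\<close> is carried along so that the lemma can be applied
  to its own result.\<close>

lemma dx_sep:
  assumes "f differentiable (at p)" and f: "f = (\<lambda>p. c * \<theta> (fst p) * kfun g m (x - snd p))"
  shows "dx i f p = - c * \<theta> (fst p) * kfun g (inc i m) (x - snd p)"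
  unfolding dx_def
proof (rule directional_derivative[OF assms(1)])
  have 1: "((\<lambda>s. kfun g m ((x - snd p) + s *\<^sub>R axis i 1)) has_field_derivative
      kfun g (inc i m) ((x - snd p) + (- 0) *\<^sub>R axis i 1)) (at (- 0))"
    by (rule kfun_DERIV[OF g])
  have 2: "((\<lambda>s. - s) has_field_derivative - 1) (at (0::real))"
    by (auto intro!: derivative_eq_intros)
  show "((\<lambda>s. f (p + s *\<^sub>R (0, axis i 1))) has_field_derivative
      - c * \<theta> (fst p) * kfun g (inc i m) (x - snd p)) (at 0)"
    using DERIV_cmult[OF DERIV_chain2[OF 1 2], of "c * \<theta> (fst p)"]
    by (simp add: f diff_diff_eq)
qed

lemma dx_sep_test: "dx i (sep_test \<theta> g x) = (\<lambda>p. (-1) * \<theta> (fst p) * kfun g (inc i (\<lambda>_. 0)) (x - snd p))"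
  using dx_sep[OF smooth_fun_differentiable[OF smooth_sep_test], of 1 "\<lambda>_. 0"]
  by (simp add: fun_eq_iff sep_test_def)

lemma dx_dx_sep_test:
  "dx i (dx j (sep_test \<theta> g x)) p = \<theta> (fst p) * kfun g (inc i (inc j (\<lambda>_. 0))) (x - snd p)"
  using dx_sep[OF smooth_fun_dx_differentiable[OF smooth_sep_test] dx_sep_test] by simp

lemma dt_sep_test: "dt (sep_test \<theta> g x) p = deriv \<theta> (fst p) * kfun g (\<lambda>_. 0) (x - snd p)"
  unfolding dt_def
proof (rule directional_derivative[OF smooth_fun_differentiable[OF smooth_sep_test]])
  have 1: "(\<theta> has_field_derivative deriv \<theta> (fst p + 0)) (at (fst p + 0))"
    by (rule smooth1_DERIV[OF \<theta>])
  have 2: "((\<lambda>s. fst p + s) has_field_derivative 1) (at (0::real))"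
    by (auto intro!: derivative_eq_intros)
  show "((\<lambda>s. sep_test \<theta> g x (p + s *\<^sub>R (1, 0))) has_field_derivative
      deriv \<theta> (fst p) * kfun g (\<lambda>_. 0) (x - snd p)) (at 0)"
    using DERIV_cmult_right[OF DERIV_chain2[OF 1 2], of "kfun g (\<lambda>_. 0) (x - snd p)"]
    by (simp add: sep_test_def)
qed

lemma test_fun_sep_test:
  assumes "\<And>t. t \<notin> {l..u} \<Longrightarrow> \<theta> t = 0" and "u < T" and gR: "\<And>s. \<bar>s\<bar> > R \<Longrightarrow> g s = 0"
  shows "test_fun_FP T (sep_test \<theta> g x)"
proof -
  let ?r = "vec_lambda (\<lambda>_. R) :: real ^ 'd"
  have "test_fun ({t. t < T} \<times> UNIV) (sep_test \<theta> g x)"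
    unfolding sep_test_tens
  proof (rule test_fun_tens[where l = "(l, x - ?r)" and u = "(u, x + ?r)"])
    fix e :: "real \<times> (real ^ 'd)"
    have "smooth1 (\<lambda>s. g ((-1) * s + x \<bullet> snd e))"
      by (rule smooth1_affine[OF g])
    then show "smooth1 (if e = (1, 0) then \<theta> else (\<lambda>s. g (x \<bullet> snd e - s)))"
      using \<theta> by (simp add: algebra_simps)
    fix t assume "e \<in> Basis" and t: "t \<notin> {(l, x - ?r) \<bullet> e..(u, x + ?r) \<bullet> e}"
    then consider "e = (1, 0)" | i where "e = (0, axis i 1)"
      by (auto simp: Basis_prod_def Basis_vec_def)
    then show "(if e = (1, 0) then \<theta> else (\<lambda>s. g (x \<bullet> snd e - s))) t = 0"
    proof cases
      case 1
      then show ?thesis using t assms(1) by simp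
    next
      case (2 i)
      then have "\<bar>x $ i - t\<bar> > R"
        using t by (auto simp: cart_eq_inner_axis[symmetric])
      then show ?thesis using 2 gR by (simp add: cart_eq_inner_axis[symmetric])
    qed
  next
    show "cbox (l, x - ?r) (u, x + ?r) \<subseteq> {t. t < T} \<times> UNIV"
      using \<open>u < T\<close> by (auto simp: cbox_Pair_eq)
  qed
  then show ?thesis by (simp add: test_fun_def test_fun_FP_def)
qed

end

section \<open>Functions of time and space\<close>

lemma lborel_pair_integral:
  fixes f :: "'a::euclidean_space \<times> 'b::euclidean_space \<Rightarrow> real"
  assumes "integrable lborel f"
  shows "(LBINT p. f p) = (LBINT t. (LBINT x. f (t, x)))"
    and "(LBINT p. f p) = (LBINT x. (LBINT t. f (t, x)))"
    and "integrable lborel (\<lambda>t. LBINT x. f (t, x))"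
    and "integrable lborel (\<lambda>x. LBINT t. f (t, x))"
    and "AE t in lborel. integrable lborel (\<lambda>x. f (t, x))"
    and "AE x in lborel. integrable lborel (\<lambda>t. f (t, x))"
proof -
  have f: "integrable (lborel \<Otimes>\<^sub>M lborel) (case_prod (\<lambda>t x. f (t, x)))"
    using assms by (simp add: lborel_prod)
  show "(LBINT p. f p) = (LBINT t. (LBINT x. f (t, x)))"
    using lborel_pair.integral_fst[OF f] by (simp add: lborel_prod)
  show "(LBINT p. f p) = (LBINT x. (LBINT t. f (t, x)))"
    using lborel_pair.integral_snd[OF f] by (simp add: lborel_prod)
  show "integrable lborel (\<lambda>t. LBINT x. f (t, x))" "integrable lborel (\<lambda>x. LBINT t. f (t, x))"
    "AE t in lborel. integrable lborel (\<lambda>x. f (t, x))" "AE x in lborel. integrable lborel (\<lambda>t. f (t, x))"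
    by (rule lborel_pair.integrable_fst[OF f] lborel_pair.integrable_snd[OF f]
        lborel_pair.AE_integrable_fst[OF f] lborel_pair.AE_integrable_snd[OF f])+
qed

lemma borel_slice [measurable (raw)]:
  fixes f :: "'a::euclidean_space \<times> 'b::euclidean_space \<Rightarrow> real"
  assumes "f \<in> borel_measurable borel" "g \<in> borel_measurable M" "h \<in> borel_measurable M"
  shows "(\<lambda>y. f (g y, h y)) \<in> borel_measurable M"
  using measurable_compose[OF borel_measurable_Pair[OF assms(2,3)] assms(1)] .

lemma borel_pair_integral:
  fixes f :: "'a::euclidean_space \<times> 'b::euclidean_space \<Rightarrow> 'c::euclidean_space \<Rightarrow> real"
  assumes "(\<lambda>q. f (fst q) (snd q)) \<in> borel_measurable (borel \<Otimes>\<^sub>M lborel)"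
  shows "(\<lambda>p. LBINT y. f p y) \<in> borel_measurable borel"
  using lborel.borel_measurable_lebesgue_integral[of f borel] assms by (simp add: case_prod_beta')

lemma AE_L2_slice:
  fixes u :: "real \<times> 'a::euclidean_space \<Rightarrow> real"
  assumes "L2 u" shows "AE t in lborel. L2 (\<lambda>x. u (t, x))"
proof -
  have [measurable]: "u \<in> borel_measurable borel" using assms by (rule L2_borel)
  have "AE t in lborel. integrable lborel (\<lambda>x. (u (t, x))\<^sup>2)"
    using assms lborel_pair_integral(5)[of "\<lambda>p. (u p)\<^sup>2"] by (simp add: L2_def)
  then show ?thesis
    by eventually_elim (simp add: L2_def)
qed

text \<open>Convolution acts on the space variable at each time separately. For square integrable
  \<open>u\<close>, the times whose slice is not square integrable form a null set, so the values
  there are irrelevant to integrals over space-time.\<close>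

definition cvx :: "('a::euclidean_space \<Rightarrow> real) \<Rightarrow> (real \<times> 'a \<Rightarrow> real) \<Rightarrow> real \<times> 'a \<Rightarrow> real" where
  "cvx k u p = conv k (\<lambda>y. u (fst p, y)) (snd p)"

lemma cvx_borel [measurable]:
  assumes [measurable]: "k \<in> borel_measurable borel" "u \<in> borel_measurable borel"
  shows "cvx k u \<in> borel_measurable borel"
  unfolding cvx_def[abs_def] conv_def
proof (rule borel_pair_integral)
  have [measurable]: "fst \<in> borel_measurable (borel :: (real \<times> 'a) measure)" "snd \<in> borel_measurable (borel :: (real \<times> 'a) measure)"
    unfolding borel_prod[symmetric] by measurable
  show "(\<lambda>q. k (snd (fst q) - snd q) * u (fst (fst q), snd q)) \<in> borel_measurable (borel \<Otimes>\<^sub>M lborel)"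
    by measurable
qed

lemma cvx_L2:
  assumes k: "kern k" and u: "L2 u"
  shows "L2 (cvx k u)"
proof -
  note [measurable] = kern_borel[OF k] L2_borel[OF u]
  define M where "M = (LBINT z. \<bar>k z\<bar>)\<^sup>2"
  have M: "M \<ge> 0" by (simp add: M_def)
  have u2: "integrable lborel (\<lambda>p. (u p)\<^sup>2)" using u by (simp add: L2_def)
  have "integrable (lborel \<Otimes>\<^sub>M lborel) (\<lambda>p. (cvx k u p)\<^sup>2)"
  proof (rule lborel_pair.Fubini_integrable)
    show "(\<lambda>p. (cvx k u p)\<^sup>2) \<in> borel_measurable (lborel \<Otimes>\<^sub>M lborel)"
      unfolding lborel_prod by measurable
    have s: "AE t in lborel. integrable lborel (\<lambda>x. (cvx k u (t, x))\<^sup>2) \<and>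
        (LBINT x. (cvx k u (t, x))\<^sup>2) \<le> M * (LBINT x. (u (t, x))\<^sup>2)"
      using AE_L2_slice[OF u]
    proof eventually_elim
      case (elim t)
      have "L2 (\<lambda>x. cvx k u (t, x))" using conv_L2[OF k elim] by (simp add: cvx_def)
      moreover have "(LBINT x. (cvx k u (t, x))\<^sup>2) \<le> M * (LBINT x. (u (t, x))\<^sup>2)"
        using conv_L2_le[OF k elim] by (simp add: cvx_def M_def)
      ultimately show ?case by (simp add: L2_def)
    qed
    then show "AE t in lborel. integrable lborel (\<lambda>x. (cvx k u (t, x))\<^sup>2)" by auto
    show "integrable lborel (\<lambda>t. LBINT x. norm ((cvx k u (t, x))\<^sup>2))"
    proof (rule Bochner_Integration.integrable_bound)
      show "integrable lborel (\<lambda>t. M * (LBINT x. (u (t, x))\<^sup>2))"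
        by (intro integrable_mult_right lborel_pair_integral(3)[OF u2])
      show "AE t in lborel. norm (LBINT x. norm ((cvx k u (t, x))\<^sup>2)) \<le> norm (M * (LBINT x. (u (t, x))\<^sup>2))"
        using s by eventually_elim (use M in \<open>auto simp: abs_mult\<close>)
    qed measurable
  qed
  then show ?thesis by (simp add: L2_def lborel_prod)
qed

section \<open>The weighted energy estimate\<close>

text \<open>Fubini's theorem on the half-plane \<open>s < \<tau>\<close>.\<close>

lemma integral_weight_primitive:
  fixes e H :: "real \<Rightarrow> real"
  assumes e: "integrable lborel e" and H: "integrable lborel H"
  shows "(LBINT \<tau>. e \<tau> * (LBINT s. indicator {..<\<tau>} s * H s))
    = (LBINT s. H s * (LBINT \<tau>. indicator {s<..} \<tau> * e \<tau>))"
proof -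
  have [measurable]: "e \<in> borel_measurable borel" "H \<in> borel_measurable borel" using e H by simp_all
  have pair: "integrable (lborel \<Otimes>\<^sub>M lborel) (case_prod (\<lambda>\<tau> s. e \<tau> * (indicator {..<\<tau>} s * H s)))"
  proof (rule Bochner_Integration.integrable_bound[OF integrable_tensor[OF e H]])
    have "(\<lambda>p. e (fst p) * ((if snd p < fst p then 1 else 0) * H (snd p))) \<in> borel_measurable (lborel \<Otimes>\<^sub>M lborel)"
      by measurable
    then show "case_prod (\<lambda>\<tau> s. e \<tau> * (indicator {..<\<tau>} s * H s)) \<in> borel_measurable (lborel \<Otimes>\<^sub>M lborel)"
      by (rule measurable_cong[THEN iffD1, rotated]) (auto simp: indicator_def)
  qed (auto intro!: AE_I2 simp: abs_mult indicator_def)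
  have "(LBINT \<tau>. e \<tau> * (LBINT s. indicator {..<\<tau>} s * H s))
      = (LBINT \<tau>. (LBINT s. e \<tau> * (indicator {..<\<tau>} s * H s)))" by simp
  also have "\<dots> = (LBINT s. (LBINT \<tau>. e \<tau> * (indicator {..<\<tau>} s * H s)))"
    by (rule lborel_pair.Fubini_integral[OF pair, symmetric])
  also have "\<dots> = (LBINT s. (LBINT \<tau>. H s * (indicator {s<..} \<tau> * e \<tau>)))"
    by (intro Bochner_Integration.integral_cong refl) (auto simp: indicator_def)
  finally show ?thesis by simp
qed

lemma integrable_mult_primitive:
  fixes F G :: "real \<Rightarrow> real"
  assumes F: "integrable lborel F" and G: "integrable lborel G"
  shows "integrable lborel (\<lambda>s. G s * (LBINT r. indicator {..<s} r * F r))"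
proof (rule Bochner_Integration.integrable_bound)
  have [measurable]: "F \<in> borel_measurable borel" "G \<in> borel_measurable borel" using F G by simp_all
  show "integrable lborel (\<lambda>s. G s * (LBINT s. \<bar>F s\<bar>))" using G by simp
  show "AE s in lborel. norm (G s * (LBINT r. indicator {..<s} r * F r)) \<le> norm (G s * (LBINT s. \<bar>F s\<bar>))"
    using primitive_bound[OF F] by (intro AE_I2) (auto simp: abs_mult intro!: mult_left_mono)
  show "(\<lambda>s. G s * (LBINT r. indicator {..<s} r * F r)) \<in> borel_measurable lborel" by measurable
qed

text \<open>\<open>(W \<tau>)^2\<close> is the integral of \<open>F r * F s\<close> over the square
  \<open>r, s < \<tau>\<close>. The two triangles on either side of the diagonal contribute equally
  and the diagonal is a null set. This replaces differentiating \<open>W^2\<close>.\<close>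

lemma primitive_square:
  fixes F :: "real \<Rightarrow> real"
  assumes F: "integrable lborel F"
  defines "W \<equiv> \<lambda>t. LBINT s. indicator {..<t} s * F s"
  shows "(W \<tau>)\<^sup>2 = 2 * (LBINT s. indicator {..<\<tau>} s * (F s * W s))"
proof -
  define G where "G s = indicator {..<\<tau>} s * F s" for s
  have G: "integrable lborel G"
    using integrable_mult_indicator[OF _ F, of "{..<\<tau>}"] by (simp add: G_def[abs_def])
  have W_G: "G s * W s = G s * (LBINT r. indicator {..<s} r * G r)" for s
  proof (cases "s < \<tau>")
    case True
    have "W s = (LBINT r. indicator {..<s} r * G r)"
      unfolding W_def G_def using True by (intro Bochner_Integration.integral_cong) (auto simp: indicator_def)
    then show ?thesis by simp
  qed (simp add: G_def)
  have sp: "(LBINT r. G r) = (LBINT r. indicator {..<s} r * G r) + (LBINT r. indicator {s<..} r * G r)" for s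
  proof -
    have i: "integrable lborel (\<lambda>r. indicator {..<s} r * G r)" "integrable lborel (\<lambda>r. indicator {s<..} r * G r)"
      using integrable_mult_indicator[OF _ G, of "{..<s}"] integrable_mult_indicator[OF _ G, of "{s<..}"] by simp_all
    have "(LBINT r. G r) = (LBINT r. indicator {..<s} r * G r + indicator {s<..} r * G r)"
    proof (rule integral_cong_AE)
      show "AE r in lborel. G r = indicator {..<s} r * G r + indicator {s<..} r * G r"
        using AE_lborel_singleton[of s] by eventually_elim (auto simp: indicator_def)
    qed (use G i in auto)
    then show ?thesis using i by simp
  qed
  have iW: "integrable lborel (\<lambda>s. G s * (LBINT r. indicator {..<s} r * G r))"
    by (rule integrable_mult_primitive[OF G G])
  have swap: "(LBINT s. G s * (LBINT r. indicator {s<..} r * G r))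
      = (LBINT s. G s * (LBINT r. indicator {..<s} r * G r))"
    by (rule integral_weight_primitive[OF G G, symmetric])
  have iW': "integrable lborel (\<lambda>s. G s * (LBINT r. indicator {s<..} r * G r))"
  proof -
    have "integrable lborel (\<lambda>s. G s * (LBINT r. G r) - G s * (LBINT r. indicator {..<s} r * G r))"
      using G iW by simp
    moreover have "G s * (LBINT r. indicator {s<..} r * G r)
        = G s * (LBINT r. G r) - G s * (LBINT r. indicator {..<s} r * G r)" for s
      using sp[of s] by (simp add: algebra_simps)
    ultimately show ?thesis by simp
  qed
  have "(W \<tau>)\<^sup>2 = (LBINT s. G s * (LBINT r. G r))"
    by (simp add: W_def G_def power2_eq_square)
  also have "\<dots> = (LBINT s. G s * (LBINT r. indicator {..<s} r * G r) + G s * (LBINT r. indicator {s<..} r * G r))"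
    by (intro Bochner_Integration.integral_cong refl) (subst sp, rule distrib_left)
  also have "\<dots> = 2 * (LBINT s. G s * W s)"
    using iW iW' by (simp add: swap W_G)
  finally show ?thesis by (simp add: G_def mult.assoc)
qed

text \<open>The source of the small factor in the energy estimate: the tail of the weight is
  dominated by the weight itself divided by \<mu>.\<close>

lemma exp_weight_tail:
  fixes \<mu> s T :: real
  assumes "\<mu> > 0" "s < T" "0 < s"
  shows "(LBINT \<tau>. indicator {s<..} \<tau> * (indicator {0<..<T} \<tau> * exp (- \<mu> * \<tau>))) \<le> exp (- \<mu> * s) / \<mu>"
proof -
  have "(LBINT \<tau>. indicator {s<..} \<tau> * (indicator {0<..<T} \<tau> * exp (- \<mu> * \<tau>)))
      = (LBINT \<tau>. exp (- \<mu> * \<tau>) * indicator {s..T} \<tau>)"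
  proof (rule integral_cong_AE)
    show "AE \<tau> in lborel. indicator {s<..} \<tau> * (indicator {0<..<T} \<tau> * exp (- \<mu> * \<tau>)) = exp (- \<mu> * \<tau>) * indicator {s..T} \<tau>"
      using AE_lborel_singleton[of s] AE_lborel_singleton[of T]
      by eventually_elim (use assms in \<open>auto simp: indicator_def\<close>)
  qed auto
  also have "\<dots> = - exp (- \<mu> * T) / \<mu> - (- exp (- \<mu> * s) / \<mu>)"
    by (rule integral_FTC_Icc_real)
       (use assms in \<open>auto intro!: derivative_eq_intros continuous_intros simp: field_simps\<close>)
  also have "\<dots> \<le> exp (- \<mu> * s) / \<mu>" using assms by simp
  finally show ?thesis .
qed

text \<open>The situation after the data have been replaced by Borel functions on all of space-time
  that vanish outside the time interval. Ellipticity can then only be asked for times in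
  \<open>(0, T)\<close>, while bounds and the Lipschitz estimate survive the extension by zero. As
  \<open>w\<close> stands for the difference of two solutions, \<open>weak\<close> has no initial
  term.\<close>

locale FP_homogeneous =
  fixes T B A L \<alpha> :: real
    and b :: "'d::finite \<Rightarrow> real \<times> (real ^ 'd) \<Rightarrow> real"
    and a :: "'d \<Rightarrow> 'd \<Rightarrow> real \<times> (real ^ 'd) \<Rightarrow> real"
    and w :: "real \<times> (real ^ 'd) \<Rightarrow> real"
  assumes w: "L2 w" and w0: "\<And>t x. t \<notin> {0<..<T} \<Longrightarrow> w (t, x) = 0"
    and b: "\<And>i. b i \<in> borel_measurable borel" "\<And>i p. \<bar>b i p\<bar> \<le> B"
    and a: "\<And>i j. a i j \<in> borel_measurable borel" "\<And>i j p. \<bar>a i j p\<bar> \<le> A"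
    and lip: "AE t in lborel. AE x in lborel. AE y in lborel. \<forall>i j. \<bar>a i j (t, y) - a i j (t, x)\<bar> \<le> L * norm (x - y)"
    and ell: "AE t in lborel. t \<in> {0<..<T} \<longrightarrow> (AE x in lborel. \<forall>\<xi>::real ^ 'd.
        (\<Sum>i\<in>UNIV. \<Sum>j\<in>UNIV. \<xi> $ i * a i j (t, x) * \<xi> $ j) \<ge> \<alpha> * (norm \<xi>)\<^sup>2)"
    and \<alpha>: "\<alpha> > 0"
    and weak: "\<And>\<phi>. test_fun_FP T \<phi> \<Longrightarrow>
        (LBINT p. w p * (dt \<phi> p + (\<Sum>i\<in>UNIV. b i p * dx i \<phi> p)
          + (1/2) * (\<Sum>i\<in>UNIV. \<Sum>j\<in>UNIV. a i j p * dx i (dx j \<phi>) p))) = 0"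
begin

text \<open>Since \<open>u\<close> vanishes outside the time interval, the indicator of
  \<open>(0, T)\<close> can be inserted for free. It makes the kernel, constant in time, square
  integrable on space-time, so Cauchy-Schwarz and Fubini's theorem apply at every
  \<open>x\<close>.\<close>

lemma slab_kernel:
  fixes x :: "real ^ 'd"
  assumes k: "kern k" and u: "L2 u" and u0: "\<And>t x. t \<notin> {0<..<T} \<Longrightarrow> u (t, x) = 0"
    and \<theta>: "\<theta> \<in> borel_measurable borel" "\<And>t. \<bar>\<theta> t\<bar> \<le> C"
  shows "integrable lborel (\<lambda>p. \<theta> (fst p) * (k (x - snd p) * u p))"
    and "(LBINT p. \<theta> (fst p) * (k (x - snd p) * u p)) = (LBINT t. \<theta> t * cvx k u (t, x))"
    and "integrable lborel (\<lambda>t. \<theta> t * cvx k u (t, x))"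
proof -
  note [measurable] = kern_borel[OF k] L2_borel[OF u] \<theta>(1)
  have [measurable]: "fst \<in> borel_measurable (borel :: (real \<times> (real ^ 'd)) measure)"
    "snd \<in> borel_measurable (borel :: (real \<times> (real ^ 'd)) measure)"
    unfolding borel_prod[symmetric] by measurable
  have "integrable lborel (indicator {0<..<T} :: real \<Rightarrow> real)"
    by (intro integrable_real_indicator emeasure_bounded_finite) auto
  moreover have "integrable lborel (\<lambda>y. (k (x - y))\<^sup>2)"
    using L2_reflect[OF kern_L2[OF k]] by (simp add: L2_def)
  ultimately have "integrable lborel (\<lambda>p. indicator {0<..<T} (fst p) * (k (x - snd p))\<^sup>2)"
    using integrable_tensor by (auto simp: lborel_prod)
  then have "L2 (\<lambda>p. indicator {0<..<T} (fst p) * k (x - snd p))"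
    by (auto simp: L2_def power_mult_distrib power2_eq_square[of "indicator _ _"] indicator_inter_arith[symmetric])
  then have "L2 (\<lambda>p. \<theta> (fst p) * (indicator {0<..<T} (fst p) * k (x - snd p)))"
    by (rule L2_bounded_mult) (use \<theta>(2) in auto)
  from L2_mult_integrable[OF this u]
  have "integrable lborel (\<lambda>p. \<theta> (fst p) * (indicator {0<..<T} (fst p) * k (x - snd p)) * u p)" .
  moreover have "\<theta> (fst p) * (indicator {0<..<T} (fst p) * k (x - snd p)) * u p = \<theta> (fst p) * (k (x - snd p) * u p)" for p
    using u0[of "fst p" "snd p"] by (cases "fst p \<in> {0<..<T}") auto
  ultimately show int: "integrable lborel (\<lambda>p. \<theta> (fst p) * (k (x - snd p) * u p))" by simp
  show "(LBINT p. \<theta> (fst p) * (k (x - snd p) * u p)) = (LBINT t. \<theta> t * cvx k u (t, x))"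
    unfolding lborel_pair_integral(1)[OF int] by (simp add: cvx_def conv_def)
  show "integrable lborel (\<lambda>t. \<theta> t * cvx k u (t, x))"
    using lborel_pair_integral(3)[OF int] by (simp add: cvx_def conv_def)
qed

lemma cvx_outside: "(\<And>t x. t \<notin> {0<..<T} \<Longrightarrow> u (t, x) = 0) \<Longrightarrow> t \<notin> {0<..<T} \<Longrightarrow> cvx k u (t, x :: real ^ 'd) = 0"
  by (simp add: cvx_def conv_def)

definition bw :: "'d \<Rightarrow> real \<times> (real ^ 'd) \<Rightarrow> real" where "bw i p = b i p * w p"
definition aw :: "'d \<Rightarrow> 'd \<Rightarrow> real \<times> (real ^ 'd) \<Rightarrow> real" where "aw i j p = a i j p * w p"

lemma bw: "L2 (bw i)" "t \<notin> {0<..<T} \<Longrightarrow> bw i (t, x) = 0"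
  unfolding bw_def[abs_def] using L2_bounded_mult[OF w b] w0 by auto

lemma aw: "L2 (aw i j)" "t \<notin> {0<..<T} \<Longrightarrow> aw i j (t, x) = 0"
  unfolding aw_def[abs_def] using L2_bounded_mult[OF w a] w0 by auto

context
  fixes g :: "real \<Rightarrow> real" and R \<kappa> :: real
  assumes g: "smooth1 g" and gR: "\<And>s. \<bar>s\<bar> > R \<Longrightarrow> g s = 0" and g0: "\<And>s. g s \<ge> 0"
    and g1: "(LBINT z. kfun g (\<lambda>_. 0) (z :: real ^ 'd)) = 1"
    and \<kappa>: "\<And>j. (LBINT z. \<bar>kfun g (inc j (\<lambda>_. 0)) (z :: real ^ 'd)\<bar> * norm z) \<le> \<kappa>"
begin

abbreviation K0 :: "real ^ 'd \<Rightarrow> real" where "K0 \<equiv> kfun g (\<lambda>_. 0)"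
abbreviation K1 :: "'d \<Rightarrow> real ^ 'd \<Rightarrow> real" where "K1 i \<equiv> kfun g (inc i (\<lambda>_. 0))"
abbreviation K2 :: "'d \<Rightarrow> 'd \<Rightarrow> real ^ 'd \<Rightarrow> real" where "K2 i j \<equiv> kfun g (inc i (inc j (\<lambda>_. 0)))"

lemma kernK: "kern (kfun g m :: real ^ 'd \<Rightarrow> real)"
  by (rule kfun_kern[OF g gR])

text \<open>The right-hand side of the mollified equation, that is, the time derivative of
  \<open>cvx K0 w\<close> in the weak sense, with all space derivatives placed on the
  kernel.\<close>

definition Fx :: "real \<times> (real ^ 'd) \<Rightarrow> real" where
  "Fx p = (1/2) * (\<Sum>i\<in>UNIV. \<Sum>j\<in>UNIV. cvx (K2 i j) (aw i j) p) - (\<Sum>i\<in>UNIV. cvx (K1 i) (bw i) p)"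

lemma Fx_outside: "t \<notin> {0<..<T} \<Longrightarrow> Fx (t, x) = 0"
  using cvx_outside[of "aw _ _", OF aw(2)] cvx_outside[of "bw _", OF bw(2)] by (simp add: Fx_def)

lemma wn_outside: "t \<notin> {0<..<T} \<Longrightarrow> cvx K0 w (t, x) = 0"
  using cvx_outside[of w, OF w0] by simp

lemma Fx_L2: "L2 Fx"
  unfolding Fx_def[abs_def]
  by (intro L2_diff L2_scale L2_sum cvx_L2 kernK aw(1) bw(1))

lemma Fx_integrable_t:
  assumes \<theta>: "\<theta> \<in> borel_measurable borel" "\<And>t. \<bar>\<theta> t\<bar> \<le> C"
  shows "integrable lborel (\<lambda>t. \<theta> t * Fx (t, x))"
proof -
  have "integrable lborel (\<lambda>t. (1/2) * (\<Sum>i\<in>UNIV. \<Sum>j\<in>UNIV. \<theta> t * cvx (K2 i j) (aw i j) (t, x))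
      - (\<Sum>i\<in>UNIV. \<theta> t * cvx (K1 i) (bw i) (t, x)))"
    by (intro Bochner_Integration.integrable_diff integrable_mult_right Bochner_Integration.integrable_sum
        slab_kernel(3)[OF kernK aw \<theta>] slab_kernel(3)[OF kernK bw \<theta>])
  then show ?thesis
    by (simp add: Fx_def algebra_simps sum_distrib_left)
qed

text \<open>The weak equation tested with \<open>sep_test \<theta> g x\<close>. Derivatives in the
  integration variable fall on the kernel at \<open>x - y\<close>, so the drift term changes sign
  and the second-order term does not.\<close>

lemma mollified_weak_equation:
  assumes \<theta>: "smooth1 \<theta>" and supp: "\<And>t. t \<notin> {l..u} \<Longrightarrow> \<theta> t = 0" and "u < T"
  shows "(LBINT t. deriv \<theta> t * cvx K0 w (t, x) + \<theta> t * Fx (t, x)) = 0"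
proof -
  \<comment> \<open>A symmetric interval containing the support, so that \<theta> and its derivative
    are kernels and hence bounded, as \<open>slab_kernel\<close> requires.\<close>
  define S where "S = max \<bar>l\<bar> \<bar>u\<bar>"
  have S: "\<theta> s = 0" if "\<bar>s\<bar> > S" for s
    using that by (intro supp) (auto simp: S_def)
  have S': "deriv \<theta> s = 0" if "\<bar>s\<bar> > S" for s
    using deriv_eq_0_outside[OF \<theta> S that, of 1] by simp
  have bdd: "\<exists>C. \<forall>t. \<bar>h t\<bar> \<le> C" if h: "kern h" for h :: "real \<Rightarrow> real"
  proof -
    obtain C D where CD: "C \<ge> 0" "\<And>t. \<bar>h t\<bar> \<le> C * indicator (cball 0 D) t"
      using kern_bound[OF h] by metis
    have "\<bar>h t\<bar> \<le> C" for t
      using CD(2)[of t] CD(1) by (cases "t \<in> cball 0 D") auto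
    then show ?thesis by blast
  qed
  have "kern \<theta>" "kern (deriv \<theta>)"
    unfolding kern_def using S S' smooth1_continuous[OF \<theta>] smooth1_continuous[OF smooth1_deriv[OF \<theta>]]
    by auto
  then obtain C C' where \<theta>b: "\<And>t. \<bar>\<theta> t\<bar> \<le> C" "\<And>t. \<bar>deriv \<theta> t\<bar> \<le> C'"
    using bdd by metis
  note m = smooth1_borel[OF \<theta>] smooth1_borel[OF smooth1_deriv[OF \<theta>]]
  let ?\<phi> = "sep_test \<theta> g x"
  have e: "(LBINT p. deriv \<theta> (fst p) * (K0 (x - snd p) * w p)) = (LBINT t. deriv \<theta> t * cvx K0 w (t, x))"
    "(LBINT p. \<theta> (fst p) * (K2 i j (x - snd p) * aw i j p)) = (LBINT t. \<theta> t * cvx (K2 i j) (aw i j) (t, x))"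
    "(LBINT p. \<theta> (fst p) * (K1 i (x - snd p) * bw i p)) = (LBINT t. \<theta> t * cvx (K1 i) (bw i) (t, x))" for i j
    by (rule slab_kernel(2)[OF kernK w w0 m(2) \<theta>b(2)] slab_kernel(2)[OF kernK aw m(1) \<theta>b(1)]
        slab_kernel(2)[OF kernK bw m(1) \<theta>b(1)]; assumption)+
  have d1: "dx i ?\<phi> p = (-1) * \<theta> (fst p) * K1 i (x - snd p)" for i p
    by (simp add: dx_sep_test[OF \<theta> g])
  have "0 = (LBINT p. w p * (dt ?\<phi> p + (\<Sum>i\<in>UNIV. b i p * dx i ?\<phi> p)
          + (1/2) * (\<Sum>i\<in>UNIV. \<Sum>j\<in>UNIV. a i j p * dx i (dx j ?\<phi>) p)))"
    by (rule weak[symmetric]) (rule test_fun_sep_test[OF \<theta> g supp \<open>u < T\<close> gR])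
  also have "\<dots> = (LBINT p. deriv \<theta> (fst p) * (K0 (x - snd p) * w p)
      + ((1/2) * (\<Sum>i\<in>UNIV. \<Sum>j\<in>UNIV. \<theta> (fst p) * (K2 i j (x - snd p) * aw i j p))
         - (\<Sum>i\<in>UNIV. \<theta> (fst p) * (K1 i (x - snd p) * bw i p))))"
    unfolding dt_sep_test[OF \<theta> g] dx_dx_sep_test[OF \<theta> g] d1
    by (intro Bochner_Integration.integral_cong refl)
       (simp add: aw_def bw_def algebra_simps sum_distrib_left sum_negf)
  also have "\<dots> = (LBINT t. deriv \<theta> t * cvx K0 w (t, x))
      + ((1/2) * (\<Sum>i\<in>UNIV. \<Sum>j\<in>UNIV. (LBINT t. \<theta> t * cvx (K2 i j) (aw i j) (t, x)))
         - (\<Sum>i\<in>UNIV. (LBINT t. \<theta> t * cvx (K1 i) (bw i) (t, x))))"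
    using slab_kernel(1)[OF kernK w w0 m(2) \<theta>b(2), of "\<lambda>_. 0" x] slab_kernel(1)[OF kernK aw m(1) \<theta>b(1)]
      slab_kernel(1)[OF kernK bw m(1) \<theta>b(1)]
    by (simp only: e[symmetric]) simp
  also have "\<dots> = (LBINT t. deriv \<theta> t * cvx K0 w (t, x)
      + ((1/2) * (\<Sum>i\<in>UNIV. \<Sum>j\<in>UNIV. \<theta> t * cvx (K2 i j) (aw i j) (t, x))
         - (\<Sum>i\<in>UNIV. \<theta> t * cvx (K1 i) (bw i) (t, x))))"
    using slab_kernel(3)[OF kernK w w0 m(2) \<theta>b(2), of "\<lambda>_. 0" x] slab_kernel(3)[OF kernK aw m(1) \<theta>b(1)]
      slab_kernel(3)[OF kernK bw m(1) \<theta>b(1)]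
    by simp
  also have "\<dots> = (LBINT t. deriv \<theta> t * cvx K0 w (t, x) + \<theta> t * Fx (t, x))"
    by (intro Bochner_Integration.integral_cong refl) (simp add: Fx_def algebra_simps sum_distrib_left)
  finally show ?thesis by simp
qed

definition energy_const :: real where
  "energy_const = 1 / (2 * \<alpha>) * real CARD('d) * (2 * B\<^sup>2 + (1/2) * (real CARD('d))\<^sup>2 * (L * \<kappa>)\<^sup>2)"

lemma energy_const_nonneg: "energy_const \<ge> 0"
  using \<alpha> by (simp add: energy_const_def)

lemma slice_energy_bound:
  "AE t in lborel. (LBINT x. cvx K0 w (t, x) * Fx (t, x)) \<le> energy_const * (LBINT x. (w (t, x))\<^sup>2)"
  using lip ell AE_L2_slice[OF w]
proof eventually_elim
  case (elim t)
  show ?case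
  proof (cases "t \<in> {0<..<T}")
    case False
    then show ?thesis using w0 by (simp add: wn_outside)
  next
    case True
    have [measurable]: "\<And>i. b i \<in> borel_measurable borel" "\<And>i j. a i j \<in> borel_measurable borel"
      using a b by auto
    have K0abs: "(LBINT z. \<bar>K0 z\<bar>) \<le> 1"
    proof -
      have "K0 z \<ge> 0" for z by (auto simp: kfun_def intro!: prod_nonneg g0)
      then show ?thesis using g1 by simp
    qed
    have "(LBINT x. conv K0 (\<lambda>y. w (t, y)) x * ((1/2) * (\<Sum>i\<in>UNIV. \<Sum>j\<in>UNIV. conv (K2 i j) (\<lambda>y. a i j (t, y) * w (t, y)) x)
        - (\<Sum>i\<in>UNIV. conv (K1 i) (\<lambda>y. b i (t, y) * w (t, y)) x)))
      \<le> 1 / (2 * \<alpha>) * real CARD('d) * (2 * B\<^sup>2 + (1/2) * (real CARD('d))\<^sup>2 * (L * \<kappa>)\<^sup>2) * (LBINT x. (w (t, x))\<^sup>2)"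
    proof (rule slice_energy[OF elim(3) kernK kernK kernK kfun_DERIV[OF g] kfun_DERIV[OF g] _ _ _ _ elim(1) _ \<alpha> K0abs \<kappa>])
      show "AE x in lborel. \<forall>\<xi>::real ^ 'd. \<alpha> * (norm \<xi>)\<^sup>2 \<le> (\<Sum>i\<in>UNIV. \<Sum>j\<in>UNIV. \<xi> $ i * a i j (t, x) * \<xi> $ j)"
        using elim(2) True by blast
    qed (use a(2) b(2) in auto)
    then show ?thesis
      by (simp add: energy_const_def cvx_def Fx_def aw_def bw_def)
  qed
qed

text \<open>For fixed \<open>x\<close> the square of the mollified solution is twice the primitive
  of itself times \<open>Fx\<close>; integrating against \<omega> replaces this by the tail weight
  \<open>c\<close>. For fixed time the energy bound applies, and
  \<open>c \<le> \<omega> / \<mu>\<close> gains the factor \<open>1/\<mu>\<close>. The right-hand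
  side involves \<open>w\<close> itself, not its mollification.\<close>

theorem weighted_energy:
  fixes \<mu> :: real
  assumes \<mu>: "\<mu> > 0"
  defines "\<omega> \<equiv> \<lambda>t. indicator {0<..<T} t * exp (- \<mu> * t)"
  shows "(LBINT p. \<omega> (fst p) * (cvx K0 w p)\<^sup>2) \<le> 2 * energy_const / \<mu> * (LBINT p. \<omega> (fst p) * (w p)\<^sup>2)"
proof -
  have [measurable]: "\<omega> \<in> borel_measurable borel" unfolding \<omega>_def by measurable
  have \<omega>: "0 \<le> \<omega> t" "\<omega> t \<le> 1" for t
    using \<mu> by (auto simp: \<omega>_def indicator_def)
  have [measurable]: "fst \<in> borel_measurable (borel :: (real \<times> (real ^ 'd)) measure)"
    unfolding borel_prod[symmetric] by measurable
  have \<omega>_int: "integrable lborel \<omega>"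
  proof (rule Bochner_Integration.integrable_bound)
    show "integrable lborel (indicator {0<..<T} :: real \<Rightarrow> real)"
      by (intro integrable_real_indicator emeasure_bounded_finite) auto
    show "AE t in lborel. norm (\<omega> t) \<le> norm (indicator {0<..<T} t :: real)"
      using \<mu> by (intro AE_I2) (auto simp: \<omega>_def indicator_def)
  qed simp
  \<comment> \<open>The tail of the weight; it appears when the weight and the primitive exchange
    their roles.\<close>
  define c where "c s = (LBINT \<tau>. indicator {s<..} \<tau> * \<omega> \<tau>)" for s
  have c0: "c s \<ge> 0" for s unfolding c_def by (rule integral_nonneg_AE) (simp add: \<omega>)
  have c_le: "c s \<le> (LBINT \<tau>. \<omega> \<tau>)" for s
    unfolding c_def
  proof (rule integral_mono)
    show "integrable lborel (\<lambda>\<tau>. indicator {s<..} \<tau> * \<omega> \<tau>)"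
      using integrable_mult_indicator[OF _ \<omega>_int, of "{s<..}"] by simp
  qed (use \<omega>_int \<omega> in \<open>auto simp: indicator_def\<close>)
  have [measurable]: "c \<in> borel_measurable borel"
  proof -
    have "(\<lambda>s. LBINT \<tau>. (if s < \<tau> then \<omega> \<tau> else 0)) \<in> borel_measurable borel"
      by measurable
    also have "(\<lambda>s. LBINT \<tau>. (if s < \<tau> then \<omega> \<tau> else 0)) = c"
      by (auto simp: c_def fun_eq_iff indicator_def intro!: Bochner_Integration.integral_cong)
    finally show ?thesis .
  qed
  define wn where "wn = cvx K0 w"
  have wnL: "L2 wn" unfolding wn_def by (rule cvx_L2[OF kernK w])
  note [measurable] = L2_borel[OF w] L2_borel[OF wnL] L2_borel[OF Fx_L2]
  have per_x: "(LBINT t. \<omega> t * (wn (t, x))\<^sup>2) = 2 * (LBINT s. c s * (wn (s, x) * Fx (s, x)))" for x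
  proof -
    define F where "F t = Fx (t, x)" for t
    define W where "W t = (LBINT s. indicator {..<t} s * F s)" for t
    have F: "integrable lborel F"
      using Fx_integrable_t[of "\<lambda>_. 1" 1 x] by (simp add: F_def[abs_def])
    have wn_int: "integrable lborel (\<lambda>t. wn (t, x))"
      using slab_kernel(3)[OF kernK w w0, of "\<lambda>_. 1" 1 "\<lambda>_. 0" x] by (simp add: wn_def)
    have eq: "AE t in lborel. t < T \<longrightarrow> wn (t, x) = W t"
      unfolding W_def
    proof (rule weak_ode_integral[OF wn_int F])
      show "wn (t, x) = 0" "F t = 0" if "t \<le> 0" for t
        using that wn_outside[of t x] Fx_outside[of t x] by (auto simp: wn_def F_def)
      show "(LBINT t. deriv \<theta> t * wn (t, x) + \<theta> t * F t) = 0"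
        if "smooth1 \<theta>" "\<And>t. t \<notin> {l..u} \<Longrightarrow> \<theta> t = 0" "u < T" for \<theta> l u
        unfolding wn_def F_def by (rule mollified_weak_equation[OF that])
    qed
    have [measurable]: "F \<in> borel_measurable borel" using F by simp
    have [measurable]: "W \<in> borel_measurable borel"
      unfolding W_def by measurable
    have FW: "integrable lborel (\<lambda>s. F s * W s)"
      unfolding W_def by (rule integrable_mult_primitive[OF F F])
    have "(LBINT t. \<omega> t * (wn (t, x))\<^sup>2) = (LBINT t. \<omega> t * (W t)\<^sup>2)"
    proof (rule integral_cong_AE)
      show "AE t in lborel. \<omega> t * (wn (t, x))\<^sup>2 = \<omega> t * (W t)\<^sup>2"
        using eq by eventually_elim (auto simp: \<omega>_def indicator_def)
    qed measurable
    also have "\<dots> = (LBINT t. 2 * (\<omega> t * (LBINT s. indicator {..<t} s * (F s * W s))))"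
      using primitive_square[OF F] unfolding W_def[symmetric] by (simp add: mult_ac)
    also have "\<dots> = 2 * (LBINT s. (F s * W s) * c s)"
      unfolding c_def using integral_weight_primitive[OF \<omega>_int FW] by simp
    also have "(LBINT s. (F s * W s) * c s) = (LBINT s. c s * (wn (s, x) * Fx (s, x)))"
    proof (rule integral_cong_AE)
      show "AE s in lborel. F s * W s * c s = c s * (wn (s, x) * Fx (s, x))"
        using eq
      proof eventually_elim
        case (elim s)
        then show ?case using Fx_outside[of s x] by (cases "s < T") (auto simp: F_def)
      qed
    qed measurable
    finally show ?thesis .
  qed
  have i1: "integrable lborel (\<lambda>p. \<omega> (fst p) * (wn p)\<^sup>2)"
  proof (rule Bochner_Integration.integrable_bound)
    show "integrable lborel (\<lambda>p. (wn p)\<^sup>2)" using wnL by (simp add: L2_def)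
    show "AE p in lborel. norm (\<omega> (fst p) * (wn p)\<^sup>2) \<le> norm ((wn p)\<^sup>2)"
      using \<omega> by (intro AE_I2) (auto simp: abs_mult intro!: mult_left_le_one_le)
  qed measurable
  have i2: "integrable lborel (\<lambda>p. \<omega> (fst p) * (w p)\<^sup>2)"
  proof (rule Bochner_Integration.integrable_bound)
    show "integrable lborel (\<lambda>p. (w p)\<^sup>2)" using w by (simp add: L2_def)
    show "AE p in lborel. norm (\<omega> (fst p) * (w p)\<^sup>2) \<le> norm ((w p)\<^sup>2)"
      using \<omega> by (intro AE_I2) (auto simp: abs_mult intro!: mult_left_le_one_le)
  qed measurable
  have i3: "integrable lborel (\<lambda>p. c (fst p) * (wn p * Fx p))"
  proof (rule Bochner_Integration.integrable_bound)
    show "integrable lborel (\<lambda>p. (LBINT \<tau>. \<omega> \<tau>) * (wn p * Fx p))"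
      by (intro integrable_mult_right L2_mult_integrable wnL Fx_L2)
    show "AE p in lborel. norm (c (fst p) * (wn p * Fx p)) \<le> norm ((LBINT \<tau>. \<omega> \<tau>) * (wn p * Fx p))"
      using c0 c_le by (intro AE_I2) (auto simp: abs_mult intro!: mult_right_mono order_trans[OF c_le])
  qed measurable
  have "(LBINT p. \<omega> (fst p) * (wn p)\<^sup>2) = (LBINT x. (LBINT t. \<omega> t * (wn (t, x))\<^sup>2))"
    using lborel_pair_integral(2)[OF i1] by simp
  also have "\<dots> = 2 * (LBINT x. (LBINT s. c s * (wn (s, x) * Fx (s, x))))"
    by (simp add: per_x)
  \<comment> \<open>The change of order is the turning point: \<open>per_x\<close> is an identity in
    time at fixed \<open>x\<close>, whereas the energy bound integrates over \<open>x\<close> at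
    fixed time.\<close>
  also have "\<dots> = 2 * (LBINT s. c s * (LBINT x. wn (s, x) * Fx (s, x)))"
    using lborel_pair_integral(1)[OF i3] lborel_pair_integral(2)[OF i3] by simp
  also have "\<dots> \<le> 2 * (LBINT s. energy_const / \<mu> * (LBINT x. \<omega> s * (w (s, x))\<^sup>2))"
  proof (intro mult_left_mono integral_mono_AE)
    show "integrable lborel (\<lambda>s. c s * (LBINT x. wn (s, x) * Fx (s, x)))"
      using lborel_pair_integral(3)[OF i3] by simp
    show "integrable lborel (\<lambda>s. energy_const / \<mu> * (LBINT x. \<omega> s * (w (s, x))\<^sup>2))"
      using lborel_pair_integral(3)[OF i2] by (intro integrable_mult_right) simp
    show "AE s in lborel. c s * (LBINT x. wn (s, x) * Fx (s, x)) \<le> energy_const / \<mu> * (LBINT x. \<omega> s * (w (s, x))\<^sup>2)"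
      using slice_energy_bound
    proof eventually_elim
      case (elim s)
      show ?case
      proof (cases "s \<in> {0<..<T}")
        case False
        then show ?thesis using wn_outside[of s] w0[of s] by (simp add: wn_def)
      next
        case True
        have "c s * (LBINT x. wn (s, x) * Fx (s, x)) \<le> c s * (energy_const * (LBINT x. (w (s, x))\<^sup>2))"
          using elim c0 by (intro mult_left_mono) (auto simp: wn_def)
        also have "\<dots> \<le> (\<omega> s / \<mu>) * (energy_const * (LBINT x. (w (s, x))\<^sup>2))"
        proof (intro mult_right_mono)
          show "c s \<le> \<omega> s / \<mu>"
            using exp_weight_tail[OF \<mu>, of s T] True by (simp add: c_def \<omega>_def)
        qed (use energy_const_nonneg in simp)
        finally show ?thesis by (simp add: mult_ac)
      qed
    qed
  qed simp
  also have "\<dots> = 2 * energy_const / \<mu> * (LBINT p. \<omega> (fst p) * (w p)\<^sup>2)"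
    using lborel_pair_integral(1)[OF i2] by simp
  finally show ?thesis by (simp add: wn_def)
qed

end

end

section \<open>Approximation in the mean square\<close>

text \<open>Compactness gives uniform continuity on a ball exceeding the support by 1. If two points
  at distance below 1 are not both in that ball, both lie outside the support.\<close>

lemma kern_uniformly_continuous:
  fixes \<phi> :: "'a::euclidean_space \<Rightarrow> real"
  assumes "kern \<phi>" "e > 0"
  obtains \<delta> where "\<delta> > 0" "\<And>p q. dist p q < \<delta> \<Longrightarrow> \<bar>\<phi> p - \<phi> q\<bar> < e"
proof -
  obtain R where R: "\<And>z. norm z > R \<Longrightarrow> \<phi> z = 0" using assms by (auto simp: kern_def)
  have "uniformly_continuous_on (cball 0 (R + 1)) \<phi>"
    by (rule compact_uniformly_continuous[OF kern_continuous[OF assms(1)]]) simp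
  then obtain d where d: "d > 0" "\<And>p q. p \<in> cball 0 (R + 1) \<Longrightarrow> q \<in> cball 0 (R + 1) \<Longrightarrow> dist p q < d \<Longrightarrow> \<bar>\<phi> p - \<phi> q\<bar> < e"
    using \<open>e > 0\<close> unfolding uniformly_continuous_on_def dist_real_def by (metis dist_commute)
  have "\<bar>\<phi> p - \<phi> q\<bar> < e" if pq: "dist p q < min d 1" for p q
  proof (cases "norm p \<le> R + 1 \<and> norm q \<le> R + 1")
    case True
    then show ?thesis using d(2)[of p q] pq by simp
  next
    case False
    have "\<bar>norm p - norm q\<bar> < 1"
      using pq norm_triangle_ineq3[of p q] by (simp add: dist_norm)
    then have "norm p > R" "norm q > R" using False by auto
    then show ?thesis using R \<open>e > 0\<close> by simp
  qed
  then show ?thesis using d(1) by (intro that[of "min d 1"]) auto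
qed

text \<open>Two dominated convergence arguments: \<open>w\<close> is first truncated in value and
  cut off in space, then the result is approximated by continuous functions treated in the same way.
  Each error is below \<open>e / 4\<close> because the square of a sum costs a factor 2.\<close>

lemma L2_kern_dense:
  fixes w :: "'a::euclidean_space \<Rightarrow> real"
  assumes w: "L2 w" and e: "e > 0"
  obtains \<phi> where "kern \<phi>" "(LBINT p. (w p - \<phi> p)\<^sup>2) < e"
proof -
  note [measurable] = L2_borel[OF w]
  have w2: "integrable lborel (\<lambda>p. (w p)\<^sup>2)" using w by (simp add: L2_def)
  define cl where "cl M s = max (- M) (min M s)" for M s :: real
  define \<eta> where "\<eta> M p = max 0 (min 1 (M + 1 - norm p))" for M and p :: 'a
  have \<eta>: "0 \<le> \<eta> M p" "\<eta> M p \<le> 1" for M p by (auto simp: \<eta>_def)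
  have [measurable]: "cl M \<in> borel_measurable borel" "\<eta> M \<in> borel_measurable borel" for M
    unfolding cl_def[abs_def] \<eta>_def[abs_def] by measurable
  have lim1: "(\<lambda>n. LBINT p. (w p - cl (real n) (w p) * \<eta> (real n) p)\<^sup>2) \<longlonglongrightarrow> (\<integral>p. (0::real) \<partial>(lborel :: 'a measure))"
  proof (rule integral_dominated_convergence[where w = "\<lambda>p. (w p)\<^sup>2"])
    show "AE p in lborel. (\<lambda>n. (w p - cl (real n) (w p) * \<eta> (real n) p)\<^sup>2) \<longlonglongrightarrow> 0"
    proof (intro AE_I2 tendsto_eventually)
      fix p
      show "\<forall>\<^sub>F n in sequentially. (w p - cl (real n) (w p) * \<eta> (real n) p)\<^sup>2 = 0"
      proof (rule eventually_sequentiallyI)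
        fix n assume "n \<ge> nat \<lceil>max \<bar>w p\<bar> (norm p)\<rceil>"
        then have "real n \<ge> \<bar>w p\<bar>" "real n \<ge> norm p" by linarith+
        then show "(w p - cl (real n) (w p) * \<eta> (real n) p)\<^sup>2 = 0"
          by (simp add: cl_def \<eta>_def)
      qed
    qed
    show "AE p in lborel. norm ((w p - cl (real n) (w p) * \<eta> (real n) p)\<^sup>2) \<le> (w p)\<^sup>2" for n
    proof (intro AE_I2)
      fix p
      have "\<bar>w p - cl (real n) (w p) * \<eta> (real n) p\<bar> \<le> \<bar>w p\<bar>"
      proof -
        \<comment> \<open>Truncation and cut-off together multiply \<open>w p\<close> by a number in
          \<open>[0, 1]\<close>, so the error is dominated by \<open>w p\<close>.\<close>
        have "\<exists>s. 0 \<le> s \<and> s \<le> 1 \<and> cl (real n) (w p) = s * w p"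
        proof (cases "w p = 0")
          case False
          then show ?thesis
            by (intro exI[of _ "cl (real n) (w p) / w p"]) (auto simp: cl_def divide_simps max_def min_def)
        qed (auto simp: cl_def)
        then obtain s where s: "0 \<le> s" "s \<le> 1" "cl (real n) (w p) = s * w p" by blast
        have "s * \<eta> (real n) p \<le> 1" "0 \<le> s * \<eta> (real n) p"
          using s \<eta>[of "real n" p] by (auto intro!: mult_le_one)
        then have "\<bar>1 - s * \<eta> (real n) p\<bar> * \<bar>w p\<bar> \<le> 1 * \<bar>w p\<bar>"
          by (intro mult_right_mono) auto
        moreover have "w p - cl (real n) (w p) * \<eta> (real n) p = (1 - s * \<eta> (real n) p) * w p"
          by (simp add: s(3) algebra_simps)
        ultimately show ?thesis by (simp add: abs_mult)
      qed
      then show "norm ((w p - cl (real n) (w p) * \<eta> (real n) p)\<^sup>2) \<le> (w p)\<^sup>2"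
        by (simp add: abs_le_square_iff)
    qed
  qed (use w2 in auto)
  then have "\<forall>\<^sub>F n in sequentially. (LBINT p. (w p - cl (real n) (w p) * \<eta> (real n) p)\<^sup>2) < e / 4"
    by (rule order_tendstoD) (use e in simp)
  then obtain n where n: "(LBINT p. (w p - cl (real n) (w p) * \<eta> (real n) p)\<^sup>2) < e / 4"
    by (auto simp: eventually_sequentially)
  define M where "M = real n"
  define v where "v p = cl M (w p) * \<eta> M p" for p
  have M0: "M \<ge> 0" by (simp add: M_def)
  have [measurable]: "v \<in> borel_measurable borel" unfolding v_def[abs_def] by measurable
  \<comment> \<open>Lebesgue measurability provides continuous functions converging to
    \<open>w\<close> off a negligible set, with no control of their size or support.\<close>
  have "w measurable_on UNIV"
    by (rule lebesgue_measurable_imp_measurable_on) (auto simp: measurable_completion)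
  then obtain N h where N: "negligible N" and hc: "\<And>k. continuous_on UNIV (h k)"
    and hlim: "\<And>x. x \<notin> N \<Longrightarrow> (\<lambda>k. h k x) \<longlonglongrightarrow> w x"
    unfolding measurable_on_def by auto
  have AEN: "AE x in lborel. x \<notin> N"
    using N by (simp add: negligible_iff_null_sets AE_not_in eventually_ae_filter null_sets_completion_iff2)
  \<comment> \<open>Applying the same truncation and cut-off to the continuous approximants makes
    them kernels with a common integrable majorant; both operations are continuous, so the limit
    becomes \<open>v\<close>.\<close>
  define \<phi> where "\<phi> k p = cl M (h k p) * \<eta> M p" for k p
  have \<phi>k: "kern (\<phi> k)" for k
    unfolding kern_def
  proof
    show "continuous_on UNIV (\<phi> k)"
      unfolding \<phi>_def[abs_def] cl_def \<eta>_def by (intro continuous_intros hc)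
    have "\<phi> k z = 0" if "norm z > M + 1" for z
      using that by (simp add: \<phi>_def \<eta>_def)
    then show "\<exists>R. \<forall>z. norm z > R \<longrightarrow> \<phi> k z = 0" by blast
  qed
  note [measurable] = kern_borel[OF \<phi>k]
  have cl_bound: "\<bar>cl M s\<bar> \<le> M" for s using M0 by (auto simp: cl_def)
  have \<eta>_ind: "\<eta> M p \<le> indicator (cball 0 (M + 1)) p" for p
    by (auto simp: \<eta>_def indicator_def)
  have bnd: "\<bar>cl M s * \<eta> M p\<bar> \<le> M * indicator (cball 0 (M + 1)) p" for s p
    unfolding abs_mult using \<eta>[of M p] by (intro mult_mono cl_bound) (auto simp: M0 \<eta>_ind)
  have lim2: "(\<lambda>k. LBINT p. (v p - \<phi> k p)\<^sup>2) \<longlonglongrightarrow> (\<integral>p. (0::real) \<partial>(lborel :: 'a measure))"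
  proof (rule integral_dominated_convergence[where w = "\<lambda>p. (2 * M)\<^sup>2 * indicator (cball 0 (M + 1)) p"])
    show "integrable lborel (\<lambda>p::'a. (2 * M)\<^sup>2 * indicator (cball 0 (M + 1)) p :: real)"
      by (rule integrable_cball_indicator)
    show "AE p in lborel. (\<lambda>k. (v p - \<phi> k p)\<^sup>2) \<longlonglongrightarrow> 0"
      using AEN
    proof eventually_elim
      case (elim p)
      have "(\<lambda>k. (v p - \<phi> k p)\<^sup>2) \<longlonglongrightarrow> (v p - cl M (w p) * \<eta> M p)\<^sup>2"
        unfolding \<phi>_def cl_def by (intro tendsto_intros hlim elim)
      then show ?case by (simp add: v_def)
    qed
    show "AE p in lborel. norm ((v p - \<phi> k p)\<^sup>2) \<le> (2 * M)\<^sup>2 * indicator (cball 0 (M + 1)) p" for k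
    proof (intro AE_I2)
      fix p
      have "\<bar>v p - \<phi> k p\<bar> \<le> \<bar>2 * M * indicator (cball 0 (M + 1)) p\<bar>"
        using bnd[of "w p" p] bnd[of "h k p" p] M0 by (auto simp: v_def \<phi>_def)
      then have "(v p - \<phi> k p)\<^sup>2 \<le> (2 * M * indicator (cball 0 (M + 1)) p)\<^sup>2"
        by (simp only: abs_le_square_iff)
      then show "norm ((v p - \<phi> k p)\<^sup>2) \<le> (2 * M)\<^sup>2 * indicator (cball 0 (M + 1)) p"
        by (auto simp: indicator_def split: if_splits)
    qed
  qed auto
  then have "\<forall>\<^sub>F k in sequentially. (LBINT p. (v p - \<phi> k p)\<^sup>2) < e / 4"
    by (rule order_tendstoD) (use e in simp)
  then obtain k where k: "(LBINT p. (v p - \<phi> k p)\<^sup>2) < e / 4"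
    by (auto simp: eventually_sequentially)
  have \<phi>L: "L2 (\<phi> k)" by (rule kern_L2[OF \<phi>k])
  have vL: "L2 v"
  proof (rule L2_bound[OF w])
    show "AE p in lborel. \<bar>v p\<bar> \<le> \<bar>w p\<bar>"
    proof (intro AE_I2)
      fix p
      have "\<bar>cl M (w p)\<bar> * \<bar>\<eta> M p\<bar> \<le> \<bar>w p\<bar> * 1"
        using \<eta>[of M p] M0 by (intro mult_mono) (auto simp: cl_def)
      then show "\<bar>v p\<bar> \<le> \<bar>w p\<bar>" by (simp add: v_def abs_mult)
    qed
  qed simp
  have "(LBINT p. (w p - \<phi> k p)\<^sup>2) \<le> (LBINT p. 2 * (w p - v p)\<^sup>2 + 2 * (v p - \<phi> k p)\<^sup>2)"
  proof (rule integral_mono)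
    show "(w p - \<phi> k p)\<^sup>2 \<le> 2 * (w p - v p)\<^sup>2 + 2 * (v p - \<phi> k p)\<^sup>2" for p
    proof -
      have "0 \<le> ((w p - v p) - (v p - \<phi> k p))\<^sup>2" by simp
      then show ?thesis by (simp add: power2_eq_square algebra_simps)
    qed
  qed (use L2_diff[OF w \<phi>L] L2_diff[OF w vL] L2_diff[OF vL \<phi>L] in \<open>auto simp: L2_def\<close>)
  also have "\<dots> = 2 * (LBINT p. (w p - v p)\<^sup>2) + 2 * (LBINT p. (v p - \<phi> k p)\<^sup>2)"
    using L2_diff[OF w vL] L2_diff[OF vL \<phi>L] by (simp add: L2_def)
  also have "\<dots> < e"
    using n k by (simp add: v_def M_def)
  finally show ?thesis using that[OF \<phi>k] by blast
qed

section \<open>Convergence of the mollification in the space variable\<close>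

lemma AE_lborel_fst:
  assumes "AE t in lborel. Q t"
  shows "AE p in (lborel :: ('a::euclidean_space \<times> 'b::euclidean_space) measure). Q (fst p)"
proof -
  obtain N where N: "N \<in> null_sets lborel" "{t. \<not> Q t} \<subseteq> N"
    using assms by (auto elim!: AE_E simp: null_sets_def)
  have "N \<times> UNIV \<in> null_sets (lborel \<Otimes>\<^sub>M (lborel :: 'b measure))"
    using N(1) by (auto simp: null_sets_def lborel.emeasure_pair_measure_Times intro!: pair_measureI)
  then have "N \<times> UNIV \<in> null_sets (lborel :: ('a \<times> 'b) measure)"
    by (simp add: lborel_prod)
  then show ?thesis
    by (rule AE_I') (use N(2) in auto)
qed

lemma cvx_L2_le:
  fixes u :: "real \<times> 'a::euclidean_space \<Rightarrow> real"
  assumes k: "kern k" and u: "L2 u"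
  shows "(LBINT p. (cvx k u p)\<^sup>2) \<le> (LBINT z. \<bar>k z\<bar>)\<^sup>2 * (LBINT p. (u p)\<^sup>2)"
proof -
  have i: "integrable lborel (\<lambda>p. (cvx k u p)\<^sup>2)" "integrable lborel (\<lambda>p. (u p)\<^sup>2)"
    using cvx_L2[OF k u] u by (auto simp: L2_def)
  have "(LBINT t. (LBINT x. (cvx k u (t, x))\<^sup>2))
      \<le> (LBINT t. (LBINT z. \<bar>k z\<bar>)\<^sup>2 * (LBINT x. (u (t, x))\<^sup>2))"
  proof (rule integral_mono_AE)
    show "AE t in lborel. (LBINT x. (cvx k u (t, x))\<^sup>2) \<le> (LBINT z. \<bar>k z\<bar>)\<^sup>2 * (LBINT x. (u (t, x))\<^sup>2)"
      using AE_L2_slice[OF u] by eventually_elim (use conv_L2_le[OF k] in \<open>simp add: cvx_def\<close>)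
  qed (use lborel_pair_integral(3)[OF i(1)] lborel_pair_integral(3)[OF i(2)] in auto)
  then show ?thesis
    by (simp add: lborel_pair_integral(1)[OF i(1)] lborel_pair_integral(1)[OF i(2)])
qed

text \<open>Linearity needs both integrals to exist, which is known only at times whose slices are
  square integrable; hence the equality almost everywhere.\<close>

lemma cvx_diff:
  fixes u v :: "real \<times> 'a::euclidean_space \<Rightarrow> real"
  assumes k: "kern k" and "L2 u" "L2 v"
  shows "AE p in lborel. cvx k (\<lambda>p. u p - v p) p = cvx k u p - cvx k v p"
proof -
  have "AE t in lborel. L2 (\<lambda>x. u (t, x)) \<and> L2 (\<lambda>x. v (t, x))"
    using AE_L2_slice[OF assms(2)] AE_L2_slice[OF assms(3)] by eventually_elim simp
  from AE_lborel_fst[OF this] show ?thesis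
  proof eventually_elim
    case (elim p)
    then show ?case
      using conv_integrable[OF k, of "\<lambda>x. u (fst p, x)"] conv_integrable[OF k, of "\<lambda>x. v (fst p, x)"]
      by (simp add: cvx_def conv_def right_diff_distrib)
  qed
qed

text \<open>For a kernel of small support the error at a point is an average of differences of
  \<phi>, hence uniformly small; it vanishes outside the ball of radius \<open>R + 1\<close>, whose
  volume is finite.\<close>

lemma mollify_kern_tendsto:
  fixes \<phi> :: "real \<times> (real ^ 'd::finite) \<Rightarrow> real" and g :: "nat \<Rightarrow> real \<Rightarrow> real"
  assumes \<phi>: "kern \<phi>"
    and g: "\<And>n. smooth1 (g n)" "\<And>n s. g n s \<ge> 0" "\<And>n s. \<bar>s\<bar> > 1 / real (Suc n) \<Longrightarrow> g n s = 0"
    and g1: "\<And>n. (LBINT z. kfun (g n) (\<lambda>_. 0) (z :: real ^ 'd)) = 1"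
    and e: "e > 0"
  shows "\<forall>\<^sub>F n in sequentially. (LBINT p. (cvx (kfun (g n) (\<lambda>_. 0)) \<phi> p - \<phi> p)\<^sup>2) \<le> e"
proof -
  obtain R where R: "\<And>z. norm z > R \<Longrightarrow> \<phi> z = 0" using \<phi> by (auto simp: kern_def)
  define V where "V = measure lborel (cball (0 :: real \<times> (real ^ 'd)) (R + 1))"
  \<comment> \<open>Chosen so that \<open>e'^2 * V \<le> e\<close>; the \<open>+ 1\<close> covers
    the case \<open>V = 0\<close>.\<close>
  define e' where "e' = sqrt (e / (V + 1))"
  have V: "V \<ge> 0" by (simp add: V_def)
  have e': "e' > 0" using e V by (simp add: e'_def)
  obtain \<delta> where \<delta>: "\<delta> > 0" "\<And>p q. dist p q < \<delta> \<Longrightarrow> \<bar>\<phi> p - \<phi> q\<bar> < e'"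
    using kern_uniformly_continuous[OF \<phi> e'] by metis
  \<comment> \<open>The kernel vanishes beyond \<open>CARD('d) / (n + 1)\<close> by
    \<open>kfun_support\<close>. Below \<delta> this permits uniform continuity; below 1 it keeps
    the error within the enlarged ball.\<close>
  have "(\<lambda>n. real CARD('d) * inverse (real (Suc n))) \<longlonglongrightarrow> real CARD('d) * 0"
    by (intro tendsto_intros LIMSEQ_inverse_real_of_nat)
  then have "\<forall>\<^sub>F n in sequentially. real CARD('d) * inverse (real (Suc n)) < min \<delta> 1"
    by (rule order_tendstoD) (use \<delta>(1) in simp)
  then show ?thesis
  proof eventually_elim
    case (elim n)
    define k where "k = (kfun (g n) (\<lambda>_. 0) :: real ^ 'd \<Rightarrow> real)"
    have k: "kern k" unfolding k_def by (rule kfun_kern[OF g(1) g(3)])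
    have k0: "k z \<ge> 0" for z by (auto simp: k_def kfun_def intro!: prod_nonneg g(2))
    have ksupp: "k z = 0" if "norm z \<ge> min \<delta> 1" for z
      unfolding k_def by (rule kfun_support[OF g(1) g(3)]) (use elim that in \<open>auto simp: divide_inverse\<close>)
    have kx: "integrable lborel (\<lambda>y. k (x - y))" "(LBINT y. k (x - y)) = 1" for x
    proof -
      have nn: "(\<integral>\<^sup>+y. ennreal (k (x - y)) \<partial>lborel) = ennreal 1"
        using nn_integral_reflect[of "\<lambda>y. ennreal (k y)" x] kern_borel[OF k] g1[of n]
          nn_integral_eq_integral[OF kern_integrable[OF k]] k0 by (simp add: k_def)
      show i: "integrable lborel (\<lambda>y. k (x - y))"
        using nn kern_borel[OF k] k0 by (intro integrableI_nonneg) auto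
      show "(LBINT y. k (x - y)) = 1"
        using nn nn_integral_eq_integral[OF i] k0 by (simp add: integral_nonneg_AE)
    qed
    have \<phi>c: "integrable lborel (\<lambda>y. k (x - y) * \<phi> (t, y))" for t x
    proof -
      obtain C R' where C: "\<And>z. \<bar>\<phi> z\<bar> \<le> C * indicator (cball 0 R') z" "C \<ge> 0"
        using kern_bound[OF \<phi>] by metis
      have [measurable]: "\<phi> \<in> borel_measurable borel" "k \<in> borel_measurable borel"
        using kern_borel \<phi> k by auto
      show ?thesis
      proof (rule Bochner_Integration.integrable_bound)
        show "integrable lborel (\<lambda>y. k (x - y) * C)" using kx by simp
        show "AE y in lborel. norm (k (x - y) * \<phi> (t, y)) \<le> norm (k (x - y) * C)"
        proof (intro AE_I2)
          fix y
          have "\<bar>\<phi> (t, y)\<bar> \<le> C" using C(1)[of "(t, y)"] C(2)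
            by (cases "(t, y) \<in> cball 0 R'") auto
          then show "norm (k (x - y) * \<phi> (t, y)) \<le> norm (k (x - y) * C)"
            using k0 C(2) by (simp add: abs_mult mult_left_mono)
        qed
      qed measurable
    qed
    have diff: "cvx k \<phi> (t, x) - \<phi> (t, x) = (LBINT y. k (x - y) * (\<phi> (t, y) - \<phi> (t, x)))" for t x
      using kx[of x] \<phi>c[of x t] by (simp add: cvx_def conv_def right_diff_distrib)
    have bound: "\<bar>cvx k \<phi> p - \<phi> p\<bar> \<le> e' * indicator (cball 0 (R + 1)) p" for p
    proof -
      obtain t x where p: "p = (t, x)" by (cases p)
      have "\<bar>cvx k \<phi> p - \<phi> p\<bar> \<le> (LBINT y. \<bar>k (x - y) * (\<phi> (t, y) - \<phi> (t, x))\<bar>)"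
        unfolding p diff by (rule integral_abs_bound)
      also have "\<dots> \<le> (LBINT y. k (x - y) * (e' * indicator (cball 0 (R + 1)) p))"
      proof (rule integral_mono)
        show "integrable lborel (\<lambda>y. \<bar>k (x - y) * (\<phi> (t, y) - \<phi> (t, x))\<bar>)"
          using kx(1)[of x] \<phi>c[of x t] by (simp add: right_diff_distrib)
        fix y
        show "\<bar>k (x - y) * (\<phi> (t, y) - \<phi> (t, x))\<bar> \<le> k (x - y) * (e' * indicator (cball 0 (R + 1)) p)"
        proof (cases "norm (x - y) < min \<delta> 1")
          case False
          then have "k (x - y) = 0" by (intro ksupp) linarith
          then show ?thesis by simp
        next
          case True
          have dst: "dist (t, y) (t, x) < min \<delta> 1"
            using True by (simp add: dist_Pair_Pair dist_norm norm_minus_commute)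
          have "\<bar>\<phi> (t, y) - \<phi> (t, x)\<bar> \<le> e' * indicator (cball 0 (R + 1)) p"
          proof (cases "norm p \<le> R + 1")
            case True
            then show ?thesis using \<delta>(2)[of "(t, y)" "(t, x)"] dst by simp
          next
            case False
            have "\<bar>norm (t, y) - norm (t, x)\<bar> < 1"
              using dst norm_triangle_ineq3[of "(t, y)" "(t, x)"] by (simp add: dist_norm)
            then have "norm (t, y) > R" "norm (t, x) > R" using False by (auto simp: p)
            then show ?thesis using R False by simp
          qed
          then show ?thesis using k0[of "x - y"] by (simp add: abs_mult mult_left_mono)
        qed
      qed (use kx in auto)
      also have "\<dots> = e' * indicator (cball 0 (R + 1)) p" using kx by simp
      finally show ?thesis .
    qed
    have "L2 \<phi>" by (rule kern_L2[OF \<phi>])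
    then have L: "L2 (\<lambda>p. cvx k \<phi> p - \<phi> p)" by (intro L2_diff cvx_L2 k)
    have "(LBINT p. (cvx k \<phi> p - \<phi> p)\<^sup>2) \<le> (\<integral>p. e'\<^sup>2 * indicator (cball 0 (R + 1)) p \<partial>(lborel :: (real \<times> (real ^ 'd)) measure))"
    proof (rule integral_mono)
      show "integrable lborel (\<lambda>p. (cvx k \<phi> p - \<phi> p)\<^sup>2)" using L by (simp add: L2_def)
      show "integrable lborel (\<lambda>p::real \<times> (real ^ 'd). e'\<^sup>2 * indicator (cball 0 (R + 1)) p :: real)"
        by (rule integrable_cball_indicator)
      show "(cvx k \<phi> p - \<phi> p)\<^sup>2 \<le> e'\<^sup>2 * indicator (cball 0 (R + 1)) p" for p
      proof -
        have "\<bar>cvx k \<phi> p - \<phi> p\<bar> \<le> \<bar>e' * indicator (cball 0 (R + 1)) p\<bar>"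
          using bound[of p] by linarith
        then have "(cvx k \<phi> p - \<phi> p)\<^sup>2 \<le> (e' * indicator (cball 0 (R + 1)) p)\<^sup>2"
          by (simp only: abs_le_square_iff)
        then show ?thesis by (auto simp: indicator_def split: if_splits)
      qed
    qed
    also have "\<dots> = e'\<^sup>2 * V" by (simp add: V_def)
    also have "\<dots> = e * (V / (V + 1))"
      using e V by (simp add: e'_def)
    also have "\<dots> \<le> e" using e V by (intro mult_left_le) auto
    finally show ?case by (simp add: k_def)
  qed
qed

text \<open>Density of kernels and the uniform bound of mollification on \<open>L^2\<close>. Three
  error terms of size \<open>e / 9\<close>, each weighted by the 3 from squaring a sum of three, add
  up to \<open>e\<close>.\<close>

lemma mollify_L2_tendsto:
  fixes w :: "real \<times> (real ^ 'd::finite) \<Rightarrow> real" and g :: "nat \<Rightarrow> real \<Rightarrow> real"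
  assumes w: "L2 w"
    and g: "\<And>n. smooth1 (g n)" "\<And>n s. g n s \<ge> 0" "\<And>n s. \<bar>s\<bar> > 1 / real (Suc n) \<Longrightarrow> g n s = 0"
    and g1: "\<And>n. (LBINT z. kfun (g n) (\<lambda>_. 0) (z :: real ^ 'd)) = 1"
    and e: "e > 0"
  obtains n where "(LBINT p. (cvx (kfun (g n) (\<lambda>_. 0)) w p - w p)\<^sup>2) \<le> e"
proof -
  obtain \<phi> where \<phi>: "kern \<phi>" "(LBINT p. (w p - \<phi> p)\<^sup>2) < e / 9"
    using L2_kern_dense[OF w, of "e / 9"] e by auto
  obtain n where n: "(LBINT p. (cvx (kfun (g n) (\<lambda>_. 0)) \<phi> p - \<phi> p)\<^sup>2) \<le> e / 9"
    using mollify_kern_tendsto[where g = g and e = "e / 9", OF \<phi>(1) g g1] e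
    unfolding eventually_sequentially by (metis divide_pos_pos order_refl zero_less_numeral)
  define k where "k = (kfun (g n) (\<lambda>_. 0) :: real ^ 'd \<Rightarrow> real)"
  have k: "kern k" unfolding k_def by (rule kfun_kern[OF g(1) g(3)])
  have k0: "k z \<ge> 0" for z by (auto simp: k_def kfun_def intro!: prod_nonneg g(2))
  have k1: "(LBINT z. \<bar>k z\<bar>) = 1" using k0 g1[of n] by (simp add: k_def)
  have \<phi>L: "L2 \<phi>" by (rule kern_L2[OF \<phi>(1)])
  define d where "d p = w p - \<phi> p" for p
  have dL: "L2 d" unfolding d_def[abs_def] by (rule L2_diff[OF w \<phi>L])
  have L: "L2 (cvx k d)" "L2 (\<lambda>p. cvx k \<phi> p - \<phi> p)" "L2 (\<lambda>p. cvx k w p - w p)"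
    by (intro L2_diff cvx_L2 k dL \<phi>L w)+
  have "(LBINT p. (cvx k w p - w p)\<^sup>2)
      \<le> (LBINT p. 3 * (cvx k d p)\<^sup>2 + 3 * (cvx k \<phi> p - \<phi> p)\<^sup>2 + 3 * (d p)\<^sup>2)"
  proof (rule integral_mono_AE)
    show "AE p in lborel. (cvx k w p - w p)\<^sup>2 \<le> 3 * (cvx k d p)\<^sup>2 + 3 * (cvx k \<phi> p - \<phi> p)\<^sup>2 + 3 * (d p)\<^sup>2"
      using cvx_diff[OF k w \<phi>L]
    proof eventually_elim
      case (elim p)
      define A1 where "A1 = cvx k d p"
      define A2 where "A2 = cvx k \<phi> p - \<phi> p"
      define A3 where "A3 = d p"
      have eq: "cvx k w p - w p = A1 + A2 - A3"
        using elim by (simp add: A1_def A2_def A3_def d_def[abs_def])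
      \<comment> \<open>This sum of squares is exactly the difference between the two sides of the
        inequality below.\<close>
      have "0 \<le> (A1 - A2)\<^sup>2 + (A1 + A3)\<^sup>2 + (A2 + A3)\<^sup>2" by simp
      then have "(A1 + A2 - A3)\<^sup>2 \<le> 3 * A1\<^sup>2 + 3 * A2\<^sup>2 + 3 * A3\<^sup>2"
        by (simp add: power2_eq_square algebra_simps)
      then show ?case by (simp add: eq A1_def A2_def A3_def)
    qed
  qed (use L dL in \<open>auto simp: L2_def\<close>)
  also have "\<dots> = 3 * (LBINT p. (cvx k d p)\<^sup>2) + 3 * (LBINT p. (cvx k \<phi> p - \<phi> p)\<^sup>2) + 3 * (LBINT p. (d p)\<^sup>2)"
    using L dL by (simp add: L2_def)
  also have "\<dots> \<le> 3 * (e / 9) + 3 * (e / 9) + 3 * (e / 9)"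
  proof -
    have "(LBINT p. (cvx k d p)\<^sup>2) \<le> (LBINT p. (d p)\<^sup>2)"
      using cvx_L2_le[OF k dL] by (simp add: k1)
    then show ?thesis using \<phi>(2) n by (simp add: d_def k_def)
  qed
  finally show ?thesis using that[of n] by (simp add: k_def)
qed

section \<open>Uniqueness for the homogeneous problem\<close>

context FP_homogeneous
begin

theorem solution_eq_0: "AE p in lborel. w p = 0"
proof -
  obtain g :: "nat \<Rightarrow> real \<Rightarrow> real" and \<kappa> where g: "\<And>n. smooth1 (g n)" "\<And>n s. g n s \<ge> 0"
    "\<And>n s. \<bar>s\<bar> > 1 / real (Suc n) \<Longrightarrow> g n s = 0"
    and g1: "\<And>n. (LBINT z. kfun (g n) (\<lambda>_. 0) (z :: real ^ 'd)) = 1"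
    and \<kappa>: "\<And>n j. (LBINT z. \<bar>kfun (g n) (inc j (\<lambda>_. 0)) (z :: real ^ 'd)\<bar> * norm z) \<le> \<kappa>"
    by (rule mollifiers_exist[where 'd = 'd]) blast
  \<comment> \<open>The constant depends on the mollifier only through \<kappa>, hence not on
    \<open>n\<close>.\<close>
  define C where "C = energy_const \<kappa>"
  have C0: "C \<ge> 0" unfolding C_def by (rule energy_const_nonneg[OF g(1) g(3) g(2) g1 \<kappa>])
  \<comment> \<open>Large enough for \<open>2 * C / \<mu> \<le> 1/4\<close>: passing from the
    mollified function back to \<open>w\<close> doubles this to \<open>1/2\<close>, which can still
    be absorbed, and leaves \<open>E \<le> 4 * e\<close>.\<close>
  define \<mu> where "\<mu> = 8 * C + 1"
  have \<mu>: "\<mu> > 0" using C0 by (simp add: \<mu>_def)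
  define \<omega> where "\<omega> t = indicator {0<..<T} t * exp (- \<mu> * t)" for t
  have [measurable]: "\<omega> \<in> borel_measurable borel" unfolding \<omega>_def[abs_def] by measurable
  have \<omega>: "0 \<le> \<omega> t" "\<omega> t \<le> 1" for t
    using \<mu> by (auto simp: \<omega>_def indicator_def)
  have [measurable]: "fst \<in> borel_measurable (borel :: (real \<times> (real ^ 'd)) measure)"
    unfolding borel_prod[symmetric] by measurable
  have \<omega>i: "integrable lborel (\<lambda>p. \<omega> (fst p) * (f p)\<^sup>2)" if f: "L2 f" for f :: "real \<times> (real ^ 'd) \<Rightarrow> real"
  proof (rule Bochner_Integration.integrable_bound)
    note [measurable] = L2_borel[OF f]
    show "integrable lborel (\<lambda>p. (f p)\<^sup>2)" using f by (simp add: L2_def)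
    show "AE p in lborel. norm (\<omega> (fst p) * (f p)\<^sup>2) \<le> norm ((f p)\<^sup>2)"
      using \<omega> by (intro AE_I2) (auto simp: abs_mult intro!: mult_left_le_one_le)
    show "(\<lambda>p. \<omega> (fst p) * (f p)\<^sup>2) \<in> borel_measurable lborel" by measurable
  qed
  define E where "E = (LBINT p. \<omega> (fst p) * (w p)\<^sup>2)"
  have E0: "E \<ge> 0" unfolding E_def by (rule integral_nonneg_AE) (simp add: \<omega>)
  have small: "E \<le> 4 * e" if e: "e > 0" for e
  proof -
    obtain n where n: "(LBINT p. (cvx (kfun (g n) (\<lambda>_. 0)) w p - w p)\<^sup>2) \<le> e"
      by (rule mollify_L2_tendsto[where g = g, OF w g g1 e])
    define wn where "wn = cvx (kfun (g n) (\<lambda>_. 0)) w"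
    have wnL: "L2 wn" unfolding wn_def by (rule cvx_L2[OF kfun_kern[OF g(1) g(3)] w])
    have dL: "L2 (\<lambda>p. wn p - w p)" by (rule L2_diff[OF wnL w])
    have "(LBINT p. \<omega> (fst p) * (wn p)\<^sup>2) \<le> 2 * C / \<mu> * E"
      unfolding wn_def E_def \<omega>_def C_def by (rule weighted_energy[OF g(1) g(3) g(2) g1 \<kappa> \<mu>])
    also have "\<dots> \<le> 1 / 4 * E"
      using C0 E0 \<mu> by (intro mult_right_mono) (auto simp: \<mu>_def field_simps)
    finally have en: "(LBINT p. \<omega> (fst p) * (wn p)\<^sup>2) \<le> 1 / 4 * E" .
    have "E \<le> (LBINT p. 2 * (\<omega> (fst p) * (wn p)\<^sup>2) + 2 * (wn p - w p)\<^sup>2)"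
      unfolding E_def
    proof (rule integral_mono)
      fix p
      have "0 \<le> (wn p - (w p - wn p))\<^sup>2" by simp
      then have sq: "(w p)\<^sup>2 \<le> 2 * (wn p)\<^sup>2 + 2 * (wn p - w p)\<^sup>2"
        by (simp add: power2_eq_square algebra_simps)
      have "\<omega> (fst p) * (w p)\<^sup>2 \<le> \<omega> (fst p) * (2 * (wn p)\<^sup>2 + 2 * (wn p - w p)\<^sup>2)"
        by (intro mult_left_mono sq \<omega>)
      also have "\<dots> \<le> 2 * (\<omega> (fst p) * (wn p)\<^sup>2) + 2 * (wn p - w p)\<^sup>2"
        using mult_left_le_one_le[of "(wn p - w p)\<^sup>2" "\<omega> (fst p)"] \<omega> by (simp add: algebra_simps)
      finally show "\<omega> (fst p) * (w p)\<^sup>2 \<le> 2 * (\<omega> (fst p) * (wn p)\<^sup>2) + 2 * (wn p - w p)\<^sup>2" .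
    qed (use \<omega>i[OF w] \<omega>i[OF wnL] dL in \<open>auto simp: L2_def\<close>)
    also have "\<dots> = 2 * (LBINT p. \<omega> (fst p) * (wn p)\<^sup>2) + 2 * (LBINT p. (wn p - w p)\<^sup>2)"
      using \<omega>i[OF wnL] dL by (simp add: L2_def)
    finally show ?thesis using en n by (simp add: wn_def)
  qed
  have "E \<le> 0"
  proof (rule field_le_epsilon)
    show "E \<le> 0 + e" if "e > 0" for e using small[of "e / 4"] that by simp
  qed
  with E0 have "E = 0" by simp
  then have "AE p in lborel. \<omega> (fst p) * (w p)\<^sup>2 = 0"
    unfolding E_def using integral_nonneg_eq_0_iff_AE[OF \<omega>i[OF w]] \<omega> by simp
  then show ?thesis
  proof eventually_elim
    case (elim p)
    then show ?case using w0[of "fst p" "snd p"] by (auto simp: \<omega>_def indicator_def split: if_splits)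
  qed
qed

end

section \<open>Lipschitz continuity from bounded weak derivatives\<close>

lemma frechet_derivative_space_direction:
  fixes f :: "real \<times> (real ^ 'd::finite) \<Rightarrow> real"
  assumes "f differentiable (at q)"
  shows "frechet_derivative f (at q) (0, z) = (\<Sum>k\<in>UNIV. z $ k * dx k f q)"
proof -
  have lin: "linear (frechet_derivative f (at q))"
    using assms by (rule linear_frechet_derivative)
  have "(0, z) = (\<Sum>k\<in>UNIV. z $ k *\<^sub>R (0 :: real, axis k 1 :: real ^ 'd))"
    using basis_expansion[of z] by (simp add: sum_prod scalar_mult_eq_scaleR)
  then have "frechet_derivative f (at q) (0, z) = frechet_derivative f (at q) (\<Sum>k\<in>UNIV. z $ k *\<^sub>R (0, axis k 1))"
    by simp
  also have "\<dots> = (\<Sum>k\<in>UNIV. z $ k * dx k f q)"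
    by (simp only: linear_sum[OF lin] linear_scale[OF lin] dx_def real_scaleR_def)
  finally show ?thesis .
qed

text \<open>The complement of the support is open, so a function vanishing there has vanishing
  derivatives there, and the argument can be iterated.\<close>

lemma dpart_eq_0_off_tsupp:
  assumes "p \<notin> tsupp \<phi>" shows "dpart es \<phi> p = 0"
  using assms
proof (induction es arbitrary: p)
  case Nil
  then show ?case using closure_subset[of "{p. \<phi> p \<noteq> 0}"] by (auto simp: tsupp_def)
next
  case (Cons e es)
  have "open (- tsupp \<phi>)" by (simp add: tsupp_def open_Compl)
  moreover have "((\<lambda>_. 0) has_derivative (\<lambda>_. 0)) (at p)" by simp
  ultimately have "(dpart es \<phi> has_derivative (\<lambda>_. 0)) (at p)"
    using Cons has_derivative_transform_within_open[of "\<lambda>_. 0" "\<lambda>_. 0" p UNIV "- tsupp \<phi>" "dpart es \<phi>"] by auto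
  then show ?case by (simp add: frechet_derivative_at[symmetric])
qed

lemma dpart_kern:
  assumes "smooth_fun \<phi>" "compact (tsupp \<phi>)" "set es \<subseteq> Basis"
  shows "kern (dpart es \<phi>)"
  unfolding kern_def
proof
  show "continuous_on UNIV (dpart es \<phi>)"
    using assms by (simp add: smooth_fun_def differentiable_imp_continuous_within continuous_at_imp_continuous_on)
  obtain R where R: "\<And>p. p \<in> tsupp \<phi> \<Longrightarrow> norm p \<le> R"
    using compact_imp_bounded[OF assms(2)] by (auto simp: bounded_iff)
  have "dpart es \<phi> z = 0" if "norm z > R" for z
    by (rule dpart_eq_0_off_tsupp) (use R[of z] that in auto)
  then show "\<exists>R. \<forall>z. norm z > R \<longrightarrow> dpart es \<phi> z = 0" by blast
qed

text \<open>Translates of box bumps are box bumps, so the difference-quotient argument below stays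
  within one explicit family of test functions.\<close>

lemma box_bump_shift: "box_bump n l u (p - c) = box_bump n (l + c) (u + c) p"
  by (simp add: box_bump_def tens_def bump_def inner_simps algebra_simps)

lemma test_fun_box_bump: "cbox l u \<subseteq> U \<Longrightarrow> test_fun U (box_bump n l u)"
  unfolding box_bump_def by (rule test_fun_tens[where l = l and u = u]) (auto intro!: smooth1_bump bump_eq_0)

lemma integrable_bounded_kern:
  assumes k: "kern k" and f: "f \<in> borel_measurable borel" "\<And>p. \<bar>f p\<bar> \<le> C"
  shows "integrable lborel (\<lambda>p. f p * k p)"
proof (rule Bochner_Integration.integrable_bound)
  show "integrable lborel (\<lambda>p. C * k p)" using kern_integrable[OF k] by simp
  show "AE p in lborel. norm (f p * k p) \<le> norm (C * k p)"
  proof (intro AE_I2)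
    fix p show "norm (f p * k p) \<le> norm (C * k p)"
      using f(2)[of p] by (auto simp: abs_mult intro!: mult_right_mono)
  qed
qed (use f kern_borel[OF k] in auto)

text \<open>The increment \<open>f (p + (0, z)) - f p\<close> is the integral of \<open>\<Sum>k. z\<^sub>k G\<^sub>k\<close> over the segment: both sides have the
  same integrals against test functions.\<close>

lemma weak_derivative_lipschitz:
  fixes f :: "real \<times> (real ^ 'd::finite) \<Rightarrow> real" and z :: "real ^ 'd"
  assumes f: "f \<in> borel_measurable borel" "\<And>p. \<bar>f p\<bar> \<le> A"
    and G: "\<And>k. G k \<in> borel_measurable borel" "\<And>k p. \<bar>G k p\<bar> \<le> D"
    and weak: "\<And>k \<phi>. test_fun (cyl T) \<phi> \<Longrightarrow> (LBINT p. f p * dx k \<phi> p) = - (LBINT p. G k p * \<phi> p)"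
  shows "AE p in lborel. p \<in> cyl T \<longrightarrow> \<bar>f (p + (0, z)) - f p\<bar> \<le> (\<Sum>k\<in>UNIV. \<bar>z $ k\<bar> * D)"
proof -
  define \<zeta> where "\<zeta> = (0 :: real, z)"
  define I where "I = (indicator {0..1} :: real \<Rightarrow> real)"
  have I: "integrable lborel I" "I \<in> borel_measurable borel" "\<And>r. 0 \<le> I r" "\<And>r. I r \<le> 1"
    unfolding I_def by (auto intro!: integrable_real_indicator)
  note [measurable] = f(1) G(1) I(2)
  define S where "S p = (LBINT r. I r * (\<Sum>k\<in>UNIV. z $ k * G k (p + r *\<^sub>R \<zeta>)))" for p
  define D' where "D' = (\<Sum>k\<in>UNIV. \<bar>z $ k\<bar> * D)"
  have D': "\<bar>\<Sum>k\<in>UNIV. z $ k * G k p\<bar> \<le> D'" for p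
  proof -
    have "\<bar>\<Sum>k\<in>UNIV. z $ k * G k p\<bar> \<le> (\<Sum>k\<in>UNIV. \<bar>z $ k * G k p\<bar>)" by (rule sum_abs)
    also have "\<dots> \<le> D'" unfolding D'_def abs_mult by (intro sum_mono mult_left_mono G) auto
    finally show ?thesis .
  qed
  have S_bound: "\<bar>S p\<bar> \<le> D'" for p
  proof -
    have "\<bar>S p\<bar> \<le> (LBINT r. \<bar>I r * (\<Sum>k\<in>UNIV. z $ k * G k (p + r *\<^sub>R \<zeta>))\<bar>)"
      unfolding S_def by (rule integral_abs_bound)
    also have "\<dots> \<le> (LBINT r. I r * D')"
    proof (rule integral_mono')
      show "integrable lborel (\<lambda>r. I r * D')" using I by simp
      show "\<bar>I r * (\<Sum>k\<in>UNIV. z $ k * G k (p + r *\<^sub>R \<zeta>))\<bar> \<le> I r * D'" for r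
        using I(3)[of r] D' by (simp add: abs_mult mult_left_mono)
    qed (use I(3) D' in \<open>auto intro!: mult_nonneg_nonneg order_trans[OF abs_ge_zero D']\<close>)
    also have "\<dots> = D'" by (simp add: I_def)
    finally show ?thesis .
  qed
  have [measurable]: "S \<in> borel_measurable borel"
    unfolding S_def[abs_def]
    by (rule borel_pair_integral) measurable
  define h where "h p = f (p + \<zeta>) - f p - S p" for p
  have hm: "h \<in> borel_measurable borel" unfolding h_def[abs_def] by measurable
  have h_bound: "\<bar>h p\<bar> \<le> 2 * A + D'" for p
    using f(2)[of p] f(2)[of "p + \<zeta>"] S_bound[of p] unfolding h_def by linarith
  have "AE p in lborel. p \<in> cyl T \<longrightarrow> h p = 0"
  proof (rule AE_eq_0_if_bump_integrals_0[OF _ hm])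
    show "open (cyl T :: (real \<times> (real ^ 'd)) set)"
      unfolding cyl_def by (intro open_Times) auto
    show "integrable lborel (\<lambda>p. h p * indicator (cbox l u) p)" for l u
    proof (rule Bochner_Integration.integrable_bound)
      show "integrable lborel (\<lambda>p. (2 * A + D') * indicator (cbox l u) p :: real)"
        by (intro integrable_mult_right integrable_real_indicator emeasure_lborel_cbox_finite) auto
      show "AE p in lborel. norm (h p * indicator (cbox l u) p) \<le> norm ((2 * A + D') * indicator (cbox l u) p :: real)"
        using order_trans[OF h_bound abs_ge_self] by (intro AE_I2) (simp add: abs_mult indicator_def)
    qed (use hm in auto)
    fix n and l u :: "real \<times> (real ^ 'd)"
    assume lu: "cbox l u \<subseteq> cyl T"
    define \<phi> where "\<phi> = box_bump n l u"
    have test: "test_fun (cyl T) \<phi>" unfolding \<phi>_def by (rule test_fun_box_bump[OF lu])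
    then have sm: "smooth_fun \<phi>" and cs: "compact (tsupp \<phi>)" by (auto simp: test_fun_def)
    have diff: "\<phi> differentiable (at q)" for q
      by (rule smooth_fun_differentiable[OF sm])
    have k\<phi>: "kern \<phi>" using dpart_kern[OF sm cs, of "[]"] by simp
    have kd: "kern (dx k \<phi>)" for k
      using dpart_kern[OF sm cs, of "[(0, axis k 1)]"] by (simp add: dx_def[abs_def] Basis_prod_def)
    note [measurable] = kern_borel[OF k\<phi>] kern_borel[OF kd]
    \<comment> \<open>The shift is purely spatial and therefore preserves the cylinder, so the
      translated bump is again admissible in \<open>weak\<close>.\<close>
    have shift_test: "(LBINT p. f p * dx k \<phi> (p - r *\<^sub>R \<zeta>)) = - (LBINT p. G k p * \<phi> (p - r *\<^sub>R \<zeta>))" for k r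
    proof -
      define \<phi>r where "\<phi>r p = \<phi> (p - r *\<^sub>R \<zeta>)" for p
      have "\<phi>r = box_bump n (l + r *\<^sub>R \<zeta>) (u + r *\<^sub>R \<zeta>)"
        by (simp add: fun_eq_iff \<phi>r_def \<phi>_def box_bump_shift)
      moreover have "cbox (l + r *\<^sub>R \<zeta>) (u + r *\<^sub>R \<zeta>) \<subseteq> cyl T"
      proof
        fix p assume "p \<in> cbox (l + r *\<^sub>R \<zeta>) (u + r *\<^sub>R \<zeta>)"
        then have "p - r *\<^sub>R \<zeta> \<in> cbox l u" by (auto simp: mem_box inner_simps algebra_simps)
        then have "p - r *\<^sub>R \<zeta> \<in> cyl T" using lu by blast
        then show "p \<in> cyl T" by (cases p) (auto simp: cyl_def \<zeta>_def)
      qed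
      ultimately have t: "test_fun (cyl T) \<phi>r" using test_fun_box_bump by simp
      then have d: "\<phi>r differentiable (at q)" for q
        unfolding test_fun_def by (simp add: smooth_fun_differentiable)
      have "dx k \<phi>r p = dx k \<phi> (p - r *\<^sub>R \<zeta>)" for p
        unfolding dx_def
      proof (rule directional_derivative[OF d])
        have "((\<lambda>s. \<phi> (p - r *\<^sub>R \<zeta> + s *\<^sub>R (0, axis k 1))) has_field_derivative
            frechet_derivative \<phi> (at (p - r *\<^sub>R \<zeta> + 0 *\<^sub>R (0, axis k 1))) (0, axis k 1)) (at 0)"
          by (rule DERIV_along_line[OF diff])
        moreover have "p - r *\<^sub>R \<zeta> + s *\<^sub>R (0, axis k 1) = p + s *\<^sub>R (0, axis k 1) - r *\<^sub>R \<zeta>" for s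
          by (simp add: algebra_simps)
        ultimately show "((\<lambda>s. \<phi>r (p + s *\<^sub>R (0, axis k 1))) has_field_derivative
            frechet_derivative \<phi> (at (p - r *\<^sub>R \<zeta>)) (0, axis k 1)) (at 0)"
          by (simp only: \<phi>r_def scaleR_zero_left add_0_right)
      qed
      then show ?thesis using weak[OF t, of k] by (simp add: \<phi>r_def)
    qed
    \<comment> \<open>The derivative of \<phi> in the direction \<zeta>.\<close>
    define \<Phi> where "\<Phi> q = (\<Sum>k\<in>UNIV. z $ k * dx k \<phi> q)" for q
    have k\<Phi>: "kern \<Phi>"
      unfolding \<Phi>_def[abs_def] kern_def
    proof
      show "continuous_on UNIV (\<lambda>q. \<Sum>k\<in>UNIV. z $ k * dx k \<phi> q)"
        by (intro continuous_intros kern_continuous[OF kd])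
      obtain R where R: "\<And>p. p \<in> tsupp \<phi> \<Longrightarrow> norm p \<le> R"
        using compact_imp_bounded[OF cs] by (auto simp: bounded_iff)
      have "dx k \<phi> q = 0" if "norm q > R" for k q
        using dpart_eq_0_off_tsupp[of q \<phi> "[(0, axis k 1)]"] R[of q] that by (auto simp: dx_def)
      then show "\<exists>R. \<forall>q. norm q > R \<longrightarrow> (\<Sum>k\<in>UNIV. z $ k * dx k \<phi> q) = 0" by (intro exI[of _ R]) simp
    qed
    note [measurable] = kern_borel[OF k\<Phi>]
    have ftc: "(LBINT r. \<Phi> (p - r *\<^sub>R \<zeta>) * I r) = \<phi> p - \<phi> (p - \<zeta>)" for p
    proof -
      have der: "((\<lambda>r. - \<phi> (p - r *\<^sub>R \<zeta>)) has_field_derivative \<Phi> (p - r *\<^sub>R \<zeta>)) (at r)" for r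
      proof -
        have "((\<lambda>r. \<phi> (p + r *\<^sub>R (- \<zeta>))) has_field_derivative frechet_derivative \<phi> (at (p + r *\<^sub>R (- \<zeta>))) (- \<zeta>)) (at r)"
          by (rule DERIV_along_line[OF diff])
        moreover have "frechet_derivative \<phi> (at q) (- \<zeta>) = - \<Phi> q" for q
          using frechet_derivative_space_direction[OF diff, of q "- z"] by (simp add: \<zeta>_def \<Phi>_def sum_negf)
        ultimately show ?thesis using DERIV_minus by fastforce
      qed
      have "(LBINT r. \<Phi> (p - r *\<^sub>R \<zeta>) * indicator {0..1} r) = - \<phi> (p - 1 *\<^sub>R \<zeta>) - - \<phi> (p - 0 *\<^sub>R \<zeta>)"
      proof (rule integral_FTC_Icc_real)
        show "isCont (\<lambda>r. \<Phi> (p - r *\<^sub>R \<zeta>)) r" for r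
        proof -
          have "continuous_on UNIV (\<lambda>r. \<Phi> (p - r *\<^sub>R \<zeta>))"
            by (rule continuous_on_compose2[OF kern_continuous[OF k\<Phi>, of UNIV]]) (auto intro!: continuous_intros)
          then show ?thesis by (simp add: continuous_on_eq_continuous_at)
        qed
      qed (use der in auto)
      then show ?thesis by (simp add: I_def)
    qed
    have k\<phi>r: "kern (\<lambda>p. \<phi> (p - r *\<^sub>R \<zeta>))" "kern (\<lambda>p. dx k \<phi> (p - r *\<^sub>R \<zeta>))" for k r
      using kern_shift[OF k\<phi>, of "- r *\<^sub>R \<zeta>"] kern_shift[OF kd, of _ "- r *\<^sub>R \<zeta>"] by simp_all
    have pair1: "integrable (lborel \<Otimes>\<^sub>M lborel) (case_prod (\<lambda>p r. I r * (\<Sum>k\<in>UNIV. z $ k * G k (p + r *\<^sub>R \<zeta>)) * \<phi> p))"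
    proof (rule Bochner_Integration.integrable_bound)
      show "integrable (lborel \<Otimes>\<^sub>M lborel) (\<lambda>q :: (real \<times> (real ^ 'd)) \<times> real. (D' * \<phi> (fst q)) * I (snd q))"
        by (intro integrable_tensor integrable_mult_right kern_integrable[OF k\<phi>] I)
      show "AE q in lborel \<Otimes>\<^sub>M lborel. norm (case_prod (\<lambda>p r. I r * (\<Sum>k\<in>UNIV. z $ k * G k (p + r *\<^sub>R \<zeta>)) * \<phi> p) q)
          \<le> norm (D' * \<phi> (fst q) * I (snd q))"
      proof (intro AE_I2)
        fix q :: "(real \<times> (real ^ 'd)) \<times> real"
        obtain p r where q: "q = (p, r)" by (cases q)
        have "\<bar>\<Sum>k\<in>UNIV. z $ k * G k (p + r *\<^sub>R \<zeta>)\<bar> * (\<bar>I r\<bar> * \<bar>\<phi> p\<bar>) \<le> \<bar>D'\<bar> * (\<bar>I r\<bar> * \<bar>\<phi> p\<bar>)"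
          using D'[of "p + r *\<^sub>R \<zeta>"] by (intro mult_right_mono) auto
        then show "norm (case q of (p, r) \<Rightarrow> I r * (\<Sum>k\<in>UNIV. z $ k * G k (p + r *\<^sub>R \<zeta>)) * \<phi> p)
          \<le> norm (D' * \<phi> (fst q) * I (snd q))"
          by (simp add: q abs_mult mult_ac)
      qed
    qed measurable
    obtain C0 R0 where C0: "C0 \<ge> 0" "R0 \<ge> 0" "\<And>q. \<bar>\<Phi> q\<bar> \<le> C0 * indicator (cball 0 R0) q"
      using kern_bound[OF k\<Phi>] by metis
    have A0: "A \<ge> 0" using f(2)[of 0] by simp
    have pair2: "integrable (lborel \<Otimes>\<^sub>M lborel) (case_prod (\<lambda>p r. f p * (\<Phi> (p - r *\<^sub>R \<zeta>) * I r)))"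
    proof (rule Bochner_Integration.integrable_bound)
      show "integrable (lborel \<Otimes>\<^sub>M lborel) (\<lambda>q :: (real \<times> (real ^ 'd)) \<times> real.
          ((A * C0) * indicator (cball 0 (R0 + norm \<zeta>)) (fst q)) * I (snd q))"
        by (intro integrable_tensor integrable_cball_indicator I)
      show "AE q in lborel \<Otimes>\<^sub>M lborel. norm (case_prod (\<lambda>p r. f p * (\<Phi> (p - r *\<^sub>R \<zeta>) * I r)) q)
          \<le> norm (((A * C0) * indicator (cball 0 (R0 + norm \<zeta>)) (fst q)) * I (snd q))"
      proof (intro AE_I2)
        fix q :: "(real \<times> (real ^ 'd)) \<times> real"
        obtain p r where q: "q = (p, r)" by (cases q)
        have "\<bar>\<Phi> (p - r *\<^sub>R \<zeta>)\<bar> * I r \<le> C0 * indicator (cball 0 (R0 + norm \<zeta>)) p * I r"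
        proof (cases "r \<in> {0..1} \<and> norm (p - r *\<^sub>R \<zeta>) \<le> R0")
          case True
          have "norm p \<le> norm (p - r *\<^sub>R \<zeta>) + norm (r *\<^sub>R \<zeta>)"
            using norm_triangle_ineq[of "p - r *\<^sub>R \<zeta>" "r *\<^sub>R \<zeta>"] by simp
          also have "norm (r *\<^sub>R \<zeta>) \<le> norm \<zeta>" using True by (simp add: mult_left_le_one_le)
          finally have "norm p \<le> R0 + norm \<zeta>" using True by simp
          then show ?thesis using C0(3)[of "p - r *\<^sub>R \<zeta>"] True by (intro mult_right_mono) (auto simp: I(3))
        next
          case False
          then have "\<bar>\<Phi> (p - r *\<^sub>R \<zeta>)\<bar> * I r = 0"
            using C0(3)[of "p - r *\<^sub>R \<zeta>"] by (cases "r \<in> {0..1}") (auto simp: I_def)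
          then show ?thesis using C0(1) I(3)[of r] by (auto intro!: mult_nonneg_nonneg)
        qed
        then have "\<bar>f p\<bar> * (\<bar>\<Phi> (p - r *\<^sub>R \<zeta>)\<bar> * I r) \<le> A * (C0 * indicator (cball 0 (R0 + norm \<zeta>)) p * I r)"
          by (rule mult_mono[OF f(2) _ A0]) (simp add: I(3))
        then show "norm (case q of (p, r) \<Rightarrow> f p * (\<Phi> (p - r *\<^sub>R \<zeta>) * I r))
          \<le> norm (((A * C0) * indicator (cball 0 (R0 + norm \<zeta>)) (fst q)) * I (snd q))"
          using A0 C0(1) I(3)[of r] by (simp add: q abs_mult mult_ac)
      qed
    qed measurable
    \<comment> \<open>Translation by \<open>r *\<^sub>R \<zeta>\<close> moves the shift from
      \<open>G\<close> to \<phi>, where \<open>shift_test\<close> turns \<open>G\<close> back into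
      \<open>f\<close>; integrating over \<open>r\<close> then leaves the increment of \<phi> found
      in \<open>ftc\<close>.\<close>
    have inner: "(LBINT p. I r * (\<Sum>k\<in>UNIV. z $ k * G k (p + r *\<^sub>R \<zeta>)) * \<phi> p)
        = - (LBINT p. f p * (\<Phi> (p - r *\<^sub>R \<zeta>) * I r))" for r
    proof -
      have "(LBINT p. I r * (\<Sum>k\<in>UNIV. z $ k * G k (p + r *\<^sub>R \<zeta>)) * \<phi> p)
          = (LBINT p. (\<lambda>q. I r * (\<Sum>k\<in>UNIV. z $ k * G k q) * \<phi> (q - r *\<^sub>R \<zeta>)) (p + r *\<^sub>R \<zeta>))"
        by simp
      also have "\<dots> = (LBINT p. I r * (\<Sum>k\<in>UNIV. z $ k * G k p) * \<phi> (p - r *\<^sub>R \<zeta>))"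
        by (rule integral_shift) measurable
      also have "\<dots> = (LBINT p. I r * (\<Sum>k\<in>UNIV. z $ k * (G k p * \<phi> (p - r *\<^sub>R \<zeta>))))"
        by (simp add: sum_distrib_right sum_distrib_left mult_ac)
      also have "\<dots> = I r * (\<Sum>k\<in>UNIV. z $ k * (LBINT p. G k p * \<phi> (p - r *\<^sub>R \<zeta>)))"
        using integrable_bounded_kern[OF k\<phi>r(1) G] by simp
      also have "\<dots> = - (I r * (\<Sum>k\<in>UNIV. z $ k * (LBINT p. f p * dx k \<phi> (p - r *\<^sub>R \<zeta>))))"
        by (simp add: shift_test sum_negf)
      also have "\<dots> = - (LBINT p. I r * (\<Sum>k\<in>UNIV. z $ k * (f p * dx k \<phi> (p - r *\<^sub>R \<zeta>))))"
        using integrable_bounded_kern[OF k\<phi>r(2) f] by simp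
      also have "\<dots> = - (LBINT p. f p * (\<Phi> (p - r *\<^sub>R \<zeta>) * I r))"
        by (simp add: \<Phi>_def sum_distrib_right sum_distrib_left mult_ac)
      finally show ?thesis .
    qed
    have "(LBINT p. S p * \<phi> p) = (LBINT p. (LBINT r. I r * (\<Sum>k\<in>UNIV. z $ k * G k (p + r *\<^sub>R \<zeta>)) * \<phi> p))"
      by (simp add: S_def)
    also have "\<dots> = (LBINT r. (LBINT p. I r * (\<Sum>k\<in>UNIV. z $ k * G k (p + r *\<^sub>R \<zeta>)) * \<phi> p))"
      by (rule lborel_pair.Fubini_integral[OF pair1, symmetric])
    also have "\<dots> = - (LBINT r. (LBINT p. f p * (\<Phi> (p - r *\<^sub>R \<zeta>) * I r)))"
      by (simp only: inner) simp
    also have "(LBINT r. (LBINT p. f p * (\<Phi> (p - r *\<^sub>R \<zeta>) * I r)))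
        = (LBINT p. (LBINT r. f p * (\<Phi> (p - r *\<^sub>R \<zeta>) * I r)))"
      by (rule lborel_pair.Fubini_integral[OF pair2])
    also have "\<dots> = (LBINT p. f p * \<phi> p - f p * \<phi> (p - \<zeta>))"
      by (simp add: ftc right_diff_distrib)
    also have "\<dots> = (LBINT p. f p * \<phi> p) - (LBINT p. f p * \<phi> (p - \<zeta>))"
      using integrable_bounded_kern[OF k\<phi> f] integrable_bounded_kern[OF k\<phi>r(1)[of 1] f] by simp
    also have "(LBINT p. f p * \<phi> (p - \<zeta>)) = (LBINT p. f (p + \<zeta>) * \<phi> p)"
      using integral_shift[of "\<lambda>p. f p * \<phi> (p - \<zeta>)" \<zeta>] by simp
    finally have eq: "(LBINT p. S p * \<phi> p) = (LBINT p. f (p + \<zeta>) * \<phi> p) - (LBINT p. f p * \<phi> p)"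
      by simp
    have "integrable lborel (\<lambda>p. f (p + \<zeta>) * \<phi> p)" "integrable lborel (\<lambda>p. S p * \<phi> p)"
      by (rule integrable_bounded_kern[OF k\<phi> _ f(2)], measurable)
         (rule integrable_bounded_kern[OF k\<phi> _ S_bound], measurable)
    then have "(LBINT p. h p * \<phi> p) = (LBINT p. f (p + \<zeta>) * \<phi> p) - (LBINT p. f p * \<phi> p) - (LBINT p. S p * \<phi> p)"
      using integrable_bounded_kern[OF k\<phi> f] by (simp add: h_def left_diff_distrib)
    then show "(LBINT p. h p * \<phi> p) = 0" using eq by simp
  qed
  then show ?thesis
  proof eventually_elim
    case (elim p)
    then show ?case using S_bound[of p] by (auto simp: h_def \<zeta>_def D'_def)
  qed
qed

text \<open>The exceptional set of the hypothesis depends on the increment \<open>z\<close>. Joint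
  measurability allows the order of the quantifiers to be exchanged: for almost every point the
  bound holds for almost every \<open>z\<close>. This form for almost all pairs is all that the
  commutator bound needs.\<close>

lemma AE_lipschitz_slices:
  fixes a :: "'d::finite \<Rightarrow> 'd \<Rightarrow> real \<times> (real ^ 'd) \<Rightarrow> real"
  assumes [measurable]: "\<And>i j. a i j \<in> borel_measurable borel"
    and lip: "\<And>z. AE p in lborel. \<forall>i j. \<bar>a i j (p + (0, z)) - a i j p\<bar> \<le> L * norm z"
  shows "AE t in lborel. AE x in lborel. AE y in lborel. \<forall>i j. \<bar>a i j (t, y) - a i j (t, x)\<bar> \<le> L * norm (x - y)"
proof -
  let ?P = "\<lambda>z p. \<forall>i j. \<bar>a i j (p + (0, z)) - a i j p\<bar> \<le> L * norm (z :: real ^ 'd)"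
  define D where "D i j q = \<bar>a i j (snd q + (0, fst q)) - a i j (snd q)\<bar>" for i j and q :: "(real ^ 'd) \<times> real \<times> (real ^ 'd)"
  have shift: "(\<lambda>q::(real ^ 'd) \<times> real \<times> (real ^ 'd). snd q + (0, fst q)) \<in> borel_measurable (lborel \<Otimes>\<^sub>M lborel)"
    by (intro borel_measurable_add borel_measurable_Pair borel_measurable_const) simp_all
  have D_meas: "D i j \<in> borel_measurable (lborel \<Otimes>\<^sub>M lborel)" for i j
    unfolding D_def[abs_def]
    by (intro borel_measurable_abs borel_measurable_diff measurable_compose[OF shift assms(1)]
        measurable_compose[OF _ assms(1)]) simp
  have "(\<lambda>q::(real ^ 'd) \<times> real \<times> (real ^ 'd). L * norm (fst q)) \<in> borel_measurable (lborel \<Otimes>\<^sub>M lborel)"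
    by (intro borel_measurable_times borel_measurable_norm borel_measurable_const) simp
  then have "{q \<in> space (lborel \<Otimes>\<^sub>M lborel). \<forall>i j. D i j q \<le> L * norm (fst q)} \<in> sets (lborel \<Otimes>\<^sub>M lborel)"
    by (intro sets.sets_Collect_countable_All borel_measurable_le D_meas)
  then have "{q \<in> space (lborel \<Otimes>\<^sub>M lborel). ?P (fst q) (snd q)} \<in> sets (lborel \<Otimes>\<^sub>M lborel)"
    by (simp only: D_def)
  from lborel_pair.AE_commute[OF this] lip
  have "AE p in lborel. AE z in lborel. ?P z p" by simp
  then have "AE p in lborel \<Otimes>\<^sub>M lborel. AE z in lborel. ?P z p" by (simp only: lborel_prod)
  note AEt = lborel_pair.AE_pair[OF this]
  have key: "AE y in lborel. \<forall>i j. \<bar>a i j (t, y) - a i j (t, x)\<bar> \<le> L * norm (x - y)"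
    if AEz: "AE z in lborel. ?P z (t, x)" for t x
  proof -
    let ?Q = "\<lambda>y. \<forall>i j. \<bar>a i j (t, y) - a i j (t, x)\<bar> \<le> L * norm (x - y)"
    have "(\<lambda>y. (t, y)) \<in> borel_measurable borel"
      by (intro borel_measurable_continuous_onI continuous_intros)
    then have sl: "(\<lambda>y. a i j (t, y)) \<in> borel_measurable borel" for i j
      using assms(1) by (rule measurable_compose)
    have "(\<lambda>y. \<bar>a i j (t, y) - a i j (t, x)\<bar>) \<in> borel_measurable borel" for i j
      by (intro borel_measurable_abs borel_measurable_diff sl borel_measurable_const)
    moreover have "(\<lambda>y. L * norm (x - y)) \<in> borel_measurable borel"
      by (intro borel_measurable_continuous_onI continuous_intros)
    ultimately have Q_set: "{y \<in> space borel. ?Q y} \<in> sets borel"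
      by (intro sets.sets_Collect_countable_All borel_measurable_le)
    \<comment> \<open>The substitution \<open>y = x + z\<close> turns almost every increment into
      almost every second point.\<close>
    have "AE z in lborel. ?Q (x + z)"
      using AEz by eventually_elim (simp add: norm_minus_commute)
    then have "AE y in distr lborel borel ((+) x). ?Q y"
      by (subst AE_distr_iff[OF _ Q_set]) simp_all
    then show "AE y in lborel. ?Q y" unfolding lborel_distr_plus .
  qed
  show ?thesis
    by (rule eventually_mono[OF AEt], erule eventually_mono, rule key)
qed

section \<open>Reduction to Borel functions\<close>

lemma AE_lebesgue_on_iff:
  fixes S :: "'a::euclidean_space set"
  assumes "S \<in> sets borel"
  shows "(AE p in lebesgue_on S. P p) \<longleftrightarrow> (AE p in lborel. p \<in> S \<longrightarrow> P p)"
  using assms by (subst AE_restrict_space_iff) (auto simp: AE_completion_iff)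

lemma borel_version:
  fixes f :: "'a::euclidean_space \<Rightarrow> real"
  assumes S: "S \<in> sets borel" and f: "f \<in> borel_measurable (lebesgue_on S)"
  obtains f' where "f' \<in> borel_measurable borel" "\<And>p. p \<notin> S \<Longrightarrow> f' p = 0" "AE p in lborel. p \<in> S \<longrightarrow> f' p = f p"
proof -
  have "(\<lambda>p. indicator S p *\<^sub>R f p) \<in> borel_measurable lebesgue"
    using f S by (subst (asm) borel_measurable_restrict_space_iff) auto
  then obtain g where g: "g \<in> borel_measurable lborel" "AE p in lborel. indicator S p *\<^sub>R f p = g p"
    using completion_ex_borel_measurable_real by blast
  show ?thesis
  proof
    show "(\<lambda>p. g p * indicator S p) \<in> borel_measurable borel" using g(1) S by simp
    show "AE p in lborel. p \<in> S \<longrightarrow> g p * indicator S p = f p"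
      using g(2) by eventually_elim auto
  qed simp
qed

text \<open>Bridges the two settings: the theorem speaks of the Lebesgue measure restricted to the
  cylinder, the analysis uses Borel functions on the whole space. Extension by zero and completion
  do not change integrals.\<close>

lemma lebesgue_on_transfer:
  fixes h H :: "'a::euclidean_space \<Rightarrow> real"
  assumes S: "S \<in> sets borel" and h: "h \<in> borel_measurable (lebesgue_on S)"
    and H: "H \<in> borel_measurable borel" "\<And>p. p \<notin> S \<Longrightarrow> H p = 0" and eq: "AE p in lborel. p \<in> S \<longrightarrow> H p = h p"
  shows "integral\<^sup>L (lebesgue_on S) h = (LBINT p. H p)"
    and "integrable (lebesgue_on S) h \<longleftrightarrow> integrable lborel H"
proof -
  have S': "S \<inter> space lebesgue \<in> sets lebesgue" using S by simp
  have m: "(\<lambda>p. indicator S p *\<^sub>R h p) \<in> borel_measurable lebesgue" "H \<in> borel_measurable lebesgue"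
    using h S H by (auto simp: borel_measurable_restrict_space_iff intro!: measurable_completion)
  have "AE p in lborel. indicator S p *\<^sub>R h p = H p"
    using eq by eventually_elim (use H(2) in \<open>auto simp: indicator_def\<close>)
  then have ae: "AE p in lebesgue. indicator S p *\<^sub>R h p = H p"
    by (rule AE_completion)
  have "integral\<^sup>L (lebesgue_on S) h = (\<integral>p. H p \<partial>lebesgue)"
    unfolding integral_restrict_space[OF S'] by (rule integral_cong_AE[OF m ae])
  then show "integral\<^sup>L (lebesgue_on S) h = (LBINT p. H p)"
    using H by (simp add: integral_completion)
  have "integrable (lebesgue_on S) h \<longleftrightarrow> integrable lebesgue H"
    unfolding integrable_restrict_space[OF S'] by (rule integrable_cong_AE[OF m ae])
  then show "integrable (lebesgue_on S) h \<longleftrightarrow> integrable lborel H"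
    using H by (simp add: integrable_completion)
qed

text \<open>Finiteness of the index type makes a single bound and a single exceptional set serve all
  indices at once; the bound then holds at every point, as the locale requires.\<close>

lemma ess_bounded_versions:
  fixes f :: "'i::finite \<Rightarrow> 'a::euclidean_space \<Rightarrow> real"
  assumes S: "S \<in> sets borel" and f: "\<And>i. ess_bounded_on S (f i)"
  obtains f' C where "\<And>i. f' i \<in> borel_measurable borel" "\<And>i p. \<bar>f' i p\<bar> \<le> C" "\<And>i p. p \<notin> S \<Longrightarrow> f' i p = 0"
    "AE p in lborel. p \<in> S \<longrightarrow> (\<forall>i. f' i p = f i p)"
proof -
  define Q where "Q i g c \<longleftrightarrow> g \<in> borel_measurable borel \<and> (\<forall>p. \<bar>g p\<bar> \<le> c) \<and> (\<forall>p. p \<notin> S \<longrightarrow> g p = 0) \<and>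
      (AE p in lborel. p \<in> S \<longrightarrow> g p = f i p)" for i g and c :: real
  have "\<exists>g c. Q i g c" for i
  proof -
    obtain c where fm: "f i \<in> borel_measurable (lebesgue_on S)" and c: "AE p in lebesgue_on S. \<bar>f i p\<bar> \<le> c"
      using f[of i] by (auto simp: ess_bounded_on_def)
    obtain g where g: "g \<in> borel_measurable borel" "\<And>p. p \<notin> S \<Longrightarrow> g p = 0" "AE p in lborel. p \<in> S \<longrightarrow> g p = f i p"
      using borel_version[OF S fm] by blast
    have [measurable]: "g \<in> borel_measurable borel" by fact
    have "AE p in lborel. p \<in> S \<longrightarrow> \<bar>f i p\<bar> \<le> c" using c by (rule AE_lebesgue_on_iff[OF S, THEN iffD1])
    \<comment> \<open>Points where the essential bound fails form a null set within
      \<open>S\<close>; the value is reset to 0 there.\<close>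
    with g(3) have "AE p in lborel. p \<in> S \<longrightarrow> (if \<bar>g p\<bar> \<le> c then g p else 0) = f i p"
      by eventually_elim auto
    moreover have "(\<lambda>p. if \<bar>g p\<bar> \<le> c then g p else 0) \<in> borel_measurable borel"
      by (intro measurable_If) auto
    \<comment> \<open>The everywhere bound is \<open>\<bar>c\<bar>\<close>, since \<open>c\<close>
      could be negative when \<open>S\<close> is a null set.\<close>
    ultimately show ?thesis
      using g(2) by (intro exI[of _ "\<lambda>p. if \<bar>g p\<bar> \<le> c then g p else 0"] exI[of _ "\<bar>c\<bar>"]) (auto simp: Q_def)
  qed
  then obtain f' c where "\<And>i. Q i (f' i) (c i)" by metis
  then have f': "\<And>i. f' i \<in> borel_measurable borel" "\<And>i p. \<bar>f' i p\<bar> \<le> c i" "\<And>i p. p \<notin> S \<Longrightarrow> f' i p = 0"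
    and ae: "\<And>i. AE p in lborel. p \<in> S \<longrightarrow> f' i p = f i p"
    unfolding Q_def by blast+
  show ?thesis
  proof
    have c0: "c i \<ge> 0" for i using f'(2)[of i undefined] by simp
    show "\<bar>f' i p\<bar> \<le> (\<Sum>i\<in>UNIV. c i)" for i p
      using f'(2)[of i p] member_le_sum[of i UNIV c] c0 by force
    have "AE p in lborel. \<forall>i. p \<in> S \<longrightarrow> f' i p = f i p"
      using ae by (intro eventually_all_finite) auto
    then show "AE p in lborel. p \<in> S \<longrightarrow> (\<forall>i. f' i p = f i p)"
      by eventually_elim blast
  qed (use f' in auto)
qed

lemma kern_lebesgue_on: "kern k \<Longrightarrow> k \<in> borel_measurable (lebesgue_on S)"
  by (intro measurable_restrict_space1 measurable_completion) (simp add: kern_borel)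

lemma cyl_borel: "cyl T \<in> sets (borel :: (real \<times> (real ^ 'd::finite)) measure)"
  unfolding cyl_def by (intro borel_open open_Times) auto

text \<open>All data are replaced by Borel versions vanishing off the cylinder. Bounded weak
  derivatives yield the Lipschitz bound, and the difference of the two versions then satisfies the
  homogeneous problem.\<close>

theorem theorem4p4:
  fixes T :: real
    and b :: "'d::finite \<Rightarrow> real \<times> (real ^ 'd) \<Rightarrow> real"
    and a :: "'d \<Rightarrow> 'd \<Rightarrow> real \<times> (real ^ 'd) \<Rightarrow> real"
    and u0 :: "real ^ 'd \<Rightarrow> real"
    and u v :: "real \<times> (real ^ 'd) \<Rightarrow> real"
  assumes T_pos: "T > 0"
    and b_bdd: "\<And>i. ess_bounded_on (cyl T) (b i)"
    and a_bdd: "\<And>i j. ess_bounded_on (cyl T) (a i j)"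
    and a_W1inf: "\<exists>Da :: 'd \<Rightarrow> 'd \<Rightarrow> 'd \<Rightarrow> real \<times> (real ^ 'd) \<Rightarrow> real.
         (\<forall>i j k. weak_dx (cyl T) k (a i j) (Da i j k) \<and> ess_bounded_on (cyl T) (Da i j k))
       \<and> (\<forall>i. ess_bounded_on (cyl T) (\<lambda>p. \<Sum>j\<in>UNIV. Da i j j p))
       \<and> (\<exists>h. loc_integrable_on (cyl T) h
            \<and> (\<forall>\<phi>. test_fun (cyl T) \<phi> \<longrightarrow>
                 integral\<^sup>L (lebesgue_on (cyl T)) (\<lambda>p. h p * \<phi> p)
                 = - integral\<^sup>L (lebesgue_on (cyl T))
                     (\<lambda>p. \<Sum>i\<in>UNIV. (b i p - (1/2) * (\<Sum>j\<in>UNIV. Da i j j p)) * dx i \<phi> p))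
            \<and> (\<exists>C. AE p in lebesgue_on (cyl T). max 0 (- h p) \<le> C))"
    and elliptic: "\<exists>\<alpha>>0. AE p in lebesgue_on (cyl T).
         \<forall>\<xi>::real ^ 'd. (\<Sum>i\<in>UNIV. \<Sum>j\<in>UNIV. \<xi> $ i * a i j p * \<xi> $ j) \<ge> \<alpha> * (norm \<xi>)\<^sup>2"
    and u0_loc: "loc_integrable_on UNIV u0"
    and u_sol: "FP_solution T b a u0 u"
    and v_sol: "FP_solution T b a u0 v"
  shows "AE p in lebesgue_on (cyl T). u p = v p"
proof -
  let ?S = "cyl T :: (real \<times> (real ^ 'd)) set"
  note S = cyl_borel[of T]
  obtain Da :: "'d \<Rightarrow> 'd \<Rightarrow> 'd \<Rightarrow> real \<times> (real ^ 'd) \<Rightarrow> real" where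
    wD: "\<And>i j k. weak_dx ?S k (a i j) (Da i j k)" and Db: "\<And>i j k. ess_bounded_on ?S (Da i j k)"
    using a_W1inf by blast
  obtain \<alpha> where \<alpha>: "\<alpha> > 0" and ell: "AE p in lebesgue_on ?S.
      \<forall>\<xi>::real ^ 'd. (\<Sum>i\<in>UNIV. \<Sum>j\<in>UNIV. \<xi> $ i * a i j p * \<xi> $ j) \<ge> \<alpha> * (norm \<xi>)\<^sup>2"
    using elliptic by blast
  obtain b' B where b': "\<And>i. b' i \<in> borel_measurable borel" "\<And>i p. \<bar>b' i p\<bar> \<le> B"
    "\<And>i p. p \<notin> ?S \<Longrightarrow> b' i p = 0" "AE p in lborel. p \<in> ?S \<longrightarrow> (\<forall>i. b' i p = b i p)"
    by (rule ess_bounded_versions[of ?S b, OF S b_bdd]) blast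
  \<comment> \<open>Pairs, and below triples, of indices form one finite index type, so the versions
    of all entries come with a common bound.\<close>
  obtain a2 A where a2: "\<And>i. a2 i \<in> borel_measurable borel" "\<And>i p. \<bar>a2 i p\<bar> \<le> A"
    "\<And>i p. p \<notin> ?S \<Longrightarrow> a2 i p = 0" "AE p in lborel. p \<in> ?S \<longrightarrow> (\<forall>i. a2 i p = a (fst i) (snd i) p)"
    by (rule ess_bounded_versions[of ?S "\<lambda>i. a (fst i) (snd i)", OF S a_bdd]) blast
  obtain D3 D where D3: "\<And>i. D3 i \<in> borel_measurable borel" "\<And>i p. \<bar>D3 i p\<bar> \<le> D"
    "\<And>i p. p \<notin> ?S \<Longrightarrow> D3 i p = 0"
    "AE p in lborel. p \<in> ?S \<longrightarrow> (\<forall>i. D3 i p = Da (fst i) (fst (snd i)) (snd (snd i)) p)"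
    by (rule ess_bounded_versions[of ?S "\<lambda>i. Da (fst i) (fst (snd i)) (snd (snd i))", OF S Db]) blast
  define a' where "a' i j = a2 (i, j)" for i j
  define D' where "D' i j k = D3 (i, j, k)" for i j k
  have a'_ae: "AE p in lborel. p \<in> ?S \<longrightarrow> (\<forall>i j. a' i j p = a i j p)"
    using a2(4) by eventually_elim (auto simp: a'_def)
  have D'_ae: "AE p in lborel. p \<in> ?S \<longrightarrow> (\<forall>i j k. D' i j k p = Da i j k p)"
    using D3(4) by eventually_elim (auto simp: D'_def)
  have a_meas: "a i j \<in> borel_measurable (lebesgue_on ?S)" and b_meas: "b i \<in> borel_measurable (lebesgue_on ?S)"
    and Da_meas: "Da i j k \<in> borel_measurable (lebesgue_on ?S)" for i j k
    using a_bdd b_bdd Db by (auto simp: ess_bounded_on_def)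

  have weak_a: "(LBINT p. a' i j p * dx k \<phi> p) = - (LBINT p. D' i j k p * \<phi> p)"
    if \<phi>: "test_fun ?S \<phi>" for i j k \<phi>
  proof -
    have sm: "smooth_fun \<phi>" and cs: "compact (tsupp \<phi>)" using \<phi> by (auto simp: test_fun_def)
    have k0: "kern \<phi>" using dpart_kern[OF sm cs, of "[]"] by simp
    have k1: "kern (dx k \<phi>)"
      using dpart_kern[OF sm cs, of "[(0, axis k 1)]"] by (simp add: dx_def[abs_def] Basis_prod_def)
    have "integral\<^sup>L (lebesgue_on ?S) (\<lambda>p. a i j p * dx k \<phi> p) = (LBINT p. a' i j p * dx k \<phi> p)"
    proof (rule lebesgue_on_transfer(1)[OF S])
      show "AE p in lborel. p \<in> ?S \<longrightarrow> a' i j p * dx k \<phi> p = a i j p * dx k \<phi> p"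
        using a'_ae by eventually_elim auto
    qed (use a_meas kern_lebesgue_on[OF k1] kern_borel[OF k1] a2 in \<open>auto simp: a'_def\<close>)
    moreover have "integral\<^sup>L (lebesgue_on ?S) (\<lambda>p. Da i j k p * \<phi> p) = (LBINT p. D' i j k p * \<phi> p)"
    proof (rule lebesgue_on_transfer(1)[OF S])
      show "AE p in lborel. p \<in> ?S \<longrightarrow> D' i j k p * \<phi> p = Da i j k p * \<phi> p"
        using D'_ae by eventually_elim auto
    qed (use Da_meas kern_lebesgue_on[OF k0] kern_borel[OF k0] D3 in \<open>auto simp: D'_def\<close>)
    ultimately show ?thesis
      using wD[of k i j] \<phi> by (simp add: weak_dx_def)
  qed

  \<comment> \<open>Each component of \<open>z\<close> is at most \<open>norm z\<close>, and there
    are \<open>d\<close> of them.\<close>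
  define L where "L = real CARD('d) * D"
  have D0: "D \<ge> 0" using D3(2)[of undefined 0] by simp
  have "AE p in lborel. \<bar>a' i j (p + (0, z)) - a' i j p\<bar> \<le> L * norm z" for i j z
  proof -
    have "AE p in lborel. p \<in> ?S \<longrightarrow> \<bar>a' i j (p + (0, z)) - a' i j p\<bar> \<le> (\<Sum>k\<in>UNIV. \<bar>z $ k\<bar> * D)"
      by (rule weak_derivative_lipschitz[where G = "D' i j" and T = T, OF _ _ _ _ weak_a])
         (use a2 D3 in \<open>auto simp: a'_def D'_def\<close>)
    then show ?thesis
    proof eventually_elim
      case (elim p)
      show ?case
      proof (cases "p \<in> ?S")
        case True
        have "(\<Sum>k\<in>UNIV. \<bar>z $ k\<bar> * D) \<le> (\<Sum>k\<in>(UNIV :: 'd set). norm z * D)"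
          using D0 by (intro sum_mono mult_right_mono component_le_norm_cart) auto
        also have "\<dots> = L * norm z" by (simp add: L_def)
        finally show ?thesis using elim True by simp
      next
        \<comment> \<open>A spatial shift does not lead from outside the cylinder into it, and the
          extended coefficients vanish there.\<close>
        case False
        then have "p + (0, z) \<notin> ?S" by (cases p) (auto simp: cyl_def)
        then show ?thesis using False a2(3) D0 by (simp add: a'_def L_def)
      qed
    qed
  qed
  then have "AE p in lborel. \<forall>i j. \<bar>a' i j (p + (0, z)) - a' i j p\<bar> \<le> L * norm z" for z
    by (intro eventually_all_finite)
  then have lip: "AE t in lborel. AE x in lborel. AE y in lborel. \<forall>i j. \<bar>a' i j (t, y) - a' i j (t, x)\<bar> \<le> L * norm (x - y)"
    using a2(1) by (intro AE_lipschitz_slices) (auto simp: a'_def)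

  have ell': "AE t in lborel. t \<in> {0<..<T} \<longrightarrow> (AE x in lborel. \<forall>\<xi>::real ^ 'd.
        (\<Sum>i\<in>UNIV. \<Sum>j\<in>UNIV. \<xi> $ i * a' i j (t, x) * \<xi> $ j) \<ge> \<alpha> * (norm \<xi>)\<^sup>2)"
  proof -
    have "AE p in lborel. p \<in> ?S \<longrightarrow> (\<forall>\<xi>::real ^ 'd. (\<Sum>i\<in>UNIV. \<Sum>j\<in>UNIV. \<xi> $ i * a i j p * \<xi> $ j) \<ge> \<alpha> * (norm \<xi>)\<^sup>2)"
      using ell by (rule AE_lebesgue_on_iff[OF S, THEN iffD1])
    with a'_ae have "AE p in lborel. p \<in> ?S \<longrightarrow> (\<forall>\<xi>::real ^ 'd. (\<Sum>i\<in>UNIV. \<Sum>j\<in>UNIV. \<xi> $ i * a' i j p * \<xi> $ j) \<ge> \<alpha> * (norm \<xi>)\<^sup>2)"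
      by eventually_elim simp
    then have "AE p in lborel \<Otimes>\<^sub>M lborel. p \<in> ?S \<longrightarrow> (\<forall>\<xi>::real ^ 'd. (\<Sum>i\<in>UNIV. \<Sum>j\<in>UNIV. \<xi> $ i * a' i j p * \<xi> $ j) \<ge> \<alpha> * (norm \<xi>)\<^sup>2)"
      by (simp only: lborel_prod)
    from lborel_pair.AE_pair[OF this] show ?thesis
    proof (rule eventually_mono)
      fix t :: real
      assume *: "AE x in lborel. (t, x) \<in> ?S \<longrightarrow> (\<forall>\<xi>::real ^ 'd. (\<Sum>i\<in>UNIV. \<Sum>j\<in>UNIV. \<xi> $ i * a' i j (t, x) * \<xi> $ j) \<ge> \<alpha> * (norm \<xi>)\<^sup>2)"
      have "AE x in lborel. \<forall>\<xi>::real ^ 'd. (\<Sum>i\<in>UNIV. \<Sum>j\<in>UNIV. \<xi> $ i * a' i j (t, x) * \<xi> $ j) \<ge> \<alpha> * (norm \<xi>)\<^sup>2"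
        if t: "t \<in> {0<..<T}"
        using * by (rule eventually_mono) (use t in \<open>auto simp: cyl_def\<close>)
      then show "t \<in> {0<..<T} \<longrightarrow> (AE x in lborel. \<forall>\<xi>::real ^ 'd. (\<Sum>i\<in>UNIV. \<Sum>j\<in>UNIV. \<xi> $ i * a' i j (t, x) * \<xi> $ j) \<ge> \<alpha> * (norm \<xi>)\<^sup>2)"
        by blast
    qed
  qed

  define \<Phi> where "\<Phi> \<phi> p = dt \<phi> p + (\<Sum>i\<in>UNIV. b' i p * dx i \<phi> p)
      + (1/2) * (\<Sum>i\<in>UNIV. \<Sum>j\<in>UNIV. a' i j p * dx i (dx j \<phi>) p)" for \<phi> p
  \<comment> \<open>For either solution the space-time integral equals the same initial term, which
    cancels in the difference; integrability is recorded so that the integrals may be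
    subtracted.\<close>
  have sol: "\<exists>s'. L2 s' \<and> (\<forall>p. p \<notin> ?S \<longrightarrow> s' p = 0) \<and> (AE p in lborel. p \<in> ?S \<longrightarrow> s' p = s p) \<and>
      (\<forall>\<phi>. test_fun_FP T \<phi> \<longrightarrow> integrable lborel (\<lambda>p. s' p * \<Phi> \<phi> p) \<and>
        (LBINT p. s' p * \<Phi> \<phi> p) = - integral\<^sup>L lebesgue (\<lambda>x. u0 x * \<phi> (0, x)))"
    if s: "FP_solution T b a u0 s" for s
  proof -
    have sm: "s \<in> borel_measurable (lebesgue_on ?S)" and s2: "integrable (lebesgue_on ?S) (\<lambda>p. (s p)\<^sup>2)"
      using s by (auto simp: FP_solution_def L2_on_def)
    obtain s' where s': "s' \<in> borel_measurable borel" "\<And>p. p \<notin> ?S \<Longrightarrow> s' p = 0" "AE p in lborel. p \<in> ?S \<longrightarrow> s' p = s p"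
      using borel_version[OF S sm] by blast
    have "integrable (lebesgue_on ?S) (\<lambda>p. (s p)\<^sup>2) \<longleftrightarrow> integrable lborel (\<lambda>p. (s' p)\<^sup>2)"
    proof (rule lebesgue_on_transfer(2)[OF S])
      show "AE p in lborel. p \<in> ?S \<longrightarrow> (s' p)\<^sup>2 = (s p)\<^sup>2"
        using s'(3) by eventually_elim auto
    qed (use sm s' in auto)
    then have L2s: "L2 s'" using s2 s' by (simp add: L2_def)
    have "integrable lborel (\<lambda>p. s' p * \<Phi> \<phi> p) \<and>
        (LBINT p. s' p * \<Phi> \<phi> p) = - integral\<^sup>L lebesgue (\<lambda>x. u0 x * \<phi> (0, x))" if \<phi>: "test_fun_FP T \<phi>" for \<phi>
    proof -
      have sm\<phi>: "smooth_fun \<phi>" and cs: "compact (tsupp \<phi>)" using \<phi> by (auto simp: test_fun_FP_def)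
      have kt: "kern (dt \<phi>)"
        using dpart_kern[OF sm\<phi> cs, of "[(1, 0)]"] by (simp add: dt_def[abs_def] Basis_prod_def)
      have kx: "kern (dx i \<phi>)" for i
        using dpart_kern[OF sm\<phi> cs, of "[(0, axis i 1)]"] by (simp add: dx_def[abs_def] Basis_prod_def)
      have kxx: "kern (dx i (dx j \<phi>))" for i j
        using dpart_kern[OF sm\<phi> cs, of "[(0, axis i 1), (0, axis j 1)]"] by (simp add: dx_def[abs_def] Basis_prod_def)
      have \<Phi>L: "L2 (\<Phi> \<phi>)"
        unfolding \<Phi>_def[abs_def] a'_def
        by (intro L2_add L2_sum L2_scale kern_L2 kt L2_bounded_mult[OF kern_L2[OF kx] b'(1,2)]
            L2_bounded_mult[OF kern_L2[OF kxx] a2(1,2)])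
      have "integral\<^sup>L (lebesgue_on ?S)
          (\<lambda>p. s p * (dt \<phi> p + (\<Sum>i\<in>UNIV. b i p * dx i \<phi> p)
                 + (1/2) * (\<Sum>i\<in>UNIV. \<Sum>j\<in>UNIV. a i j p * dx i (dx j \<phi>) p))) = (LBINT p. s' p * \<Phi> \<phi> p)"
      proof (rule lebesgue_on_transfer(1)[OF S])
        show "(\<lambda>p. s p * (dt \<phi> p + (\<Sum>i\<in>UNIV. b i p * dx i \<phi> p)
                 + (1/2) * (\<Sum>i\<in>UNIV. \<Sum>j\<in>UNIV. a i j p * dx i (dx j \<phi>) p))) \<in> borel_measurable (lebesgue_on ?S)"
          by (intro borel_measurable_times borel_measurable_add borel_measurable_sum borel_measurable_const
              sm a_meas b_meas kern_lebesgue_on kt kx kxx)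
        show "AE p in lborel. p \<in> ?S \<longrightarrow> s' p * \<Phi> \<phi> p = s p * (dt \<phi> p + (\<Sum>i\<in>UNIV. b i p * dx i \<phi> p)
                 + (1/2) * (\<Sum>i\<in>UNIV. \<Sum>j\<in>UNIV. a i j p * dx i (dx j \<phi>) p))"
          using s'(3) a'_ae b'(4) by eventually_elim (simp add: \<Phi>_def)
      qed (use s' L2_borel[OF \<Phi>L] in auto)
      moreover have "integral\<^sup>L (lebesgue_on ?S)
          (\<lambda>p. s p * (dt \<phi> p + (\<Sum>i\<in>UNIV. b i p * dx i \<phi> p)
                 + (1/2) * (\<Sum>i\<in>UNIV. \<Sum>j\<in>UNIV. a i j p * dx i (dx j \<phi>) p)))
          + integral\<^sup>L lebesgue (\<lambda>x. u0 x * \<phi> (0, x)) = 0"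
        using s \<phi> by (simp add: FP_solution_def)
      ultimately show ?thesis using L2_mult_integrable[OF L2s \<Phi>L] by simp
    qed
    then show ?thesis using L2s s' by (intro exI[of _ s']) auto
  qed
  obtain u' where u': "L2 u'" "\<And>p. p \<notin> ?S \<Longrightarrow> u' p = 0" "AE p in lborel. p \<in> ?S \<longrightarrow> u' p = u p"
    "\<And>\<phi>. test_fun_FP T \<phi> \<Longrightarrow> integrable lborel (\<lambda>p. u' p * \<Phi> \<phi> p)"
    "\<And>\<phi>. test_fun_FP T \<phi> \<Longrightarrow> (LBINT p. u' p * \<Phi> \<phi> p) = - integral\<^sup>L lebesgue (\<lambda>x. u0 x * \<phi> (0, x))"
    using sol[OF u_sol] by blast
  obtain v' where v': "L2 v'" "\<And>p. p \<notin> ?S \<Longrightarrow> v' p = 0" "AE p in lborel. p \<in> ?S \<longrightarrow> v' p = v p"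
    "\<And>\<phi>. test_fun_FP T \<phi> \<Longrightarrow> integrable lborel (\<lambda>p. v' p * \<Phi> \<phi> p)"
    "\<And>\<phi>. test_fun_FP T \<phi> \<Longrightarrow> (LBINT p. v' p * \<Phi> \<phi> p) = - integral\<^sup>L lebesgue (\<lambda>x. u0 x * \<phi> (0, x))"
    using sol[OF v_sol] by blast
  interpret FP_homogeneous T B A L \<alpha> b' a' "\<lambda>p. u' p - v' p"
  proof
    show "L2 (\<lambda>p. u' p - v' p)" by (rule L2_diff[OF u'(1) v'(1)])
    show "u' (t, x) - v' (t, x) = 0" if "t \<notin> {0<..<T}" for t x
      using u'(2)[of "(t, x)"] v'(2)[of "(t, x)"] that by (simp add: cyl_def)
    show "a' i j \<in> borel_measurable borel" "\<bar>a' i j p\<bar> \<le> A" for i j p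
      using a2 by (auto simp: a'_def)
    show "(LBINT p. (u' p - v' p) * (dt \<phi> p + (\<Sum>i\<in>UNIV. b' i p * dx i \<phi> p)
          + (1/2) * (\<Sum>i\<in>UNIV. \<Sum>j\<in>UNIV. a' i j p * dx i (dx j \<phi>) p))) = 0" if \<phi>: "test_fun_FP T \<phi>" for \<phi>
      unfolding \<Phi>_def[symmetric] left_diff_distrib using u'(4,5)[OF \<phi>] v'(4,5)[OF \<phi>] by simp
  qed (fact b' lip ell' \<alpha>)+
  from solution_eq_0 u'(3) v'(3) have "AE p in lborel. p \<in> ?S \<longrightarrow> u p = v p"
    by eventually_elim auto
  then show ?thesis by (rule AE_lebesgue_on_iff[OF S, THEN iffD2])
qed

end
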